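(* Let $V_1 \to V_2 \to \cdots$ be a coherent sequence of representations of the symmetric groups over a field $\mathbb{F}$ which is centrally stable starting at $N$. Assume that either $\operatorname{char}(\mathbb{F})=0$ or $\operatorname{char}(\mathbb{F}) \geq 2N+2$. Consider $n$, $m$, $M$ with $2N+1 \leq n \leq m \leq M$. Then the $M$-central stability chain complex $$\mathrm{IA}_{M-n}(V_n) \xrightarrow{\partial_n} \mathrm{IA}_{M-n-1}(V_{n+1}) \xrightarrow{\partial_{n+1}} \cdots \xrightarrow{\partial_{m-1}} \mathrm{IA}_{M-m}(V_m)$$ associated to the (potentially centrally stable) sequence $V_n \to V_{n+1} \to \cdots \to V_m$ is exact, i.e. exact at the term $\mathrm{IA}_{M-i}(V_i)$ for every $n < i < m$.
   Context: Representations are over $\mathbb{F}$ and may be infinite-dimensional. $S_{n}\subset S_{n+1}$ is the standard inclusion; $S_Y$ denotes the symmetric group on a set $Y$; $(-1)^{|\sigma|}$ is the sign of a permutation $\sigma$. **Central stability.** A coherent sequence is a sequence $V_1 \xrightarrow{\phi_1} V_2 \xrightarrow{\phi_2} \cdots$ with $V_n$ a representation of $S_n$ and $\phi_n$ linear and $S_n$-equivariant. For an $S_{n-1}$-equivariant map $\phi_{n-1}: V_{n-1} \to V_n$ from a representation of $S_{n-1}$ to one of $S_n$, let $W = \operatorname{Ind}_{S_n}^{S_{n+1}} V_n$, let $\phi'_{n-1}: V_{n-1} \to W$ be the composition of $\phi_{n-1}$ with the natural inclusion $V_n \hookrightarrow W$, and let $U \subset W$ be the span of the $S_{n+1}$-orbit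 of $\{\vec v - (n,n+1)\cdot \vec v : \vec v \in \phi'_{n-1}(V_{n-1})\}$. The central stabilization of $\phi_{n-1}$ is $\mathcal{C}(V_{n-1} \xrightarrow{\phi_{n-1}} V_n) = W/U$; it comes with a natural $S_n$-equivariant map from $V_n$. A coherent sequence is centrally stable starting at $N \geq 2$ if for all $n \geq N$ one has $V_{n+1} = \mathcal{C}(V_{n-1} \xrightarrow{\phi_{n-1}} V_n)$ with $\phi_n$ the natural map (i.e. there is an $S_{n+1}$-equivariant isomorphism carrying $\phi_n$ to the natural map). **Potential central stability.** A sequence $V_n \to V_{n+1}\to \cdots \to V_m$ ($V_i$ a representation of $S_i$, maps $V_i \to V_{i+1}$ being $S_i$-equivariant) is potentially centrally stable if for all $n \leq i<j \leq m$, every $\vec v \in V_j$ in the image of $V_i$ satisfies $\sigma\cdot\vec v = \vec v$ for all $\sigma \in S_{\{i+1,\ldots,j\}}$. (For a sequence centrally stable from $N$ this holds in the range considered.) **Chain complex.** Let $\mathcal{A}_k$ be the sign representation of $S_k$. For a representation $V$ of $S_n$ and $k \geq 0$ set $\mathrm{IA}_k(V) = \operatorname{Ind}_{S_n\times S_k}^{S_{n+k}} (V \boxtimes \mathcal{A}_k)$ (external tensor product); $V$ is regarded as a subspace of $\mathrm{IA}_k(V)$. Given an $S_i$-equivariant map $\phi_i: V_i \to V_{i+1}$ and $M>i$, the $M$-boundary map $\partial_i: \mathrm{IA}_{M-i}(V_i) \to \mathrm{IA}_{M-i-1}(V_{i+1})$ is the unique $S_M$-equivariant map whose restriction to $V_i$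 is $\vec v \mapsto \sum_{\sigma \in C_i} (-1)^{|\sigma|}\sigma\cdot\phi_i(\vec v)$, where $C_i$ is any set of representatives of the cosets $\sigma S_{\{i+2,\ldots,M\}}$ in $S_{\{i+1,\ldots,M\}}$ (the result is independent of $C_i$ and well defined). The $M$-central stability chain complex of a potentially centrally stable sequence $V_n \to \cdots \to V_m$, $M \geq m$, is the sequence of these maps, as displayed in the claim. *)

theory Defs
  imports
    "HOL-Combinatorics.Combinatorics"
    "HOL-Computational_Algebra.Computational_Algebra"
    "HOL-Library.Function_Algebras"
    "HOL-Library.FuncSet"
begin

text \<open>
  All vector spaces are subspaces (given by their carrier sets) of an ambient vector space over the
  field \<^typ>\<open>'f\<close>. A whole sequence of vector spaces lives in one ambient space; this is no
  restriction, because any sequence of vector spaces embeds into its direct sum. No relation between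
  the members of a sequence (such as disjointness or inclusion) is assumed.
\<close>

abbreviation symgrp :: "nat set \<Rightarrow> (nat \<Rightarrow> nat) set" where
  "symgrp Y \<equiv> {p. p permutes Y}"

text \<open>With permutations as functions on all of \<^typ>\<open>nat\<close>, the standard inclusion of \<open>S\<^sub>n\<close> in
  \<open>S\<^sub>n\<^sub>+\<^sub>1\<close>, and that of the symmetric group on a subset, is an inclusion of sets.\<close>

abbreviation S :: "nat \<Rightarrow> (nat \<Rightarrow> nat) set" where
  "S n \<equiv> symgrp {1..n}"

definition linear_map_on ::
  "('f::field \<Rightarrow> 'v::ab_group_add \<Rightarrow> 'v) \<Rightarrow> ('f \<Rightarrow> 'w::ab_group_add \<Rightarrow> 'w)
     \<Rightarrow> 'v set \<Rightarrow> ('v \<Rightarrow> 'w) \<Rightarrow> bool" where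
  "linear_map_on s1 s2 V f \<longleftrightarrow>
     (\<forall>x\<in>V. \<forall>y\<in>V. f (x + y) = f x + f y) \<and> (\<forall>c. \<forall>x\<in>V. f (s1 c x) = s2 c (f x))"

definition representation ::
  "('f::field \<Rightarrow> 'v::ab_group_add \<Rightarrow> 'v) \<Rightarrow> (nat \<Rightarrow> nat) set \<Rightarrow> 'v set
     \<Rightarrow> ((nat \<Rightarrow> nat) \<Rightarrow> 'v \<Rightarrow> 'v) \<Rightarrow> bool" where
  "representation s G V \<rho> \<longleftrightarrow>
     module.subspace s V \<and>
     (\<forall>g\<in>G. \<rho> g ` V \<subseteq> V \<and> linear_map_on s s V (\<rho> g)) \<and>
     (\<forall>v\<in>V. \<rho> id v = v) \<and>
     (\<forall>g\<in>G. \<forall>h\<in>G. \<forall>v\<in>V. \<rho> (g \<circ> h) v = \<rho> g (\<rho> h v))"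

definition equivariant_on ::
  "(nat \<Rightarrow> nat) set \<Rightarrow> 'v set \<Rightarrow> ((nat \<Rightarrow> nat) \<Rightarrow> 'v \<Rightarrow> 'v) \<Rightarrow> ((nat \<Rightarrow> nat) \<Rightarrow> 'w \<Rightarrow> 'w)
     \<Rightarrow> ('v \<Rightarrow> 'w) \<Rightarrow> bool" where
  "equivariant_on G V \<rho>V \<rho>W f \<longleftrightarrow> (\<forall>g\<in>G. \<forall>v\<in>V. f (\<rho>V g v) = \<rho>W g (f v))"

definition coherent_sequence ::
  "('f::field \<Rightarrow> 'v::ab_group_add \<Rightarrow> 'v) \<Rightarrow> (nat \<Rightarrow> 'v set)
     \<Rightarrow> (nat \<Rightarrow> (nat \<Rightarrow> nat) \<Rightarrow> 'v \<Rightarrow> 'v) \<Rightarrow> (nat \<Rightarrow> 'v \<Rightarrow> 'v) \<Rightarrow> bool" where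
  "coherent_sequence s V \<rho> \<phi> \<longleftrightarrow>
     (\<forall>n\<ge>1. representation s (S n) (V n) (\<rho> n) \<and>
        \<phi> n ` V n \<subseteq> V (n + 1) \<and> linear_map_on s s (V n) (\<phi> n) \<and>
        equivariant_on (S n) (V n) (\<rho> n) (\<rho> (n + 1)) (\<phi> n))"


section \<open>Induced representations\<close>

text \<open>
  For a finite group \<open>G\<close> of permutations, a subgroup \<open>H\<close> and a representation \<open>V\<close> of \<open>H\<close>, the
  induced representation is realised as the space of functions \<open>f : G \<rightarrow> V\<close> with
  \<open>f (g h) = h\<inverse> f(g)\<close> for \<open>h\<close> in \<open>H\<close>, extended by zero outside \<open>G\<close>; a permutation \<open>x\<close> in \<open>G\<close> sends
  \<open>f\<close> to \<open>g \<mapsto> f (x\<inverse> g)\<close>. The function \<open>f\<close> corresponds to the sum of \<open>g \<otimes> f(g)\<close> over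
  representatives \<open>g\<close> of \<open>G/H\<close> in \<open>F[G] \<otimes>\<^bsub>F[H]\<^esub> V\<close>, and \<open>ind_incl\<close> to \<open>v \<mapsto> 1 \<otimes> v\<close>.
\<close>

definition fun_scale :: "('f \<Rightarrow> 'v \<Rightarrow> 'v) \<Rightarrow> 'f \<Rightarrow> ('a \<Rightarrow> 'v) \<Rightarrow> ('a \<Rightarrow> 'v)" where
  "fun_scale s c f = (\<lambda>x. s c (f x))"

definition ind :: "(nat \<Rightarrow> nat) set \<Rightarrow> (nat \<Rightarrow> nat) set \<Rightarrow> 'v::ab_group_add set
     \<Rightarrow> ((nat \<Rightarrow> nat) \<Rightarrow> 'v \<Rightarrow> 'v) \<Rightarrow> ((nat \<Rightarrow> nat) \<Rightarrow> 'v) set" where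
  "ind G H V \<rho> = {f. (\<forall>g\<in>G. f g \<in> V) \<and> (\<forall>g. g \<notin> G \<longrightarrow> f g = 0) \<and>
     (\<forall>g\<in>G. \<forall>h\<in>H. f (g \<circ> h) = \<rho> (inv h) (f g))}"

definition ind_act :: "(nat \<Rightarrow> nat) \<Rightarrow> ((nat \<Rightarrow> nat) \<Rightarrow> 'v) \<Rightarrow> (nat \<Rightarrow> nat) \<Rightarrow> 'v" where
  "ind_act x f = (\<lambda>g. f (inv x \<circ> g))"

definition ind_incl :: "(nat \<Rightarrow> nat) set \<Rightarrow> ((nat \<Rightarrow> nat) \<Rightarrow> 'v::ab_group_add \<Rightarrow> 'v)
     \<Rightarrow> 'v \<Rightarrow> (nat \<Rightarrow> nat) \<Rightarrow> 'v" where
  "ind_incl H \<rho> v = (\<lambda>g. if g \<in> H then \<rho> (inv g) v else 0)"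


section \<open>Central stability\<close>

text \<open>The subspace \<open>U\<close> of \<open>W = Ind V\<^sub>n\<close> attached to an equivariant map
  \<open>f : V\<^sub>n\<^sub>-\<^sub>1 \<rightarrow> V\<^sub>n\<close>; here \<open>A = V\<^sub>n\<^sub>-\<^sub>1\<close>, and \<open>\<rho>\<close> is the action on \<open>V\<^sub>n\<close>.\<close>

definition cstab_relations ::
  "('f::field \<Rightarrow> 'v::ab_group_add \<Rightarrow> 'v) \<Rightarrow> nat \<Rightarrow> 'v set \<Rightarrow> ('v \<Rightarrow> 'v)
     \<Rightarrow> ((nat \<Rightarrow> nat) \<Rightarrow> 'v \<Rightarrow> 'v) \<Rightarrow> ((nat \<Rightarrow> nat) \<Rightarrow> 'v) set" where
  "cstab_relations s n A f \<rho> = module.span (fun_scale s)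
     {ind_act g (w - ind_act (transpose n (n + 1)) w) | g w.
        g \<in> S (n + 1) \<and> w \<in> (\<lambda>v. ind_incl (S n) \<rho> (f v)) ` A}"

definition coset :: "'w::ab_group_add set \<Rightarrow> 'w \<Rightarrow> 'w set" where
  "coset U w = {w + u | u. u \<in> U}"

definition coset_add :: "'w::ab_group_add set \<Rightarrow> 'w set \<Rightarrow> 'w set" where
  "coset_add X Y = {x + y | x y. x \<in> X \<and> y \<in> Y}"

text \<open>Adding \<open>U\<close> makes the product of the scalar \<open>0\<close> with any coset equal to \<open>U\<close> rather than \<open>{0}\<close>.\<close>

definition coset_scale :: "('f \<Rightarrow> 'w \<Rightarrow> 'w) \<Rightarrow> 'w::ab_group_add set \<Rightarrow> 'f \<Rightarrow> 'w set \<Rightarrow> 'w set" where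
  "coset_scale s U c X = {s c x + u | x u. x \<in> X \<and> u \<in> U}"

text \<open>The central stabilization \<open>W/U\<close>, as a set of cosets, for \<open>f : A \<rightarrow> B\<close> with \<open>A = V\<^sub>n\<^sub>-\<^sub>1\<close> and
  \<open>B = V\<^sub>n\<close>. A permutation acts on it by taking images of cosets.\<close>

definition central_stabilization ::
  "('f::field \<Rightarrow> 'v::ab_group_add \<Rightarrow> 'v) \<Rightarrow> nat \<Rightarrow> 'v set \<Rightarrow> ('v \<Rightarrow> 'v) \<Rightarrow> 'v set
     \<Rightarrow> ((nat \<Rightarrow> nat) \<Rightarrow> 'v \<Rightarrow> 'v) \<Rightarrow> ((nat \<Rightarrow> nat) \<Rightarrow> 'v) set set" where
  "central_stabilization s n A f B \<rho> =
     coset (cstab_relations s n A f \<rho>) ` ind (S (n + 1)) (S n) B \<rho>"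

definition cstab_natural_map ::
  "('f::field \<Rightarrow> 'v::ab_group_add \<Rightarrow> 'v) \<Rightarrow> nat \<Rightarrow> 'v set \<Rightarrow> ('v \<Rightarrow> 'v)
     \<Rightarrow> ((nat \<Rightarrow> nat) \<Rightarrow> 'v \<Rightarrow> 'v) \<Rightarrow> 'v \<Rightarrow> ((nat \<Rightarrow> nat) \<Rightarrow> 'v) set" where
  "cstab_natural_map s n A f \<rho> v = coset (cstab_relations s n A f \<rho>) (ind_incl (S n) \<rho> v)"

text \<open>\<open>F\<close> is an \<open>S\<^sub>n\<^sub>+\<^sub>1\<close>-equivariant linear isomorphism from the central stabilization of
  \<open>\<phi>\<^sub>n\<^sub>-\<^sub>1\<close> to \<open>V\<^sub>n\<^sub>+\<^sub>1\<close> carrying the natural map to \<open>\<phi>\<^sub>n\<close>.\<close>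

definition cstab_iso ::
  "('f::field \<Rightarrow> 'v::ab_group_add \<Rightarrow> 'v) \<Rightarrow> (nat \<Rightarrow> 'v set)
     \<Rightarrow> (nat \<Rightarrow> (nat \<Rightarrow> nat) \<Rightarrow> 'v \<Rightarrow> 'v) \<Rightarrow> (nat \<Rightarrow> 'v \<Rightarrow> 'v) \<Rightarrow> nat
     \<Rightarrow> (((nat \<Rightarrow> nat) \<Rightarrow> 'v) set \<Rightarrow> 'v) \<Rightarrow> bool" where
  "cstab_iso s V \<rho> \<phi> n F \<longleftrightarrow>
     (let Q = central_stabilization s n (V (n - 1)) (\<phi> (n - 1)) (V n) (\<rho> n);
          U = cstab_relations s n (V (n - 1)) (\<phi> (n - 1)) (\<rho> n)
      in bij_betw F Q (V (n + 1)) \<and>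
         (\<forall>X\<in>Q. \<forall>Y\<in>Q. F (coset_add X Y) = F X + F Y) \<and>
         (\<forall>c. \<forall>X\<in>Q. F (coset_scale (fun_scale s) U c X) = s c (F X)) \<and>
         equivariant_on (S (n + 1)) Q (\<lambda>g X. ind_act g ` X) (\<rho> (n + 1)) F \<and>
         (\<forall>v\<in>V n. F (cstab_natural_map s n (V (n - 1)) (\<phi> (n - 1)) (\<rho> n) v) = \<phi> n v))"

definition centrally_stable_from ::
  "('f::field \<Rightarrow> 'v::ab_group_add \<Rightarrow> 'v) \<Rightarrow> (nat \<Rightarrow> 'v set)
     \<Rightarrow> (nat \<Rightarrow> (nat \<Rightarrow> nat) \<Rightarrow> 'v \<Rightarrow> 'v) \<Rightarrow> (nat \<Rightarrow> 'v \<Rightarrow> 'v) \<Rightarrow> nat \<Rightarrow> bool" where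
  "centrally_stable_from s V \<rho> \<phi> N \<longleftrightarrow> N \<ge> 2 \<and> (\<forall>n\<ge>N. \<exists>F. cstab_iso s V \<rho> \<phi> n F)"


section \<open>The central stability chain complex\<close>

text \<open>\<open>S\<^sub>n \<times> S\<^sub>k\<close> as a subgroup of \<open>S\<^sub>n\<^sub>+\<^sub>k\<close>, the factor \<open>S\<^sub>k\<close> permuting \<open>n + 1, \<dots>, n + k\<close>.\<close>

definition young :: "nat \<Rightarrow> nat \<Rightarrow> (nat \<Rightarrow> nat) set" where
  "young n k = {\<sigma> \<circ> \<tau> | \<sigma> \<tau>. \<sigma> \<in> S n \<and> \<tau> \<in> symgrp {n+1..n+k}}"

text \<open>The action of \<open>S\<^sub>n \<times> S\<^sub>k\<close> on the external tensor product of \<open>V\<close> with the sign representation.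
  As the latter is the field itself as a vector space, the underlying space of the tensor product
  is \<open>V\<close>, and \<open>(\<sigma>, \<tau>)\<close> acts on it as \<open>sign \<tau>\<close> times \<open>\<sigma>\<close>.\<close>

definition sign_twist ::
  "('f::field \<Rightarrow> 'v::ab_group_add \<Rightarrow> 'v) \<Rightarrow> nat \<Rightarrow> nat \<Rightarrow> ((nat \<Rightarrow> nat) \<Rightarrow> 'v \<Rightarrow> 'v)
     \<Rightarrow> (nat \<Rightarrow> nat) \<Rightarrow> 'v \<Rightarrow> 'v" where
  "sign_twist s n k \<rho> h v =
     s (of_int (sign (perm_restrict h {n+1..n+k}))) (\<rho> (perm_restrict h {1..n}) v)"

definition IA ::
  "('f::field \<Rightarrow> 'v::ab_group_add \<Rightarrow> 'v) \<Rightarrow> nat \<Rightarrow> nat \<Rightarrow> 'v set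
     \<Rightarrow> ((nat \<Rightarrow> nat) \<Rightarrow> 'v \<Rightarrow> 'v) \<Rightarrow> ((nat \<Rightarrow> nat) \<Rightarrow> 'v) set" where
  "IA s n k V \<rho> = ind (S (n + k)) (young n k) V (sign_twist s n k \<rho>)"

definition IA_incl ::
  "('f::field \<Rightarrow> 'v::ab_group_add \<Rightarrow> 'v) \<Rightarrow> nat \<Rightarrow> nat \<Rightarrow> ((nat \<Rightarrow> nat) \<Rightarrow> 'v \<Rightarrow> 'v)
     \<Rightarrow> 'v \<Rightarrow> (nat \<Rightarrow> nat) \<Rightarrow> 'v" where
  "IA_incl s n k \<rho> = ind_incl (young n k) (sign_twist s n k \<rho>)"

definition left_coset_reps :: "(nat \<Rightarrow> nat) set \<Rightarrow> (nat \<Rightarrow> nat) set \<Rightarrow> (nat \<Rightarrow> nat) set \<Rightarrow> bool" where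
  "left_coset_reps G H C \<longleftrightarrow> C \<subseteq> G \<and> (\<forall>g\<in>G. \<exists>!c. c \<in> C \<and> g \<in> {c \<circ> h | h. h \<in> H})"

definition is_boundary_map ::
  "('f::field \<Rightarrow> 'v::ab_group_add \<Rightarrow> 'v) \<Rightarrow> (nat \<Rightarrow> 'v set)
     \<Rightarrow> (nat \<Rightarrow> (nat \<Rightarrow> nat) \<Rightarrow> 'v \<Rightarrow> 'v) \<Rightarrow> (nat \<Rightarrow> 'v \<Rightarrow> 'v) \<Rightarrow> nat \<Rightarrow> nat
     \<Rightarrow> (((nat \<Rightarrow> nat) \<Rightarrow> 'v) \<Rightarrow> ((nat \<Rightarrow> nat) \<Rightarrow> 'v)) \<Rightarrow> bool" where
  "is_boundary_map s V \<rho> \<phi> M i d \<longleftrightarrow>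
     d \<in> IA s i (M - i) (V i) (\<rho> i)
           \<rightarrow>\<^sub>E IA s (i + 1) (M - (i + 1)) (V (i + 1)) (\<rho> (i + 1)) \<and>
     linear_map_on (fun_scale s) (fun_scale s) (IA s i (M - i) (V i) (\<rho> i)) d \<and>
     equivariant_on (S M) (IA s i (M - i) (V i) (\<rho> i)) ind_act ind_act d \<and>
     (\<forall>C. left_coset_reps (symgrp {i+1..M}) (symgrp {i+2..M}) C \<longrightarrow>
        (\<forall>v\<in>V i. d (IA_incl s i (M - i) (\<rho> i) v) =
           (\<Sum>\<sigma>\<in>C. fun_scale s (of_int (sign \<sigma>))
              (ind_act \<sigma> (IA_incl s (i + 1) (M - (i + 1)) (\<rho> (i + 1)) (\<phi> i v))))))"

text \<open>Meaningful for \<open>1 \<le> i < M\<close>. The map is \<open>undefined\<close> outside its domain, so that it is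
  unique as a HOL function.\<close>

definition boundary ::
  "('f::field \<Rightarrow> 'v::ab_group_add \<Rightarrow> 'v) \<Rightarrow> (nat \<Rightarrow> 'v set)
     \<Rightarrow> (nat \<Rightarrow> (nat \<Rightarrow> nat) \<Rightarrow> 'v \<Rightarrow> 'v) \<Rightarrow> (nat \<Rightarrow> 'v \<Rightarrow> 'v) \<Rightarrow> nat \<Rightarrow> nat
     \<Rightarrow> ((nat \<Rightarrow> nat) \<Rightarrow> 'v) \<Rightarrow> ((nat \<Rightarrow> nat) \<Rightarrow> 'v)" where
  "boundary s V \<rho> \<phi> M i = (THE d. is_boundary_map s V \<rho> \<phi> M i d)"

end

theory Submission
  imports Defs
begin

text \<open>
  The term \<open>IA\<^sub>M\<^sub>-\<^sub>i(V\<^sub>i)\<close> is the direct sum of copies \<open>V\<^sub>R\<close> of \<open>V\<^sub>i\<close> over the subsets \<open>R\<close> of \<open>{1..M}\<close>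
  with \<open>i\<close> elements, and the boundary is the sum of anticommuting maps \<open>V\<^sub>R \<rightarrow> V\<^sub>R\<^sub>\<union>\<^sub>x\<close>. Each set \<open>Y\<close> has a
  complex built from the \<open>V\<^sub>R\<close> with \<open>R \<subseteq> Y\<close>, and central stability amounts to exactness of these
  complexes in the two top degrees, \<open>|Y|\<close> and \<open>|Y| - 1\<close>, once \<open>Y\<close> is large (at least \<open>g\<close> and \<open>g + 1\<close>
  elements, where \<open>g = N + 1\<close>). For a point \<open>p\<close> put \<open>(DV)\<^sub>R = V\<^sub>R\<^sub>\<union>\<^sub>p / V\<^sub>R\<close>. The complex of \<open>Y \<union> p\<close> is
  the mapping cone of the map from the complex of \<open>Y\<close> to that of the shifted cube \<open>R \<mapsto> V\<^sub>R\<^sub>\<union>\<^sub>p\<close>, so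
  where \<open>V\<^sub>R \<rightarrow> V\<^sub>R\<^sub>\<union>\<^sub>p\<close> is injective it has the homology of the complex of \<open>DV\<close>. Now \<open>DV\<close> satisfies the
  top degree conditions with \<open>g - 1\<close> instead of \<open>g\<close>, and exactness for \<open>DV\<close> in turn forces that
  injectivity for \<open>|R| \<ge> 2g - 1\<close>. Induction on \<open>g\<close> gives exactness in all degrees \<open>i \<ge> 2g - 1\<close>.
\<close>

section \<open>Complexes of cubes of abelian groups\<close>

text \<open>The maps V_R -> V_{R\<union>p} need not be injective, so the mapping cone and DV differ
  by their kernels. A cycle of DV of degree i lifts to a chain of degree i+1 for Y \<union> p whose
  boundary can fail to vanish only on subsets of Y with i+2 elements. In the two top degrees there
  are none, so DV inherits the hypotheses with no injectivity assumed.

  Injectivity is recovered from symmetry: the kernel of V_R -> V_{R\<union>x} is the same for every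
  x outside R. An element killed by adjoining p turns out to be the boundary of a chain with
  coefficients in these kernels, hence zero. For |R| = n this uses exactness of DV in degree n-2. DV
  is known to be exact from degree 2(g-1)-1 on, and n-2 \<ge> 2g-3 means n \<ge> 2g-1: this loss of
  two degrees per step is the origin of the factor 2.

  The value g = N+1 comes from cutting the cube off below N: the relations for Y come from the V_R
  with |R| = |Y|-2, so |Y| \<ge> N+2 is required. For g = 0 the cube is zero.\<close>

definition add_subgroup :: "'a::ab_group_add set \<Rightarrow> bool" where
  "add_subgroup A \<longleftrightarrow> 0 \<in> A \<and> (\<forall>a\<in>A. \<forall>b\<in>A. a - b \<in> A)"

lemma add_subgroup_zero: "add_subgroup A \<Longrightarrow> 0 \<in> A"
  by (simp add: add_subgroup_def)

lemma add_subgroup_diff: "add_subgroup A \<Longrightarrow> a \<in> A \<Longrightarrow> b \<in> A \<Longrightarrow> a - b \<in> A"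
  by (simp add: add_subgroup_def)

lemma add_subgroup_uminus: "add_subgroup A \<Longrightarrow> a \<in> A \<Longrightarrow> - a \<in> A"
  using add_subgroup_diff[of A 0 a] by (simp add: add_subgroup_zero)

lemma add_subgroup_add: "add_subgroup A \<Longrightarrow> a \<in> A \<Longrightarrow> b \<in> A \<Longrightarrow> a + b \<in> A"
  using add_subgroup_diff[of A a "- b"] by (simp add: add_subgroup_uminus)

lemma add_subgroup_sum:
  assumes "add_subgroup A" "\<And>x. x \<in> I \<Longrightarrow> f x \<in> A"
  shows "sum f I \<in> A"
  using assms(2) by (induction I rule: infinite_finite_induct)
    (auto intro: add_subgroup_zero add_subgroup_add assms(1))

text \<open>The terms cancel in pairs {x, y}. The pairing is built by adding one point at a time;
  comparing the sum with its negative would prove nothing in characteristic 2.\<close>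

lemma sum_offdiag_cancel:
  fixes T :: "'x \<Rightarrow> 'x \<Rightarrow> 'a::ab_group_add"
  assumes "finite Q" "\<And>x y. x \<in> Q \<Longrightarrow> y \<in> Q \<Longrightarrow> x \<noteq> y \<Longrightarrow> T x y + T y x = 0"
  shows "(\<Sum>x\<in>Q. \<Sum>y\<in>Q - {x}. T x y) = 0"
  using assms
proof (induction Q rule: finite_induct)
  case (insert z Q)
  have "(\<Sum>x\<in>insert z Q. \<Sum>y\<in>insert z Q - {x}. T x y)
      = (\<Sum>y\<in>Q. T z y) + (\<Sum>x\<in>Q. \<Sum>y\<in>insert z Q - {x}. T x y)"
    using insert.hyps by (simp add: sum.insert)
  also have "(\<Sum>x\<in>Q. \<Sum>y\<in>insert z Q - {x}. T x y) = (\<Sum>x\<in>Q. T x z + (\<Sum>y\<in>Q - {x}. T x y))"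
  proof (rule sum.cong[OF refl])
    fix x assume "x \<in> Q"
    then have "insert z Q - {x} = insert z (Q - {x})" using insert.hyps by auto
    then show "(\<Sum>y\<in>insert z Q - {x}. T x y) = T x z + (\<Sum>y\<in>Q - {x}. T x y)"
      using insert.hyps by (simp add: sum.insert)
  qed
  also have "\<dots> = (\<Sum>x\<in>Q. T x z)"
    using insert by (simp add: sum.distrib)
  also have "(\<Sum>y\<in>Q. T z y) + (\<Sum>x\<in>Q. T x z) = (\<Sum>y\<in>Q. T z y + T y z)"
    by (simp add: sum.distrib)
  also have "\<dots> = 0"
    using insert by (intro sum.neutral) auto
  finally show ?case .
qed simp

definition cube_bd :: "('x set \<Rightarrow> 'x \<Rightarrow> 'a \<Rightarrow> 'a::ab_group_add) \<Rightarrow> ('x set \<Rightarrow> 'a) \<Rightarrow> 'x set \<Rightarrow> 'a" where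
  "cube_bd \<iota> c R = (\<Sum>x\<in>R. \<iota> (R - {x}) x (c (R - {x})))"

text \<open>
  Degree \<open>i\<close> of the complex of the set \<open>Y\<close> is the sum of the groups \<open>A R / B R\<close> over the
  subsets \<open>R\<close> of \<open>Y\<close> with \<open>i\<close> elements, so the boundary raises the degree. Writing \<open>Suc (card R) = i\<close>
  makes degree \<open>-1\<close> empty for \<open>i = 0\<close>.
\<close>

definition cube_exact ::
  "('x set \<Rightarrow> 'a::ab_group_add set) \<Rightarrow> ('x set \<Rightarrow> 'a set) \<Rightarrow> ('x set \<Rightarrow> 'x \<Rightarrow> 'a \<Rightarrow> 'a)
     \<Rightarrow> 'x set \<Rightarrow> nat \<Rightarrow> bool" where
  "cube_exact A B \<iota> Y i \<longleftrightarrow>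
     (\<forall>c. (\<forall>R\<subseteq>Y. card R = i \<longrightarrow> c R \<in> A R) \<and> (\<forall>R\<subseteq>Y. card R = Suc i \<longrightarrow> cube_bd \<iota> c R \<in> B R)
       \<longrightarrow> (\<exists>e. (\<forall>R\<subseteq>Y. Suc (card R) = i \<longrightarrow> e R \<in> A R) \<and>
               (\<forall>R\<subseteq>Y. card R = i \<longrightarrow> c R - cube_bd \<iota> e R \<in> B R)))"

lemma cube_exactE:
  assumes "cube_exact A B \<iota> Y i"
    and "\<And>R. R \<subseteq> Y \<Longrightarrow> card R = i \<Longrightarrow> c R \<in> A R"
    and "\<And>R. R \<subseteq> Y \<Longrightarrow> card R = Suc i \<Longrightarrow> cube_bd \<iota> c R \<in> B R"
  obtains e where "\<And>R. R \<subseteq> Y \<Longrightarrow> Suc (card R) = i \<Longrightarrow> e R \<in> A R"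
    and "\<And>R. R \<subseteq> Y \<Longrightarrow> card R = i \<Longrightarrow> c R - cube_bd \<iota> e R \<in> B R"
proof -
  have "(\<exists>e. (\<forall>R\<subseteq>Y. Suc (card R) = i \<longrightarrow> e R \<in> A R) \<and>
               (\<forall>R\<subseteq>Y. card R = i \<longrightarrow> c R - cube_bd \<iota> e R \<in> B R))"
    using assms(1)[unfolded cube_exact_def, THEN spec, of c] assms(2,3) by simp
  then show ?thesis using that by (elim exE conjE) auto
qed

text \<open>
  The cube is \<open>R \<mapsto> A R / B R\<close>; keeping numerator and denominator apart allows passing to cokernels
  without changing the type. As the maps \<open>\<iota>\<close> anticommute, the boundary needs no signs.
  The map \<open>t x y R\<close> is the effect of the transposition of \<open>x\<close> and \<open>y\<close>; its role is to make the kernel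
  of \<open>\<iota> R x\<close> independent of \<open>x\<close>.
\<close>

locale cube =
  fixes X :: "'x set" and A B :: "'x set \<Rightarrow> 'a::ab_group_add set"
    and \<iota> :: "'x set \<Rightarrow> 'x \<Rightarrow> 'a \<Rightarrow> 'a" and t :: "'x \<Rightarrow> 'x \<Rightarrow> 'x set \<Rightarrow> 'a \<Rightarrow> 'a"
  assumes finite_X: "finite X"
    and sub_A: "R \<subseteq> X \<Longrightarrow> add_subgroup (A R)"
    and sub_B: "R \<subseteq> X \<Longrightarrow> add_subgroup (B R)"
    and B_le_A: "R \<subseteq> X \<Longrightarrow> B R \<subseteq> A R"
    and \<iota>_diff: "\<iota> R x (a - b) = \<iota> R x a - \<iota> R x b"
    and \<iota>_A: "R \<subseteq> X \<Longrightarrow> x \<in> X \<Longrightarrow> x \<notin> R \<Longrightarrow> a \<in> A R \<Longrightarrow> \<iota> R x a \<in> A (insert x R)"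
    and \<iota>_B: "R \<subseteq> X \<Longrightarrow> x \<in> X \<Longrightarrow> x \<notin> R \<Longrightarrow> a \<in> B R \<Longrightarrow> \<iota> R x a \<in> B (insert x R)"
    and \<iota>_anti: "R \<subseteq> X \<Longrightarrow> x \<in> X \<Longrightarrow> y \<in> X \<Longrightarrow> x \<notin> R \<Longrightarrow> y \<notin> R \<Longrightarrow> x \<noteq> y \<Longrightarrow> a \<in> A R \<Longrightarrow>
        \<iota> (insert x R) y (\<iota> R x a) + \<iota> (insert y R) x (\<iota> R y a) = 0"
    and t_diff: "t x y R (a - b) = t x y R a - t x y R b"
    and t_A: "R \<subseteq> X \<Longrightarrow> x \<in> X \<Longrightarrow> y \<in> X \<Longrightarrow> x \<notin> R \<Longrightarrow> y \<notin> R \<Longrightarrow> x \<noteq> y \<Longrightarrow> a \<in> A (insert x R) \<Longrightarrow>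
        t x y R a \<in> A (insert y R)"
    and t_B: "R \<subseteq> X \<Longrightarrow> x \<in> X \<Longrightarrow> y \<in> X \<Longrightarrow> x \<notin> R \<Longrightarrow> y \<notin> R \<Longrightarrow> x \<noteq> y \<Longrightarrow> a \<in> B (insert x R) \<Longrightarrow>
        t x y R a \<in> B (insert y R)"
    and t_\<iota>: "R \<subseteq> X \<Longrightarrow> x \<in> X \<Longrightarrow> y \<in> X \<Longrightarrow> x \<notin> R \<Longrightarrow> y \<notin> R \<Longrightarrow> x \<noteq> y \<Longrightarrow> a \<in> A R \<Longrightarrow>
        t x y R (\<iota> R x a) = - \<iota> R y a"
    and t_nat: "R \<subseteq> X \<Longrightarrow> x \<in> X \<Longrightarrow> y \<in> X \<Longrightarrow> z \<in> X \<Longrightarrow> x \<notin> R \<Longrightarrow> y \<notin> R \<Longrightarrow> z \<notin> R \<Longrightarrow>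
        x \<noteq> y \<Longrightarrow> x \<noteq> z \<Longrightarrow> y \<noteq> z \<Longrightarrow> a \<in> A (insert x R) \<Longrightarrow>
        t x y (insert z R) (\<iota> (insert x R) z a) = \<iota> (insert y R) z (t x y R a)"
begin

lemma \<iota>_zero [simp]: "\<iota> R x 0 = 0"
  using \<iota>_diff[of R x 0 0] by simp

lemma \<iota>_uminus: "\<iota> R x (- a) = - \<iota> R x a"
  using \<iota>_diff[of R x 0 a] by simp

lemma \<iota>_add: "\<iota> R x (a + b) = \<iota> R x a + \<iota> R x b"
  using \<iota>_diff[of R x a "- b"] by (simp add: \<iota>_uminus)

lemma \<iota>_sum: "\<iota> R x (sum f I) = (\<Sum>j\<in>I. \<iota> R x (f j))"
  by (induction I rule: infinite_finite_induct) (auto simp: \<iota>_add)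

lemma t_add: "t x y R (a + b) = t x y R a + t x y R b"
proof -
  have "t x y R 0 = 0" using t_diff[of x y R 0 0] by simp
  then have "t x y R (- b) = - t x y R b" using t_diff[of x y R 0 b] by simp
  then show ?thesis using t_diff[of x y R a "- b"] by simp
qed

lemma bd_diff: "cube_bd \<iota> (\<lambda>R. c R - e R) R = cube_bd \<iota> c R - cube_bd \<iota> e R"
  by (simp add: cube_bd_def \<iota>_diff sum_subtractf)

lemma bd_add: "cube_bd \<iota> (\<lambda>R. c R + e R) R = cube_bd \<iota> c R + cube_bd \<iota> e R"
  by (simp add: cube_bd_def \<iota>_add sum.distrib)

lemma bd_zero [simp]: "cube_bd \<iota> (\<lambda>R. 0) R = 0"
  by (simp add: cube_bd_def)

lemma bd_cong: "(\<And>x. x \<in> R \<Longrightarrow> c (R - {x}) = e (R - {x})) \<Longrightarrow> cube_bd \<iota> c R = cube_bd \<iota> e R"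
  unfolding cube_bd_def by (rule sum.cong) auto

lemma \<iota>_into:
  assumes "R \<subseteq> X" "x \<in> R"
  shows "a \<in> A (R - {x}) \<Longrightarrow> \<iota> (R - {x}) x a \<in> A R" "a \<in> B (R - {x}) \<Longrightarrow> \<iota> (R - {x}) x a \<in> B R"
  using \<iota>_A[of "R - {x}" x a] \<iota>_B[of "R - {x}" x a] assms by (auto simp: insert_absorb)

lemma bd_A:
  assumes "R \<subseteq> X" "\<And>x. x \<in> R \<Longrightarrow> c (R - {x}) \<in> A (R - {x})"
  shows "cube_bd \<iota> c R \<in> A R"
  unfolding cube_bd_def using assms by (intro add_subgroup_sum sub_A \<iota>_into(1)) auto

lemma bd_B:
  assumes "R \<subseteq> X" "\<And>x. x \<in> R \<Longrightarrow> c (R - {x}) \<in> B (R - {x})"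
  shows "cube_bd \<iota> c R \<in> B R"
  unfolding cube_bd_def using assms by (intro add_subgroup_sum sub_B \<iota>_into(2)) auto

lemma bd_bd:
  assumes Q: "Q \<subseteq> X" and e: "\<And>x y. x \<in> Q \<Longrightarrow> y \<in> Q \<Longrightarrow> x \<noteq> y \<Longrightarrow> e (Q - {x} - {y}) \<in> A (Q - {x} - {y})"
  shows "cube_bd \<iota> (cube_bd \<iota> e) Q = 0"
proof -
  have "cube_bd \<iota> (cube_bd \<iota> e) Q
      = (\<Sum>x\<in>Q. \<Sum>y\<in>Q - {x}. \<iota> (Q - {x}) x (\<iota> (Q - {x} - {y}) y (e (Q - {x} - {y}))))"
    by (simp add: cube_bd_def \<iota>_sum)
  also have "\<dots> = 0"
  proof (rule sum_offdiag_cancel)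
    show "finite Q" using Q finite_X by (rule finite_subset)
    fix x y assume xy: "x \<in> Q" "y \<in> Q" "x \<noteq> y"
    have *: "insert y (Q - {x} - {y}) = Q - {x}" "insert x (Q - {x} - {y}) = Q - {y}" "Q - {y} - {x} = Q - {x} - {y}"
      using xy by auto
    show "\<iota> (Q - {x}) x (\<iota> (Q - {x} - {y}) y (e (Q - {x} - {y}))) +
        \<iota> (Q - {y}) y (\<iota> (Q - {y} - {x}) x (e (Q - {y} - {x}))) = 0"
      using \<iota>_anti[of "Q - {x} - {y}" y x "e (Q - {x} - {y})"] xy Q e[OF xy] unfolding * by blast
  qed
  finally show ?thesis .
qed

text \<open>The map \<open>t x y R\<close> preserves the denominators and carries
  \<open>\<iota> R x a\<close> to \<open>- \<iota> R y a\<close>.\<close>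

lemma killed_sym:
  assumes "R \<subseteq> X" "x \<in> X" "y \<in> X" "x \<notin> R" "y \<notin> R" "a \<in> A R" "\<iota> R x a \<in> B (insert x R)"
  shows "\<iota> R y a \<in> B (insert y R)"
proof (cases "x = y")
  case False
  have "- \<iota> R y a \<in> B (insert y R)"
    using t_B[OF assms(1-5) False assms(7)] t_\<iota>[OF assms(1-5) False assms(6)] by simp
  then show ?thesis
    using add_subgroup_uminus[OF sub_B, of "insert y R" "- \<iota> R y a"] assms(1,3) by simp
qed (use assms in simp)

end

text \<open>
  The derivative of a cube at a point \<open>p\<close> consists of the cokernels of the maps \<open>\<iota> R p\<close>.
\<close>

definition der_B :: "('x set \<Rightarrow> 'a::ab_group_add set) \<Rightarrow> ('x set \<Rightarrow> 'a set) \<Rightarrow> ('x set \<Rightarrow> 'x \<Rightarrow> 'a \<Rightarrow> 'a)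
    \<Rightarrow> 'x \<Rightarrow> 'x set \<Rightarrow> 'a set" where
  "der_B A B \<iota> p R = {b + \<iota> R p a | a b. b \<in> B (insert p R) \<and> a \<in> A R}"

abbreviation (input) der_\<iota> :: "('x set \<Rightarrow> 'x \<Rightarrow> 'a \<Rightarrow> 'a) \<Rightarrow> 'x \<Rightarrow> 'x set \<Rightarrow> 'x \<Rightarrow> 'a \<Rightarrow> 'a" where
  "der_\<iota> \<iota> p R \<equiv> \<iota> (insert p R)"

abbreviation (input) der_exact where
  "der_exact A B \<iota> p \<equiv> cube_exact (\<lambda>R. A (insert p R)) (der_B A B \<iota> p) (der_\<iota> \<iota> p)"

context cube
begin

lemma der_BI: "b \<in> B (insert p R) \<Longrightarrow> a \<in> A R \<Longrightarrow> b + \<iota> R p a \<in> der_B A B \<iota> p R"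
  unfolding der_B_def by blast

lemma der_BI0: "R \<subseteq> X \<Longrightarrow> b \<in> B (insert p R) \<Longrightarrow> b \<in> der_B A B \<iota> p R"
  using der_BI[of b p R 0] by (simp add: add_subgroup_zero sub_A)

lemma bd_insert:
  assumes "R \<subseteq> X" "p \<notin> R"
  shows "cube_bd \<iota> C (insert p R) = \<iota> R p (C R) + cube_bd (der_\<iota> \<iota> p) (\<lambda>R. C (insert p R)) R"
proof -
  have "cube_bd \<iota> C (insert p R) = \<iota> R p (C R) +
      (\<Sum>x\<in>R. \<iota> (insert p R - {x}) x (C (insert p R - {x})))"
    using assms finite_subset[OF _ finite_X] by (simp add: cube_bd_def)
  also have "(\<Sum>x\<in>R. \<iota> (insert p R - {x}) x (C (insert p R - {x})))
      = cube_bd (der_\<iota> \<iota> p) (\<lambda>R. C (insert p R)) R"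
    unfolding cube_bd_def
  proof (rule sum.cong[OF refl])
    fix x assume "x \<in> R"
    then have "insert p R - {x} = insert p (R - {x})" using assms by auto
    then show "\<iota> (insert p R - {x}) x (C (insert p R - {x}))
        = \<iota> (insert p (R - {x})) x (C (insert p (R - {x})))" by simp
  qed
  finally show ?thesis .
qed

text \<open>The images of the maps \<open>\<iota> R p\<close> are stable under adjoining a further
  point x because adjoining p and adjoining x anticommute, and stable under transpositions of points
  other than p by \<open>t_nat\<close>. So they may be added to the denominators.\<close>

lemma der_cube:
  assumes p: "p \<in> X"
  shows "cube (X - {p}) (\<lambda>R. A (insert p R)) (der_B A B \<iota> p) (der_\<iota> \<iota> p) (\<lambda>x y R. t x y (insert p R))"
proof
  show "finite (X - {p})" using finite_X by simp
next
  fix R assume "R \<subseteq> X - {p}"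
  then have R: "R \<subseteq> X" "p \<notin> R" "insert p R \<subseteq> X" using p by auto
  show "add_subgroup (A (insert p R))" by (rule sub_A[OF R(3)])
  show "add_subgroup (der_B A B \<iota> p R)"
    unfolding add_subgroup_def
  proof (intro conjI ballI)
    show "0 \<in> der_B A B \<iota> p R"
      using der_BI0[OF R(1)] add_subgroup_zero[OF sub_B[OF R(3)]] by blast
    fix a b assume "a \<in> der_B A B \<iota> p R" "b \<in> der_B A B \<iota> p R"
    then obtain a1 a2 b1 b2 where *: "a = b1 + \<iota> R p a1" "b1 \<in> B (insert p R)" "a1 \<in> A R"
      "b = b2 + \<iota> R p a2" "b2 \<in> B (insert p R)" "a2 \<in> A R"
      unfolding der_B_def by blast
    then have "a - b = (b1 - b2) + \<iota> R p (a1 - a2)" by (simp add: \<iota>_diff)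
    then show "a - b \<in> der_B A B \<iota> p R"
      using der_BI add_subgroup_diff[OF sub_A[OF R(1)]] add_subgroup_diff[OF sub_B[OF R(3)]] * by metis
  qed
  show "der_B A B \<iota> p R \<subseteq> A (insert p R)"
    unfolding der_B_def using add_subgroup_add[OF sub_A[OF R(3)]] \<iota>_A[OF R(1) p R(2)] B_le_A[OF R(3)] by auto
next
  fix R x a b show "\<iota> (insert p R) x (a - b) = \<iota> (insert p R) x a - \<iota> (insert p R) x b" by (rule \<iota>_diff)
next
  fix R x a assume "R \<subseteq> X - {p}" "x \<in> X - {p}" "x \<notin> R"
  then have R: "R \<subseteq> X" "p \<notin> R" "insert p R \<subseteq> X" "x \<in> X" "x \<noteq> p" "x \<notin> R" "x \<notin> insert p R" using p by auto
  show "a \<in> A (insert p R) \<Longrightarrow> \<iota> (insert p R) x a \<in> A (insert p (insert x R))"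
    using \<iota>_A[OF R(3,4,7)] by (simp add: insert_commute)
  assume "a \<in> der_B A B \<iota> p R"
  then obtain b a1 where *: "a = b + \<iota> R p a1" "b \<in> B (insert p R)" "a1 \<in> A R"
    unfolding der_B_def by blast
  \<comment> \<open>The sign from moving x past p is absorbed into \<open>- a1\<close>.\<close>
  have "\<iota> (insert p R) x a = \<iota> (insert p R) x b + \<iota> (insert x R) p (\<iota> R x (- a1))"
    using \<iota>_anti[OF R(1) R(4) p R(6) R(2) R(5) *(3)] * by (simp add: \<iota>_add \<iota>_uminus eq_neg_iff_add_eq_0 add.commute)
  moreover have "\<iota> R x (- a1) \<in> A (insert x R)"
    using \<iota>_A[OF R(1,4,6)] add_subgroup_uminus[OF sub_A[OF R(1)]] * by blast
  moreover have "\<iota> (insert p R) x b \<in> B (insert p (insert x R))"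
    using \<iota>_B[OF R(3,4,7) *(2)] by (simp add: insert_commute)
  ultimately show "\<iota> (insert p R) x a \<in> der_B A B \<iota> p (insert x R)" using der_BI by metis
next
  fix R x y a assume "R \<subseteq> X - {p}" "x \<in> X - {p}" "y \<in> X - {p}" "x \<notin> R" "y \<notin> R" and xy: "x \<noteq> y"
  then have R: "R \<subseteq> X" "p \<notin> R" "insert p R \<subseteq> X" and x: "x \<in> X" "x \<noteq> p" "x \<notin> R" "x \<notin> insert p R"
    and y: "y \<in> X" "y \<noteq> p" "y \<notin> R" "y \<notin> insert p R" using p by auto
  show "a \<in> A (insert p R) \<Longrightarrow> \<iota> (insert p (insert x R)) y (\<iota> (insert p R) x a) +
      \<iota> (insert p (insert y R)) x (\<iota> (insert p R) y a) = 0"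
    using \<iota>_anti[OF R(3) x(1) y(1) x(4) y(4) xy] by (simp add: insert_commute)
  show "a \<in> A (insert p (insert x R)) \<Longrightarrow> t x y (insert p R) a \<in> A (insert p (insert y R))"
    using t_A[OF R(3) x(1) y(1) x(4) y(4) xy] by (simp add: insert_commute)
  show "a \<in> A (insert p R) \<Longrightarrow> t x y (insert p R) (\<iota> (insert p R) x a) = - \<iota> (insert p R) y a"
    using t_\<iota>[OF R(3) x(1) y(1) x(4) y(4) xy] by simp
  assume "a \<in> der_B A B \<iota> p (insert x R)"
  then obtain b a1 where *: "a = b + \<iota> (insert x R) p a1" "b \<in> B (insert x (insert p R))" "a1 \<in> A (insert x R)"
    unfolding der_B_def by (auto simp: insert_commute)
  have "t x y (insert p R) a = t x y (insert p R) b + \<iota> (insert y R) p (t x y R a1)"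
    using t_nat[OF R(1) x(1) y(1) p x(3) y(3) R(2) xy x(2) y(2) *(3)] * by (simp add: t_add)
  moreover have "t x y (insert p R) b \<in> B (insert p (insert y R))"
    using t_B[OF R(3) x(1) y(1) x(4) y(4) xy *(2)] by (simp add: insert_commute)
  moreover have "t x y R a1 \<in> A (insert y R)"
    using t_A[OF R(1) x(1) y(1) x(3) y(3) xy *(3)] .
  ultimately show "t x y (insert p R) a \<in> der_B A B \<iota> p (insert y R)" using der_BI by metis
next
  fix x y R a b show "t x y (insert p R) (a - b) = t x y (insert p R) a - t x y (insert p R) b" by (rule t_diff)
next
  fix R x y z a assume "R \<subseteq> X - {p}" "x \<in> X - {p}" "y \<in> X - {p}" "z \<in> X - {p}" "x \<notin> R" "y \<notin> R" "z \<notin> R"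
    "x \<noteq> y" "x \<noteq> z" "y \<noteq> z" "a \<in> A (insert p (insert x R))"
  then show "t x y (insert p (insert z R)) (\<iota> (insert p (insert x R)) z a)
      = \<iota> (insert p (insert y R)) z (t x y (insert p R) a)"
    using t_nat[of "insert p R" x y z a] p by (auto simp: insert_commute)
qed

section \<open>Comparison of a cube with its derivative\<close>

lemma der_bd_B:
  assumes R: "R \<subseteq> X" "p \<in> X" "p \<notin> R"
    and c: "\<And>x. x \<in> R \<Longrightarrow> c (R - {x}) \<in> B (insert p (R - {x}))"
  shows "cube_bd (der_\<iota> \<iota> p) c R \<in> B (insert p R)"
  unfolding cube_bd_def
proof (intro add_subgroup_sum sub_B)
  show "insert p R \<subseteq> X" using R by simp
  fix x assume x: "x \<in> R"
  then have "insert x (insert p (R - {x})) = insert p R" by auto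
  then show "\<iota> (insert p (R - {x})) x (c (R - {x})) \<in> B (insert p R)"
    using \<iota>_B[of "insert p (R - {x})" x "c (R - {x})"] c[OF x] x R by auto
qed

lemma card_insert_p: "R \<subseteq> X \<Longrightarrow> p \<notin> R \<Longrightarrow> card (insert p R) = Suc (card R)"
  using finite_subset[OF _ finite_X] by simp

text \<open>A cycle \<open>c\<close> of the derivative has a boundary of the form
  \<open>\<iota> R p (b R)\<close> modulo \<open>B\<close>, so \<open>c\<close> and
  \<open>- b\<close> together form a chain for \<open>insert p Y\<close>. Its boundary vanishes on
  faces through p by construction. On faces inside Y only the image of the boundary of
  \<open>b\<close> under adjoining p is controlled, and the bound on \<open>card Y\<close> says that
  there are no such faces.\<close>

lemma der_exact_down:
  assumes Y: "Y \<subseteq> X" and p: "p \<in> X" "p \<notin> Y"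
    and ex: "cube_exact A B \<iota> (insert p Y) (Suc i)" and le: "card Y \<le> Suc i"
  shows "der_exact A B \<iota> p Y i"
  unfolding cube_exact_def
proof (intro allI impI, elim conjE)
  have finY: "finite Y" using Y finite_X by (rule finite_subset)
  fix c assume c: "\<forall>R\<subseteq>Y. card R = i \<longrightarrow> c R \<in> A (insert p R)"
    and bc: "\<forall>R\<subseteq>Y. card R = Suc i \<longrightarrow> cube_bd (der_\<iota> \<iota> p) c R \<in> der_B A B \<iota> p R"
  have "\<exists>b. R \<subseteq> Y \<and> card R = Suc i \<longrightarrow> b \<in> A R \<and> cube_bd (der_\<iota> \<iota> p) c R - \<iota> R p b \<in> B (insert p R)" for R
    using bc unfolding der_B_def by force
  then obtain b where b: "\<And>R. R \<subseteq> Y \<Longrightarrow> card R = Suc i \<Longrightarrow> b R \<in> A R"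
    "\<And>R. R \<subseteq> Y \<Longrightarrow> card R = Suc i \<Longrightarrow> cube_bd (der_\<iota> \<iota> p) c R - \<iota> R p (b R) \<in> B (insert p R)"
    by metis
  define C where "C Q = (if p \<in> Q then c (Q - {p}) else - b Q)" for Q
  have Cp: "C (insert p R) = c R" "C R = - b R" if "R \<subseteq> Y" for R
  proof -
    have "p \<notin> R" using that p by auto
    then show "C (insert p R) = c R" "C R = - b R" by (simp_all add: C_def)
  qed
  have split: "\<exists>R\<subseteq>Y. Q = insert p R" if "Q \<subseteq> insert p Y" "p \<in> Q" for Q
    using that p by (intro exI[of _ "Q - {p}"]) auto
  have bdC: "cube_bd \<iota> C (insert p R) = cube_bd (der_\<iota> \<iota> p) c R - \<iota> R p (b R)" if "R \<subseteq> Y" for R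
  proof -
    have "cube_bd (der_\<iota> \<iota> p) (\<lambda>R. C (insert p R)) R = cube_bd (der_\<iota> \<iota> p) c R"
      using that p by (intro cube.bd_cong[OF der_cube[OF p(1)]] Cp(1)) auto
    then show ?thesis using bd_insert[of R p C] that p Y Cp(2)[OF that] by (auto simp: \<iota>_uminus)
  qed
  obtain E where E: "\<And>Q. Q \<subseteq> insert p Y \<Longrightarrow> Suc (card Q) = Suc i \<Longrightarrow> E Q \<in> A Q"
    "\<And>Q. Q \<subseteq> insert p Y \<Longrightarrow> card Q = Suc i \<Longrightarrow> C Q - cube_bd \<iota> E Q \<in> B Q"
  proof (rule cube_exactE[OF ex, of C])
    fix Q assume Q: "Q \<subseteq> insert p Y" "card Q = Suc i"
    show "C Q \<in> A Q"
    proof (cases "p \<in> Q")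
      case True
      then obtain R where R: "R \<subseteq> Y" "Q = insert p R" using split Q by blast
      then have "card R = i" using Q card_insert_p[of R p] p Y by auto
      then show ?thesis using c Cp(1)[OF R(1)] R by simp
    next
      case False
      then have "Q \<subseteq> Y" using Q by auto
      then show ?thesis using Cp(2) b(1)[of Q] Q add_subgroup_uminus[OF sub_A] Y by auto
    qed
  next
    \<comment> \<open>By the bound on \<open>card Y\<close> the only possible face of this size is
      \<open>insert p Y\<close> itself, so the boundary is never tested on a subset of Y.\<close>
    fix Q assume Q: "Q \<subseteq> insert p Y" "card Q = Suc (Suc i)"
    then have "Q = insert p Y"
      using card_seteq[of "insert p Y" Q] finY p le by simp
    moreover have "card Y = Suc i" using Q calculation card_insert_p[of Y p] p Y by simp
    ultimately show "cube_bd \<iota> C Q \<in> B Q" using bdC[of Y] b(2)[of Y] by simp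
  qed blast
  show "\<exists>e. (\<forall>R\<subseteq>Y. Suc (card R) = i \<longrightarrow> e R \<in> A (insert p R)) \<and>
      (\<forall>R\<subseteq>Y. card R = i \<longrightarrow> c R - cube_bd (der_\<iota> \<iota> p) e R \<in> der_B A B \<iota> p R)"
  proof (intro exI[of _ "\<lambda>R. E (insert p R)"] conjI allI impI)
    fix R assume R: "R \<subseteq> Y" "Suc (card R) = i"
    then show "E (insert p R) \<in> A (insert p R)"
      using E(1)[of "insert p R"] card_insert_p[of R p] p Y by auto
  next
    fix R assume R: "R \<subseteq> Y" "card R = i"
    have "c R - cube_bd (der_\<iota> \<iota> p) (\<lambda>R. E (insert p R)) R
        = (C (insert p R) - cube_bd \<iota> E (insert p R)) + \<iota> R p (E R)"
    proof -
      have "R \<subseteq> X" "p \<notin> R" using R p Y by auto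
      then show ?thesis using bd_insert[of R p E] Cp(1)[OF R(1)] by (simp add: algebra_simps)
    qed
    moreover have "C (insert p R) - cube_bd \<iota> E (insert p R) \<in> B (insert p R)"
      using E(2)[of "insert p R"] R card_insert_p[of R p] p Y by auto
    moreover have "E R \<in> A R" using E(1)[of R] R by auto
    ultimately show "c R - cube_bd (der_\<iota> \<iota> p) (\<lambda>R. E (insert p R)) R \<in> der_B A B \<iota> p R"
      using der_BI by metis
  qed
qed

text \<open>The faces through p are treated as a cycle of the derivative and filled there; lifting
  the filling produces coefficients on faces inside Y as well. What is left of \<open>c\<close>
  lives on faces R inside Y, and the cycle condition on \<open>insert p R\<close> shows that it is
  killed by adjoining p. Injectivity then removes it.\<close>

lemma der_exact_up:
  assumes Y: "Y \<subseteq> X" and p: "p \<in> X" "p \<notin> Y"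
    and ex: "der_exact A B \<iota> p Y i"
    and inj: "\<And>R a. R \<subseteq> Y \<Longrightarrow> card R = Suc i \<Longrightarrow> a \<in> A R \<Longrightarrow> \<iota> R p a \<in> B (insert p R) \<Longrightarrow> a \<in> B R"
  shows "cube_exact A B \<iota> (insert p Y) (Suc i)"
  unfolding cube_exact_def
proof (intro allI impI, elim conjE)
  fix c assume c: "\<forall>Q\<subseteq>insert p Y. card Q = Suc i \<longrightarrow> c Q \<in> A Q"
    and bc: "\<forall>Q\<subseteq>insert p Y. card Q = Suc (Suc i) \<longrightarrow> cube_bd \<iota> c Q \<in> B Q"
  have RX: "R \<subseteq> X" "p \<notin> R" "insert p R \<subseteq> X" "R \<subseteq> insert p Y" "insert p R \<subseteq> insert p Y"
    "card (insert p R) = Suc (card R)" if "R \<subseteq> Y" for R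
    using that p Y card_insert_p[of R p] by auto
  obtain e' where e': "\<And>R. R \<subseteq> Y \<Longrightarrow> Suc (card R) = i \<Longrightarrow> e' R \<in> A (insert p R)"
    "\<And>R. R \<subseteq> Y \<Longrightarrow> card R = i \<Longrightarrow> c (insert p R) - cube_bd (der_\<iota> \<iota> p) e' R \<in> der_B A B \<iota> p R"
  proof (rule cube_exactE[OF ex, of "\<lambda>R. c (insert p R)"])
    fix R assume R: "R \<subseteq> Y" "card R = i"
    then show "c (insert p R) \<in> A (insert p R)" using c RX(5,6)[of R] by simp
  next
    fix R assume R: "R \<subseteq> Y" "card R = Suc i"
    have "cube_bd (der_\<iota> \<iota> p) (\<lambda>R. c (insert p R)) R = cube_bd \<iota> c (insert p R) + \<iota> R p (- c R)"
      using bd_insert[of R p c] RX[OF R(1)] by (simp add: \<iota>_uminus)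
    moreover have "- c R \<in> A R" using c R RX[OF R(1)] add_subgroup_uminus[OF sub_A] by auto
    ultimately show "cube_bd (der_\<iota> \<iota> p) (\<lambda>R. c (insert p R)) R \<in> der_B A B \<iota> p R"
      using bc RX[OF R(1)] R der_BI by metis
  qed blast
  have "\<exists>b. R \<subseteq> Y \<and> card R = i \<longrightarrow> b \<in> A R \<and>
      c (insert p R) - cube_bd (der_\<iota> \<iota> p) e' R - \<iota> R p b \<in> B (insert p R)" for R
    using e'(2) unfolding der_B_def by force
  then obtain b where b: "\<And>R. R \<subseteq> Y \<Longrightarrow> card R = i \<Longrightarrow> b R \<in> A R"
    "\<And>R. R \<subseteq> Y \<Longrightarrow> card R = i \<Longrightarrow>
      c (insert p R) - cube_bd (der_\<iota> \<iota> p) e' R - \<iota> R p (b R) \<in> B (insert p R)"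
    by metis
  \<comment> \<open>The corrections \<open>b\<close> by which \<open>e'\<close> fails to fill
    \<open>c\<close> modulo \<open>B\<close> are exactly the coefficients needed on faces avoiding
    p.\<close>
  define e where "e Q = (if p \<in> Q then e' (Q - {p}) else b Q)" for Q
  have ep: "e (insert p R) = e' R" "e R = b R" if "R \<subseteq> Y" for R
  proof -
    have "p \<notin> R" using that p by auto
    then show "e (insert p R) = e' R" "e R = b R" by (simp_all add: e_def)
  qed
  have split: "\<exists>R\<subseteq>Y. Q = insert p R" if "Q \<subseteq> insert p Y" "p \<in> Q" for Q
    using that p by (intro exI[of _ "Q - {p}"]) auto
  have eA: "e Q \<in> A Q" if Q: "Q \<subseteq> insert p Y" "card Q = i" for Q
  proof (cases "p \<in> Q")
    case True
    then obtain R where R: "R \<subseteq> Y" "Q = insert p R" using split Q by blast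
    then show ?thesis using e'(1)[of R] ep RX[of R] Q by simp
  next
    case False
    then have "Q \<subseteq> Y" using Q by auto
    then show ?thesis using b(1)[of Q] ep(2)[of Q] Q by simp
  qed
  have bp: "c (insert p R) - cube_bd \<iota> e (insert p R) \<in> B (insert p R)" if R: "R \<subseteq> Y" "card R = i" for R
  proof -
    have "cube_bd (der_\<iota> \<iota> p) (\<lambda>R. e (insert p R)) R = cube_bd (der_\<iota> \<iota> p) e' R"
      using R p by (intro cube.bd_cong[OF der_cube[OF p(1)]] ep(1)) auto
    then show ?thesis
      using bd_insert[of R p e] RX[OF R(1)] b(2)[OF R] ep(2)[OF R(1)] by (simp add: algebra_simps)
  qed
  have b0: "c R - cube_bd \<iota> e R \<in> B R" if R: "R \<subseteq> Y" "card R = Suc i" for R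
  proof (rule inj[OF R])
    define c1 where "c1 Q = c Q - cube_bd \<iota> e Q" for Q
    have fin: "finite R" using RX(1)[OF R(1)] finite_X by (rule finite_subset)
    have "cube_bd \<iota> e R \<in> A R"
      using R RX[OF R(1)] fin by (intro bd_A eA) auto
    then show "c R - cube_bd \<iota> e R \<in> A R"
      using c R RX[OF R(1)] add_subgroup_diff[OF sub_A] by auto
    have "cube_bd \<iota> (cube_bd \<iota> e) (insert p R) = 0"
    proof (rule bd_bd[OF RX(3)[OF R(1)]])
      fix x y assume xy: "x \<in> insert p R" "y \<in> insert p R" "x \<noteq> y"
      have "card (insert p R - {x} - {y}) = i" using xy RX[OF R(1)] R fin by simp
      then show "e (insert p R - {x} - {y}) \<in> A (insert p R - {x} - {y})"
        using R by (intro eA) auto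
    qed
    then have "cube_bd \<iota> c1 (insert p R) = cube_bd \<iota> c (insert p R)"
      unfolding c1_def by (simp add: bd_diff)
    then have B1: "cube_bd \<iota> c1 (insert p R) \<in> B (insert p R)"
      using bc RX[OF R(1)] R by simp
    \<comment> \<open>Of the two parts of the boundary of \<open>c1\<close> on
      \<open>insert p R\<close>, the one coming from faces through p lies in \<open>B\<close>; this
      isolates the other part, \<open>\<iota> R p (c1 R)\<close>.\<close>
    have "cube_bd (der_\<iota> \<iota> p) (\<lambda>R. c1 (insert p R)) R \<in> B (insert p R)"
    proof -
      have "c1 (insert p (R - {x})) \<in> B (insert p (R - {x}))" if "x \<in> R" for x
        unfolding c1_def using that R fin by (intro bp) auto
      then show ?thesis using RX[OF R(1)] R p by (intro der_bd_B) auto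
    qed
    then have "cube_bd \<iota> c1 (insert p R) - cube_bd (der_\<iota> \<iota> p) (\<lambda>R. c1 (insert p R)) R \<in> B (insert p R)"
      using B1 add_subgroup_diff[OF sub_B[OF RX(3)[OF R(1)]]] by blast
    then show "\<iota> R p (c R - cube_bd \<iota> e R) \<in> B (insert p R)"
      using bd_insert[of R p c1] RX[OF R(1)] by (simp add: c1_def)
  qed
  show "\<exists>e. (\<forall>R\<subseteq>insert p Y. Suc (card R) = Suc i \<longrightarrow> e R \<in> A R) \<and>
      (\<forall>R\<subseteq>insert p Y. card R = Suc i \<longrightarrow> c R - cube_bd \<iota> e R \<in> B R)"
  proof (intro exI[of _ e] conjI allI impI)
    fix Q assume Q: "Q \<subseteq> insert p Y" "card Q = Suc i"
    show "c Q - cube_bd \<iota> e Q \<in> B Q"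
    proof (cases "p \<in> Q")
      case True
      then obtain R where R: "R \<subseteq> Y" "Q = insert p R" using split Q by blast
      then show ?thesis using bp[of R] RX(6)[of R] Q by simp
    next
      case False
      then have "Q \<subseteq> Y" using Q by auto
      then show ?thesis using b0 Q by simp
    qed
  qed (use eA in simp)
qed

text \<open>
  The element \<open>v\<close> is the boundary of a chain \<open>u\<close>. Exactness for \<open>insert p Y\<close> and for the derivative
  is used to modify \<open>u\<close> until its coefficients lie in the kernels of the maps \<open>\<iota> R p\<close>, hence, by
  symmetry, in the kernels of all \<open>\<iota> R x\<close>.
\<close>

lemma \<iota>_injective:
  assumes Y: "Y \<subseteq> X" and p: "p \<in> X" "p \<notin> Y" and n: "card Y = n"
    and ex0: "cube_exact A B \<iota> Y n" and ex1: "cube_exact A B \<iota> (insert p Y) n"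
    and ex2: "2 \<le> n \<Longrightarrow> der_exact A B \<iota> p Y (n - 2)"
    and v: "v \<in> A Y" "\<iota> Y p v \<in> B (insert p Y)"
  shows "v \<in> B Y"
proof -
  have finY: "finite Y" using Y finite_X by (rule finite_subset)
  have RX: "R \<subseteq> X" "p \<notin> R" "insert p R \<subseteq> X" "R \<subseteq> insert p Y" "insert p R \<subseteq> insert p Y"
    "card (insert p R) = Suc (card R)" "finite R" if "R \<subseteq> Y" for R
  proof -
    have "p \<notin> R" "R \<subseteq> X" "finite R" using that p Y finite_subset[OF that finY] by auto
    then show "R \<subseteq> X" "p \<notin> R" "insert p R \<subseteq> X" "R \<subseteq> insert p Y" "insert p R \<subseteq> insert p Y"
      "card (insert p R) = Suc (card R)" "finite R" using that p by auto
  qed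
  have split: "\<exists>R\<subseteq>Y. Q = insert p R" if "Q \<subseteq> insert p Y" "p \<in> Q" for Q
    using that p by (intro exI[of _ "Q - {p}"]) auto
  have big: "\<not> (R \<subseteq> Y \<and> card R = Suc n)" for R
    using card_mono[OF finY, of R] n by auto
  obtain u where u: "\<And>R. R \<subseteq> Y \<Longrightarrow> Suc (card R) = n \<Longrightarrow> u R \<in> A R" and vu: "v - cube_bd \<iota> u Y \<in> B Y"
  proof (rule cube_exactE[OF ex0, of "\<lambda>_. v"])
    fix R assume "R \<subseteq> Y" "card R = n"
    then have "R = Y" using n card_subset_eq[OF finY, of R] by simp
    then show "v \<in> A R" using v by simp
  next
    fix R assume "R \<subseteq> Y" "card R = Suc n"
    then show "cube_bd \<iota> (\<lambda>_. v) R \<in> B R" using big by blast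
  next
    fix e assume e1: "\<And>R. R \<subseteq> Y \<Longrightarrow> Suc (card R) = n \<Longrightarrow> e R \<in> A R"
      and e2: "\<And>R. R \<subseteq> Y \<Longrightarrow> card R = n \<Longrightarrow> v - cube_bd \<iota> e R \<in> B R"
    show thesis by (rule that[OF e1 e2[OF subset_refl n]])
  qed
  \<comment> \<open>This is \<open>u\<close> pushed onto the faces through p. Its boundary on
    \<open>insert p Y\<close> is minus the image of the boundary of \<open>u\<close> under adjoining
    p. Modulo \<open>B\<close> that is the negative of \<open>\<iota> Y p v\<close>, so
    \<open>C\<close> is a cycle by the assumption on \<open>v\<close>.\<close>
  define C where "C Q = (if p \<in> Q then \<iota> (Q - {p}) p (u (Q - {p})) else 0)" for Q
  have Cp: "C (insert p R) = \<iota> R p (u R)" "C R = 0" if "R \<subseteq> Y" for R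
  proof -
    have "p \<notin> R" using that p by auto
    then show "C (insert p R) = \<iota> R p (u R)" "C R = 0" by (simp_all add: C_def)
  qed
  have anti: "cube_bd (der_\<iota> \<iota> p) (\<lambda>R. \<iota> R p (w R)) R = - \<iota> R p (cube_bd \<iota> w R)"
    if "R \<subseteq> Y" "\<And>x. x \<in> R \<Longrightarrow> w (R - {x}) \<in> A (R - {x})" for w R
  proof -
    have "cube_bd (der_\<iota> \<iota> p) (\<lambda>R. \<iota> R p (w R)) R + \<iota> R p (cube_bd \<iota> w R) = 0"
      unfolding cube_bd_def \<iota>_sum sum.distrib[symmetric]
    proof (rule sum.neutral, rule ballI)
      fix x assume x: "x \<in> R"
      then have *: "insert x (R - {x}) = R" by auto
      show "\<iota> (insert p (R - {x})) x (\<iota> (R - {x}) p (w (R - {x}))) + \<iota> R p (\<iota> (R - {x}) x (w (R - {x}))) = 0"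
        using \<iota>_anti[of "R - {x}" p x "w (R - {x})"] that x RX[OF that(1)] p unfolding * by auto
    qed
    then show ?thesis by (simp add: eq_neg_iff_add_eq_0)
  qed
  have uY: "u (Y - {x}) \<in> A (Y - {x})" if "x \<in> Y" for x
    using u[of "Y - {x}"] that n finY card_gt_0_iff[of Y] by (auto simp: card_Suc_Diff1)
  obtain E where E: "\<And>Q. Q \<subseteq> insert p Y \<Longrightarrow> Suc (card Q) = n \<Longrightarrow> E Q \<in> A Q"
    "\<And>Q. Q \<subseteq> insert p Y \<Longrightarrow> card Q = n \<Longrightarrow> C Q - cube_bd \<iota> E Q \<in> B Q"
  proof (rule cube_exactE[OF ex1, of C])
    fix Q assume Q: "Q \<subseteq> insert p Y" "card Q = n"
    show "C Q \<in> A Q"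
    proof (cases "p \<in> Q")
      case True
      then obtain R where R: "R \<subseteq> Y" "Q = insert p R" using split Q by blast
      then have "u R \<in> A R" using u RX[OF R(1)] Q by auto
      then show ?thesis using \<iota>_A[of R p] Cp(1) R RX[OF R(1)] p by auto
    next
      case False
      then have "Q \<subseteq> Y" using Q by auto
      then show ?thesis using Cp(2) add_subgroup_zero[OF sub_A] Y by auto
    qed
  next
    fix Q assume Q: "Q \<subseteq> insert p Y" "card Q = Suc n"
    then have "Q = insert p Y"
      using card_seteq[of "insert p Y" Q] finY p n by simp
    moreover have "cube_bd \<iota> C (insert p Y) = \<iota> Y p (v - cube_bd \<iota> u Y) - \<iota> Y p v"
    proof -
      have "cube_bd (der_\<iota> \<iota> p) (\<lambda>R. C (insert p R)) Y = cube_bd (der_\<iota> \<iota> p) (\<lambda>R. \<iota> R p (u R)) Y"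
        by (intro cube.bd_cong[OF der_cube[OF p(1)]] Cp(1)) auto
      then show ?thesis
        using bd_insert[of Y p C] Y p Cp(2)[of Y] anti[of Y u] uY by (simp add: \<iota>_diff)
    qed
    ultimately show "cube_bd \<iota> C Q \<in> B Q"
      using add_subgroup_diff[OF sub_B[of "insert p Y"] \<iota>_B[OF Y p vu] v(2)] Y p by simp
  qed blast
  \<comment> \<open>Because \<open>C\<close> vanishes on Y, the boundary of \<open>E\<close> on Y
    lies in \<open>B Y\<close>. Replacing \<open>u\<close> by \<open>u'\<close> therefore does not
    change its boundary modulo \<open>B Y\<close>, while \<open>\<iota> R p (u' R)\<close> becomes a
    boundary of faces through p.\<close>
  define u' where "u' R = u R - E R" for R
  have u'A: "u' R \<in> A R" if "R \<subseteq> Y" "Suc (card R) = n" for R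
    unfolding u'_def using u[OF that] E(1)[of R] that RX[OF that(1)] add_subgroup_diff[OF sub_A] by auto
  have "C Y = 0" using Cp(2) by blast
  then have EY: "cube_bd \<iota> E Y \<in> B Y"
    using E(2)[of Y] n add_subgroup_uminus[OF sub_B[OF Y], of "- cube_bd \<iota> E Y"] by auto
  have u'B: "\<iota> R p (u' R) - cube_bd (der_\<iota> \<iota> p) (\<lambda>R. E (insert p R)) R \<in> B (insert p R)"
    if R: "R \<subseteq> Y" "Suc (card R) = n" for R
    using E(2)[of "insert p R"] RX[OF R(1)] R bd_insert[of R p E] Cp(1)[OF R(1)]
    by (simp add: u'_def \<iota>_diff algebra_simps)
  \<comment> \<open>The part of \<open>E\<close> on faces through p is a cycle of the derivative of
    degree n-2. Filling it by \<open>z\<close> leaves a correction \<open>y\<close>; since the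
    double boundary of \<open>z\<close> vanishes, only \<open>y\<close> survives, and adding its
    boundary to \<open>u'\<close> moves the coefficients into the kernel.\<close>
  obtain y where yA: "\<And>R. R \<subseteq> Y \<Longrightarrow> Suc (Suc (card R)) = n \<Longrightarrow> y R \<in> A R"
    and yB: "\<And>R. R \<subseteq> Y \<Longrightarrow> Suc (card R) = n \<Longrightarrow> \<iota> R p (u' R + cube_bd \<iota> y R) \<in> B (insert p R)"
  proof (cases "2 \<le> n")
    case False
    have "\<iota> R p (u' R + cube_bd \<iota> (\<lambda>_. 0) R) \<in> B (insert p R)" if R: "R \<subseteq> Y" "Suc (card R) = n" for R
    proof -
      have "R = {}" using False R RX(7)[of R] by (cases "card R") auto
      then show ?thesis using u'B[OF R] by (simp add: cube_bd_def)
    qed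
    then show ?thesis using that[of "\<lambda>_. 0"] False by auto
  next
    case True
    let ?E = "\<lambda>R. E (insert p R)"
    obtain z where z: "\<And>R. R \<subseteq> Y \<Longrightarrow> Suc (card R) = n - 2 \<Longrightarrow> z R \<in> A (insert p R)"
      "\<And>R. R \<subseteq> Y \<Longrightarrow> card R = n - 2 \<Longrightarrow> ?E R - cube_bd (der_\<iota> \<iota> p) z R \<in> der_B A B \<iota> p R"
    proof (rule cube_exactE[OF ex2[OF True], of ?E])
      fix R assume "R \<subseteq> Y" "card R = n - 2"
      then show "?E R \<in> A (insert p R)" using E(1)[of "insert p R"] RX[of R] True by simp
    next
      fix R assume R: "R \<subseteq> Y" "card R = Suc (n - 2)"
      then have Rn: "Suc (card R) = n" using True by auto
      have "- (\<iota> R p (u' R) - cube_bd (der_\<iota> \<iota> p) ?E R) \<in> B (insert p R)" "u' R \<in> A R"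
        using add_subgroup_uminus[OF sub_B[OF RX(3)[OF R(1)]] u'B[OF R(1) Rn]] u'A[OF R(1) Rn] by simp_all
      then show "cube_bd (der_\<iota> \<iota> p) ?E R \<in> der_B A B \<iota> p R"
        using der_BI[of "- (\<iota> R p (u' R) - cube_bd (der_\<iota> \<iota> p) ?E R)" p R "u' R"] by simp
    qed blast
    have "\<exists>b. R \<subseteq> Y \<and> card R = n - 2 \<longrightarrow> b \<in> A R \<and>
        ?E R - cube_bd (der_\<iota> \<iota> p) z R - \<iota> R p b \<in> B (insert p R)" for R
      using z(2) unfolding der_B_def by force
    then obtain y where y: "\<And>R. R \<subseteq> Y \<Longrightarrow> card R = n - 2 \<Longrightarrow> y R \<in> A R"
      "\<And>R. R \<subseteq> Y \<Longrightarrow> card R = n - 2 \<Longrightarrow>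
        ?E R - cube_bd (der_\<iota> \<iota> p) z R - \<iota> R p (y R) \<in> B (insert p R)"
      by metis
    show ?thesis
    proof (rule that[of y])
      fix R assume R: "R \<subseteq> Y" "Suc (card R) = n"
      have D: "cube (X - {p}) (\<lambda>R. A (insert p R)) (der_B A B \<iota> p) (der_\<iota> \<iota> p) (\<lambda>x y R. t x y (insert p R))"
        by (rule der_cube[OF p(1)])
      have cR: "card (R - {x}) = n - 2" "R - {x} \<subseteq> Y" if "x \<in> R" for x
        using that R RX(7)[OF R(1)] by auto
      have "cube_bd (der_\<iota> \<iota> p) (\<lambda>R. ?E R - cube_bd (der_\<iota> \<iota> p) z R - \<iota> R p (y R)) R \<in> B (insert p R)"
        using y(2) cR RX[OF R(1)] p by (intro der_bd_B) auto
      then have "cube_bd (der_\<iota> \<iota> p) ?E R - cube_bd (der_\<iota> \<iota> p) (cube_bd (der_\<iota> \<iota> p) z) R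
          - cube_bd (der_\<iota> \<iota> p) (\<lambda>R. \<iota> R p (y R)) R \<in> B (insert p R)"
        by (simp add: cube.bd_diff[OF D])
      moreover have "cube_bd (der_\<iota> \<iota> p) (cube_bd (der_\<iota> \<iota> p) z) R = 0"
      proof (rule cube.bd_bd[OF D])
        show "R \<subseteq> X - {p}" using RX[OF R(1)] by auto
        fix x y assume xy: "x \<in> R" "y \<in> R" "x \<noteq> y"
        then have "Suc (card (R - {x} - {y})) = n - 2"
          using cR[OF xy(1)] RX(7)[OF R(1)] by (metis card_Suc_Diff1 finite_Diff insert_Diff insert_iff)
        then show "z (R - {x} - {y}) \<in> A (insert p (R - {x} - {y}))"
          using R by (intro z(1)) auto
      qed
      moreover have "cube_bd (der_\<iota> \<iota> p) (\<lambda>R. \<iota> R p (y R)) R = - \<iota> R p (cube_bd \<iota> y R)"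
        using y(1) cR R by (intro anti) auto
      ultimately have "cube_bd (der_\<iota> \<iota> p) ?E R + \<iota> R p (cube_bd \<iota> y R) \<in> B (insert p R)"
        by simp
      from add_subgroup_add[OF sub_B[OF RX(3)[OF R(1)]] this u'B[OF R]]
      show "\<iota> R p (u' R + cube_bd \<iota> y R) \<in> B (insert p R)"
        by (simp add: \<iota>_add algebra_simps)
    qed (use y(1) in auto)
  qed
  \<comment> \<open>Each \<open>w (Y - {x})\<close> is killed by adjoining p, hence by
    \<open>killed_sym\<close> also by adjoining x. So every term of the boundary of \<open>w\<close>
    on Y lies in \<open>B Y\<close>, and up to an element of \<open>B Y\<close> this boundary is
    that of \<open>u\<close>.\<close>
  define w where "w R = u' R + cube_bd \<iota> y R" for R
  have cY: "Suc (card (Y - {x})) = n" "Y - {x} \<subseteq> Y" "x \<in> X" "x \<notin> Y - {x}" "insert x (Y - {x}) = Y" if "x \<in> Y" for x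
    using card_Suc_Diff1[OF finY that] that n Y by auto
  have "cube_bd \<iota> w Y \<in> B Y"
    unfolding cube_bd_def
  proof (intro add_subgroup_sum sub_B Y)
    fix x assume x: "x \<in> Y"
    have "w (Y - {x}) \<in> A (Y - {x})"
      unfolding w_def
    proof (intro add_subgroup_add[OF sub_A] u'A bd_A)
      fix z assume z: "z \<in> Y - {x}"
      have "Suc (Suc (card (Y - {x} - {z}))) = n"
        using cY[OF x] z finY by (metis card_Suc_Diff1 finite_Diff)
      then show "y (Y - {x} - {z}) \<in> A (Y - {x} - {z})" by (intro yA) auto
    qed (use cY[OF x] Y in auto)
    then show "\<iota> (Y - {x}) x (w (Y - {x})) \<in> B Y"
      using killed_sym[of "Y - {x}" p x "w (Y - {x})"] yB[of "Y - {x}"] cY[OF x] Y p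
      unfolding w_def by auto
  qed
  moreover have "cube_bd \<iota> w Y = cube_bd \<iota> u Y - cube_bd \<iota> E Y"
  proof -
    have "cube_bd \<iota> (cube_bd \<iota> y) Y = 0"
    proof (rule bd_bd[OF Y])
      fix x z assume xz: "x \<in> Y" "z \<in> Y" "x \<noteq> z"
      then have "Suc (Suc (card (Y - {x} - {z}))) = n"
        using cY(1)[of x] finY card_Suc_Diff1[of "Y - {x}" z] by simp
      then show "y (Y - {x} - {z}) \<in> A (Y - {x} - {z})" by (intro yA) auto
    qed
    then show ?thesis unfolding w_def u'_def by (simp add: bd_add bd_diff)
  qed
  ultimately have "cube_bd \<iota> u Y - cube_bd \<iota> E Y \<in> B Y"
    by simp
  from add_subgroup_add[OF sub_B[OF Y] this EY] have "cube_bd \<iota> u Y \<in> B Y" by simp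
  from add_subgroup_add[OF sub_B[OF Y] vu this] show ?thesis by simp
qed

end

section \<open>Exactness in a range of degrees\<close>

lemma (in cube) exact_if_trivial:
  assumes AB: "\<And>R. R \<subseteq> X \<Longrightarrow> A R \<subseteq> B R" and Y: "Y \<subseteq> X"
  shows "cube_exact A B \<iota> Y i"
  unfolding cube_exact_def
proof (intro allI impI, elim conjE, intro exI[of _ "\<lambda>_. 0"] conjI allI impI)
  fix R assume "R \<subseteq> Y"
  then show "0 \<in> A R" using Y add_subgroup_zero[OF sub_A] by auto
next
  fix c R assume "\<forall>R\<subseteq>Y. card R = i \<longrightarrow> c R \<in> A R" "R \<subseteq> Y" "card R = i"
  then show "c R - cube_bd \<iota> (\<lambda>_. 0) R \<in> B R" using AB[of R] Y by (auto)
qed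

theorem cube_exact_range:
  assumes "cube X A B \<iota> t"
    and "\<And>Y. Y \<subseteq> X \<Longrightarrow> g \<le> card Y \<Longrightarrow> cube_exact A B \<iota> Y (card Y)"
    and "\<And>Y. Y \<subseteq> X \<Longrightarrow> Suc g \<le> card Y \<Longrightarrow> cube_exact A B \<iota> Y (card Y - 1)"
    and "Y \<subseteq> X" and "2 * g \<le> Suc i"
  shows "cube_exact A B \<iota> Y i"
  using assms
proof (induction g arbitrary: X A B \<iota> t Y i)
  case 0
  then interpret cube X A B \<iota> t by simp
  \<comment> \<open>For g = 0 every subset, the empty one included, is exact in top degree. By
    induction on the size of R each element of \<open>A R\<close> is, modulo \<open>B R\<close>, a
    boundary of elements already known to lie in the denominators.\<close>
  have "A R \<subseteq> B R" if "R \<subseteq> X" for R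
    using that
  proof (induction "card R" arbitrary: R rule: less_induct)
    case less
    show ?case
    proof
      fix a assume a: "a \<in> A R"
      have fin: "finite R" using less.prems finite_X by (rule finite_subset)
      obtain e where e: "\<And>Q. Q \<subseteq> R \<Longrightarrow> Suc (card Q) = card R \<Longrightarrow> e Q \<in> A Q" "a - cube_bd \<iota> e R \<in> B R"
      proof (rule cube_exactE[OF 0(2)[of R], of "\<lambda>_. a"])
        fix Q assume "Q \<subseteq> R" "card Q = card R"
        then show "a \<in> A Q" using a card_subset_eq[OF fin] by metis
      next
        fix Q assume "Q \<subseteq> R" "card Q = Suc (card R)"
        then show "cube_bd \<iota> (\<lambda>_. a) Q \<in> B Q" using card_mono[OF fin, of Q] by simp
      qed (use less.prems in auto)
      have "cube_bd \<iota> e R \<in> B R"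
      proof (rule bd_B[OF less.prems])
        fix x assume x: "x \<in> R"
        then have "Suc (card (R - {x})) = card R" using fin by (intro card_Suc_Diff1)
        then show "e (R - {x}) \<in> B (R - {x})"
          using e(1)[of "R - {x}"] less.hyps[of "R - {x}"] less.prems by auto
      qed
      from add_subgroup_add[OF sub_B[OF less.prems] e(2) this] show "a \<in> B R" by simp
    qed
  qed
  then show ?case using 0 by (intro exact_if_trivial) auto
next
  case (Suc g)
  then interpret cube X A B \<iota> t by simp
  show ?case
  proof (cases "Y = {}")
    case True
    \<comment> \<open>Here i is positive, so the empty set has no face of degree i; all that remains
      is to name a chain e with its values in \<open>A\<close>.\<close>
    have "0 \<in> A {}" using add_subgroup_zero[OF sub_A] by simp
    then show ?thesis using True Suc.prems(5) unfolding cube_exact_def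
      by (auto intro: exI[of _ "\<lambda>_. 0"])
  next
    case False
    then obtain p where p: "p \<in> Y" by auto
    define Y' where "Y' = Y - {p}"
    have Y': "Y' \<subseteq> X" "p \<in> X" "p \<notin> Y'" "Y = insert p Y'" "Y' \<subseteq> X - {p}"
      using p Suc.prems(4) by (auto simp: Y'_def)
    obtain i' where i': "i = Suc i'" using Suc.prems(5) by (cases i) auto
    \<comment> \<open>Adding p raises sizes and degrees by one, so the bounds g+1 and g+2 for
      \<open>insert p Z\<close> become g and g+1 for \<open>Z\<close>.\<close>
    have IH: "der_exact A B \<iota> p Z j" if "Z \<subseteq> X - {p}" "2 * g \<le> Suc j" for Z j
    proof (rule Suc.IH[OF der_cube[OF Y'(2)] _ _ that])
      fix Z assume Z: "Z \<subseteq> X - {p}"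
      then have Zp: "Z \<subseteq> X" "p \<notin> Z" "insert p Z \<subseteq> X" "card (insert p Z) = Suc (card Z)"
        using Y'(2) card_insert_p[of Z p] by auto
      show "der_exact A B \<iota> p Z (card Z)" if "g \<le> card Z"
        using Suc.prems(2)[of "insert p Z"] that Zp Y' by (intro der_exact_down) auto
      show "der_exact A B \<iota> p Z (card Z - 1)" if "Suc g \<le> card Z"
        using Suc.prems(3)[of "insert p Z"] that Zp Y' by (intro der_exact_down) auto
    qed
    have "cube_exact A B \<iota> (insert p Y') (Suc i')"
    proof (rule der_exact_up[OF Y'(1-3)])
      show "der_exact A B \<iota> p Y' i'" using Y' Suc.prems(5) i' by (intro IH) auto
      fix R a assume R: "R \<subseteq> Y'" "card R = Suc i'" and a: "a \<in> A R" "\<iota> R p a \<in> B (insert p R)"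
      have Rp: "R \<subseteq> X" "p \<notin> R" "insert p R \<subseteq> X" "card (insert p R) = Suc (card R)" "R \<subseteq> X - {p}"
        using Y' R card_insert_p[of R p] by auto
      show "a \<in> B R"
      proof (rule \<iota>_injective[OF Rp(1) Y'(2) Rp(2) R(2) _ _ _ a])
        show "cube_exact A B \<iota> R (Suc i')"
          using Suc.prems(2)[of R] Rp R Suc.prems(5) i' by simp
        show "cube_exact A B \<iota> (insert p R) (Suc i')"
          using Suc.prems(3)[of "insert p R"] Rp R Suc.prems(5) i' by simp
        \<comment> \<open>The assumption 2(g+1) \<le> i+1 is exactly 2g \<le> (i-2)+1, the bound
          required by the induction hypothesis.\<close>
        show "der_exact A B \<iota> p R (Suc i' - 2)" if "2 \<le> Suc i'"
          using Rp Suc.prems(5) i' that by (intro IH) auto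
      qed
    qed
    then show ?thesis using Y'(4) i' by simp
  qed
qed

section \<open>Permutations preserving an initial segment\<close>

lemma young_commute:
  fixes i m :: nat
  assumes "\<sigma> permutes {1..i}" "\<tau> permutes {i+1..m}"
  shows "\<sigma> \<circ> \<tau> = \<tau> \<circ> \<sigma>"
proof
  fix x
  consider "x \<in> {1..i}" | "x \<in> {i+1..m}" | "x \<notin> {1..i}" "x \<notin> {i+1..m}" by blast
  then show "(\<sigma> \<circ> \<tau>) x = (\<tau> \<circ> \<sigma>) x"
  proof cases
    case 1
    then have "\<sigma> x \<in> {1..i}" using permutes_in_image[OF assms(1)] by blast
    then have "\<sigma> x \<notin> {i+1..m}" "x \<notin> {i+1..m}" using 1 by auto
    then show ?thesis using permutes_not_in[OF assms(2)] by simp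
  next
    case 2
    then have "\<tau> x \<in> {i+1..m}" using permutes_in_image[OF assms(2)] by blast
    then have "\<tau> x \<notin> {1..i}" "x \<notin> {1..i}" using 2 by auto
    then show ?thesis using permutes_not_in[OF assms(1)] by simp
  next
    case 3
    then show ?thesis using permutes_not_in[OF assms(2)] permutes_not_in[OF assms(1)] by simp
  qed
qed

lemma young_restrict:
  fixes i m :: nat
  assumes "\<sigma> permutes {1..i}" "\<tau> permutes {i+1..m}"
  shows "perm_restrict (\<sigma> \<circ> \<tau>) {1..i} = \<sigma>" "perm_restrict (\<sigma> \<circ> \<tau>) {i+1..m} = \<tau>"
proof -
  show "perm_restrict (\<sigma> \<circ> \<tau>) {1..i} = \<sigma>"
  proof
    fix x
    show "perm_restrict (\<sigma> \<circ> \<tau>) {1..i} x = \<sigma> x"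
      using permutes_not_in[OF assms(1), of x] permutes_not_in[OF assms(2), of x]
      by (auto simp: perm_restrict_def)
  qed
  show "perm_restrict (\<sigma> \<circ> \<tau>) {i+1..m} = \<tau>"
  proof
    fix x
    show "perm_restrict (\<sigma> \<circ> \<tau>) {i+1..m} x = \<tau> x"
    proof (cases "x \<in> {i+1..m}")
      case True
      then have "\<tau> x \<in> {i+1..m}" using permutes_in_image[OF assms(2)] by blast
      then show ?thesis using permutes_not_in[OF assms(1), of "\<tau> x"] True by (simp add: perm_restrict_def)
    next
      case False
      then have "\<tau> x = x" "perm_restrict (\<sigma> \<circ> \<tau>) {i+1..m} x = x"
        using permutes_not_in[OF assms(2), of x] by (auto simp: perm_restrict_def)
      then show ?thesis by simp
    qed
  qed
qed

lemma inv_young: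
  fixes i m :: nat
  assumes "\<sigma> permutes {1..i}" "\<tau> permutes {i+1..m}"
  shows "inv (\<sigma> \<circ> \<tau>) = inv \<sigma> \<circ> inv \<tau>"
proof -
  have "inv (\<sigma> \<circ> \<tau>) = inv \<tau> \<circ> inv \<sigma>"
    using permutes_bij assms by (intro o_inv_distrib) auto
  then show ?thesis
    using young_commute[OF permutes_inv permutes_inv, OF assms] by simp
qed

lemma permutes_preserving_young:
  fixes i m :: nat
  assumes "h permutes {1..m}" "h ` {1..i} = {1..i}" "i \<le> m"
  shows "\<exists>\<sigma> \<tau>. \<sigma> permutes {1..i} \<and> \<tau> permutes {i+1..m} \<and> h = \<sigma> \<circ> \<tau>"
proof -
  define \<sigma> \<tau> where "\<sigma> x = (if x \<in> {1..i} then h x else x)" and "\<tau> x = (if x \<in> {1..i} then x else h x)" for x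
  have h1: "h x \<in> {1..i} \<longleftrightarrow> x \<in> {1..i}" for x
    using assms(2) permutes_inj[OF assms(1)] by (metis inj_image_mem_iff)
  have inj: "inj_on h Z" for Z using permutes_inj[OF assms(1)] by (rule inj_on_subset) simp
  have img: "h ` {i+1..m} = {i+1..m}"
  proof -
    have "{i+1..m} = {1..m} - {1..i}" by auto
    then show ?thesis
      using permutes_image[OF assms(1)] assms(2) image_set_diff[OF permutes_inj[OF assms(1)], of "{1..m}" "{1..i}"]
      by simp
  qed
  have "\<sigma> permutes {1..i}"
  proof (rule bij_imp_permutes)
    show "bij_betw \<sigma> {1..i} {1..i}"
      using bij_betw_imageI[OF inj assms(2)] by (subst bij_betw_cong[of _ _ h]) (auto simp: \<sigma>_def)
  qed (auto simp: \<sigma>_def)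
  moreover have "\<tau> permutes {i+1..m}"
  proof (rule bij_imp_permutes)
    show "bij_betw \<tau> {i+1..m} {i+1..m}"
      using bij_betw_imageI[OF inj img] by (subst bij_betw_cong[of _ _ h]) (auto simp: \<tau>_def)
    show "\<tau> x = x" if "x \<notin> {i+1..m}" for x
      using that assms(3) permutes_not_in[OF assms(1), of x] by (auto simp: \<tau>_def)
  qed
  moreover have "h = \<sigma> \<circ> \<tau>"
    using h1 by (auto simp: \<sigma>_def \<tau>_def fun_eq_iff)
  ultimately show ?thesis by blast
qed

lemma ex_permutes_image:
  assumes "R \<subseteq> {1..m}"
  shows "\<exists>g. g permutes {1..m} \<and> g ` {1..card R} = R"
proof -
  have fin: "finite R" using assms finite_subset by blast
  have le: "card R \<le> m" using card_mono[OF _ assms] by simp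
  obtain f1 where f1: "bij_betw f1 {1..card R} R"
    using fin by (metis card_atLeastAtMost diff_Suc_1 finite_atLeastAtMost finite_same_card_bij)
  have "card {card R + 1..m} = card ({1..m} - R)"
    using card_Diff_subset[OF fin assms] by simp
  then obtain f2 where f2: "bij_betw f2 {card R + 1..m} ({1..m} - R)"
    using finite_same_card_bij by blast
  define g where "g x = (if x \<in> {1..card R} then f1 x else if x \<in> {card R+1..m} then f2 x else x)" for x
  have g1: "bij_betw g {1..card R} R"
    using f1 by (subst bij_betw_cong[of _ _ f1]) (auto simp: g_def)
  have g2: "bij_betw g {card R+1..m} ({1..m} - R)"
    using f2 by (subst bij_betw_cong[of _ _ f2]) (auto simp: g_def)
  have "bij_betw g ({1..card R} \<union> {card R+1..m}) (R \<union> ({1..m} - R))"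
    using g1 g2 by (rule bij_betw_combine) auto
  moreover have "{1..card R} \<union> {card R+1..m} = {1..m}" "R \<union> ({1..m} - R) = {1..m}"
    using le assms by auto
  ultimately have "bij_betw g {1..m} {1..m}" by simp
  then have "g permutes {1..m}" by (rule bij_imp_permutes) (use le in \<open>auto simp: g_def\<close>)
  then show ?thesis using g1 bij_betw_imp_surj_on by blast
qed

text \<open>A permutation g will stand for the face that is the image of the initial segment under
  it. In these terms \<open>g \<circ> transpose a (i+1)\<close> runs through the facets of the face
  with i+1 elements given by g, the one for a omitting \<open>g a\<close>.\<close>

lemma image_transpose_Suc:
  fixes i :: nat
  assumes "inj g" "a \<in> {1..i+1}"
  shows "(g \<circ> transpose a (i+1)) ` {1..i} = g ` {1..i+1} - {g a}"
proof -
  have "transpose a (i+1) ` {1..i} = {1..i+1} - {a}"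
  proof -
    have "{1..i} = {1..i+1} - {i+1}" by auto
    then have "transpose a (i+1) ` {1..i} = transpose a (i+1) ` {1..i+1} - {a}"
      by (simp add: image_set_diff)
    also have "transpose a (i+1) ` {1..i+1} = {1..i+1}"
      using permutes_image[OF permutes_swap_id[OF assms(2), of "i+1"]] by simp
    finally show ?thesis .
  qed
  then have "(g \<circ> transpose a (i+1)) ` {1..i} = g ` ({1..i+1} - {a})" by (metis image_comp)
  also have "\<dots> = g ` {1..i+1} - {g a}" using image_set_diff[OF assms(1)] by simp
  finally show ?thesis .
qed

lemma sum_fun_apply: "(\<Sum>x\<in>I. f x) g = (\<Sum>x\<in>I. f x g)"
  by (induction I rule: infinite_finite_induct) auto

section \<open>Central stabilization\<close>

locale coherent_seq = vector_space s
  for s :: "'f::field \<Rightarrow> 'v::ab_group_add \<Rightarrow> 'v" +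
  fixes V :: "nat \<Rightarrow> 'v set" and \<rho> :: "nat \<Rightarrow> (nat \<Rightarrow> nat) \<Rightarrow> 'v \<Rightarrow> 'v"
    and \<phi> :: "nat \<Rightarrow> 'v \<Rightarrow> 'v"
  assumes coh: "coherent_sequence s V \<rho> \<phi>"
begin

lemma
  assumes "1 \<le> i"
  shows V_subspace: "subspace (V i)"
    and \<rho>_V: "g permutes {1..i} \<Longrightarrow> v \<in> V i \<Longrightarrow> \<rho> i g v \<in> V i"
    and \<rho>_add: "g permutes {1..i} \<Longrightarrow> v \<in> V i \<Longrightarrow> w \<in> V i \<Longrightarrow> \<rho> i g (v + w) = \<rho> i g v + \<rho> i g w"
    and \<rho>_scale: "g permutes {1..i} \<Longrightarrow> v \<in> V i \<Longrightarrow> \<rho> i g (s c v) = s c (\<rho> i g v)"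
    and \<rho>_id: "v \<in> V i \<Longrightarrow> \<rho> i id v = v"
    and \<rho>_comp: "g permutes {1..i} \<Longrightarrow> h permutes {1..i} \<Longrightarrow> v \<in> V i \<Longrightarrow> \<rho> i (g \<circ> h) v = \<rho> i g (\<rho> i h v)"
    and \<phi>_V: "v \<in> V i \<Longrightarrow> \<phi> i v \<in> V (i + 1)"
    and \<phi>_add: "v \<in> V i \<Longrightarrow> w \<in> V i \<Longrightarrow> \<phi> i (v + w) = \<phi> i v + \<phi> i w"
    and \<phi>_scale: "v \<in> V i \<Longrightarrow> \<phi> i (s c v) = s c (\<phi> i v)"
    and \<phi>_\<rho>: "g permutes {1..i} \<Longrightarrow> v \<in> V i \<Longrightarrow> \<phi> i (\<rho> i g v) = \<rho> (i + 1) g (\<phi> i v)"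
proof -
  have c: "Defs.representation s (S i) (V i) (\<rho> i)" "\<phi> i ` V i \<subseteq> V (i + 1)"
    "linear_map_on s s (V i) (\<phi> i)" "equivariant_on (S i) (V i) (\<rho> i) (\<rho> (i + 1)) (\<phi> i)"
    using coh assms unfolding coherent_sequence_def by simp_all
  show "subspace (V i)"
    using c(1) by (simp add: Defs.representation_def)
  show "\<rho> i g v \<in> V i" if "g permutes {1..i}" "v \<in> V i"
    using c(1) that by (auto simp: Defs.representation_def)
  show "\<rho> i g (v + w) = \<rho> i g v + \<rho> i g w" if "g permutes {1..i}" "v \<in> V i" "w \<in> V i"
    using c(1) that by (simp add: Defs.representation_def linear_map_on_def)
  show "\<rho> i g (s c v) = s c (\<rho> i g v)" if "g permutes {1..i}" "v \<in> V i"
    using c(1) that by (simp add: Defs.representation_def linear_map_on_def)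
  show "\<rho> i id v = v" if "v \<in> V i"
    using c(1) that by (simp add: Defs.representation_def)
  show "\<rho> i (g \<circ> h) v = \<rho> i g (\<rho> i h v)" if "g permutes {1..i}" "h permutes {1..i}" "v \<in> V i"
    using c(1) that by (simp add: Defs.representation_def)
  show "\<phi> i v \<in> V (i + 1)" if "v \<in> V i"
    using c(2) that by auto
  show "\<phi> i (v + w) = \<phi> i v + \<phi> i w" if "v \<in> V i" "w \<in> V i"
    using c(3) that by (simp add: linear_map_on_def)
  show "\<phi> i (s c v) = s c (\<phi> i v)" if "v \<in> V i"
    using c(3) that by (simp add: linear_map_on_def)
  show "\<phi> i (\<rho> i g v) = \<rho> (i + 1) g (\<phi> i v)" if "g permutes {1..i}" "v \<in> V i"
    using c(4) that by (simp add: equivariant_on_def)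
qed

lemma V_0: "1 \<le> i \<Longrightarrow> 0 \<in> V i"
  and V_scale: "1 \<le> i \<Longrightarrow> v \<in> V i \<Longrightarrow> s c v \<in> V i"
  and V_diff: "1 \<le> i \<Longrightarrow> v \<in> V i \<Longrightarrow> w \<in> V i \<Longrightarrow> v - w \<in> V i"
  and V_add: "1 \<le> i \<Longrightarrow> v \<in> V i \<Longrightarrow> w \<in> V i \<Longrightarrow> v + w \<in> V i"
  by (simp_all add: V_subspace subspace_0 subspace_scale subspace_diff subspace_add)

lemma \<rho>_0: "1 \<le> i \<Longrightarrow> g permutes {1..i} \<Longrightarrow> \<rho> i g 0 = 0"
  using \<rho>_scale[of i g 0 0] V_0 by simp

lemma \<rho>_diff: "1 \<le> i \<Longrightarrow> g permutes {1..i} \<Longrightarrow> v \<in> V i \<Longrightarrow> w \<in> V i \<Longrightarrow> \<rho> i g (v - w) = \<rho> i g v - \<rho> i g w"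
  using \<rho>_add[of i g "v - w" w] V_diff by simp

sublocale fs: vector_space "fun_scale s :: 'f \<Rightarrow> ('a \<Rightarrow> 'v) \<Rightarrow> ('a \<Rightarrow> 'v)"
  by unfold_locales (simp_all add: fun_scale_def fun_eq_iff scale_right_distrib scale_left_distrib)

section \<open>The induced representation and its relations\<close>

abbreviation W :: "nat \<Rightarrow> ((nat \<Rightarrow> nat) \<Rightarrow> 'v) set" where
  "W n \<equiv> ind (S (n + 1)) (S n) (V n) (\<rho> n)"

abbreviation U :: "nat \<Rightarrow> ((nat \<Rightarrow> nat) \<Rightarrow> 'v) set" where
  "U n \<equiv> cstab_relations s n (V (n - 1)) (\<phi> (n - 1)) (\<rho> n)"

abbreviation emb :: "nat \<Rightarrow> 'v \<Rightarrow> (nat \<Rightarrow> nat) \<Rightarrow> 'v" where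
  "emb n \<equiv> ind_incl (S n) (\<rho> n)"

lemma ind_act_comp:
  assumes "g permutes Y" "h permutes Y"
  shows "ind_act g (ind_act h f) = ind_act (g \<circ> h) f"
  unfolding ind_act_def o_inv_distrib[OF permutes_bij[OF assms(1)] permutes_bij[OF assms(2)]]
  by (simp add: comp_assoc)

lemma ind_act_add: "ind_act g (f + f') = ind_act g f + ind_act g f'"
  and ind_act_diff: "ind_act g (f - f') = ind_act g f - ind_act g f'"
  and ind_act_scale: "ind_act g (fun_scale s c f) = fun_scale s c (ind_act g f)"
  and ind_act_0: "ind_act g 0 = 0"
  by (auto simp: ind_act_def fun_eq_iff fun_scale_def)

lemma ind_act_id: "ind_act id f = f"
  by (simp add: ind_act_def)

lemma U_act:
  assumes g: "g permutes {1..n+1}" and u: "u \<in> U n"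
  shows "ind_act g u \<in> U n"
  using u unfolding cstab_relations_def
proof (induction rule: fs.span_induct_alt)
  case base
  show ?case by (simp only: ind_act_0 fs.span_zero)
next
  case (step c x y)
  then obtain h w where x: "x = ind_act h (w - ind_act (transpose n (n + 1)) w)" "h permutes {1..n+1}"
    "w \<in> (\<lambda>v. emb n (\<phi> (n - 1) v)) ` V (n - 1)" by auto
  then have "ind_act g x = ind_act (g \<circ> h) (w - ind_act (transpose n (n + 1)) w)"
    using ind_act_comp[OF g x(2)] by simp
  then have gx: "ind_act g x \<in> {ind_act g (w - ind_act (transpose n (n + 1)) w) | g w.
      g \<in> S (n + 1) \<and> w \<in> (\<lambda>v. emb n (\<phi> (n - 1) v)) ` V (n - 1)}"
    using x(3) permutes_compose[OF x(2) g] by blast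
  show ?case
    unfolding ind_act_add ind_act_scale
    by (rule fs.span_add[OF fs.span_scale[OF fs.span_base[OF gx]] step.IH])
qed

lemma U_0: "0 \<in> U n" and U_add: "u \<in> U n \<Longrightarrow> u' \<in> U n \<Longrightarrow> u + u' \<in> U n"
  and U_diff: "u \<in> U n \<Longrightarrow> u' \<in> U n \<Longrightarrow> u - u' \<in> U n"
  unfolding cstab_relations_def by (auto intro: fs.span_zero fs.span_add fs.span_diff)

lemma coset_add_coset: "coset_add (coset (U n) w) (coset (U n) w') = coset (U n) (w + w')"
proof
  show "coset_add (coset (U n) w) (coset (U n) w') \<subseteq> coset (U n) (w + w')"
  proof
    fix x assume "x \<in> coset_add (coset (U n) w) (coset (U n) w')"
    then obtain u u' where "x = (w + u) + (w' + u')" "u \<in> U n" "u' \<in> U n"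
      unfolding coset_add_def coset_def by blast
    then have "x = (w + w') + (u + u')" "u + u' \<in> U n" by (simp_all only: ac_simps U_add)
    then show "x \<in> coset (U n) (w + w')" unfolding coset_def by blast
  qed
  show "coset (U n) (w + w') \<subseteq> coset_add (coset (U n) w) (coset (U n) w')"
  proof
    fix x assume "x \<in> coset (U n) (w + w')"
    then obtain u where u: "x = w + w' + u" "u \<in> U n"
      unfolding coset_def by blast
    have "x = (w + u) + (w' + 0)" unfolding u(1) by (simp only: ac_simps add_0_left)
    with u(2) show "x \<in> coset_add (coset (U n) w) (coset (U n) w')"
      unfolding coset_add_def coset_def using U_0 by blast
  qed
qed

lemma act_coset:
  assumes g: "g permutes {1..n+1}"
  shows "ind_act g ` coset (U n) w = coset (U n) (ind_act g w)"
proof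
  show "ind_act g ` coset (U n) w \<subseteq> coset (U n) (ind_act g w)"
    using U_act[OF g] unfolding coset_def by (auto simp: ind_act_add)
  show "coset (U n) (ind_act g w) \<subseteq> ind_act g ` coset (U n) w"
  proof
    fix x assume "x \<in> coset (U n) (ind_act g w)"
    then obtain u where u: "x = ind_act g w + u" "u \<in> U n" unfolding coset_def by blast
    have "ind_act g (ind_act (inv g) u) = u"
      using ind_act_comp[OF g permutes_inv[OF g], of u] permutes_inv_o(1)[OF g] by (simp add: ind_act_id)
    then have "x = ind_act g (w + ind_act (inv g) u)" using u by (simp add: ind_act_add)
    then show "x \<in> ind_act g ` coset (U n) w"
      unfolding coset_def using U_act[OF permutes_inv[OF g] u(2)] by blast
  qed
qed

lemma WI:
  assumes "\<And>g. g permutes {1..n+1} \<Longrightarrow> f g \<in> V n" "\<And>g. \<not> g permutes {1..n+1} \<Longrightarrow> f g = 0"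
    "\<And>g h. g permutes {1..n+1} \<Longrightarrow> h permutes {1..n} \<Longrightarrow> f (g \<circ> h) = \<rho> n (inv h) (f g)"
  shows "f \<in> W n"
  using assms by (simp add: ind_def)

lemma
  assumes "f \<in> W n"
  shows W_V: "g permutes {1..n+1} \<Longrightarrow> f g \<in> V n" and W_out: "\<not> g permutes {1..n+1} \<Longrightarrow> f g = 0"
    and W_\<sigma>: "g permutes {1..n+1} \<Longrightarrow> h permutes {1..n} \<Longrightarrow> f (g \<circ> h) = \<rho> n (inv h) (f g)"
  using assms by (simp_all add: ind_def)

lemma W_add:
  assumes n: "1 \<le> n" and a: "a \<in> W n" and b: "b \<in> W n"
  shows "a + b \<in> W n"
  by (rule WI) (use W_V[OF a] W_V[OF b] W_out[OF a] W_out[OF b] W_\<sigma>[OF a] W_\<sigma>[OF b]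
      V_add[OF n] \<rho>_add[OF n] in \<open>simp_all add: permutes_inv\<close>)

lemma W_diff:
  assumes n: "1 \<le> n" and a: "a \<in> W n" and b: "b \<in> W n"
  shows "a - b \<in> W n"
  by (rule WI) (use W_V[OF a] W_V[OF b] W_out[OF a] W_out[OF b] W_\<sigma>[OF a] W_\<sigma>[OF b]
      V_diff[OF n] \<rho>_diff[OF n] in \<open>simp_all add: permutes_inv\<close>)

lemma W_0: "1 \<le> n \<Longrightarrow> 0 \<in> W n"
  by (rule WI) (auto simp: V_0 \<rho>_0 permutes_inv)

lemma W_sum: "1 \<le> n \<Longrightarrow> (\<And>x. x \<in> I \<Longrightarrow> f x \<in> W n) \<Longrightarrow> sum f I \<in> W n"
  by (induction I rule: infinite_finite_induct) (simp_all only: sum.infinite sum.empty sum.insert W_0 W_add insertI1 insertI2 not_False_eq_True)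

lemma W_act:
  assumes g: "g permutes {1..n+1}" and f: "f \<in> W n"
  shows "ind_act g f \<in> W n"
proof (rule WI)
  fix h assume h: "h permutes {1..n+1}"
  then have gh: "inv g \<circ> h permutes {1..n+1}" using permutes_compose[OF h permutes_inv[OF g]] by simp
  show "ind_act g f h \<in> V n" using W_V[OF f gh] by (simp add: ind_act_def)
  show "ind_act g f (h \<circ> \<sigma>) = \<rho> n (inv \<sigma>) (ind_act g f h)" if "\<sigma> permutes {1..n}" for \<sigma>
    using W_\<sigma>[OF f gh that] by (simp add: ind_act_def comp_assoc)
next
  fix h assume h: "\<not> h permutes {1..n+1}"
  have "\<not> inv g \<circ> h permutes {1..n+1}"
  proof
    assume "inv g \<circ> h permutes {1..n+1}"
    from permutes_compose[OF this g] show False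
      using h permutes_inv_o(1)[OF g] by (simp add: comp_assoc[symmetric])
  qed
  then show "ind_act g f h = 0" using W_out[OF f] by (simp add: ind_act_def)
qed

lemma j_W:
  assumes n: "1 \<le> n" and v: "v \<in> V n"
  shows "emb n v \<in> W n"
proof (rule WI)
  fix g show "emb n v g \<in> V n"
    using \<rho>_V[OF n permutes_inv v] V_0[OF n] by (simp add: ind_incl_def)
  show "emb n v g = 0" if "\<not> g permutes {1..n+1}"
    using that permutes_subset[of g "{1..n}" "{1..n+1}"] by (auto simp: ind_incl_def)
  fix h assume h: "h permutes {1..n}"
  have *: "g \<circ> h permutes {1..n} \<longleftrightarrow> g permutes {1..n}"
  proof
    assume "g \<circ> h permutes {1..n}"
    from permutes_compose[OF permutes_inv[OF h] this] show "g permutes {1..n}"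
      using permutes_inv_o(1)[OF h] by (simp add: comp_assoc)
  qed (use permutes_compose[OF h] in blast)
  show "emb n v (g \<circ> h) = \<rho> n (inv h) (emb n v g)"
  proof (cases "g permutes {1..n}")
    case True
    then have "inv (g \<circ> h) = inv h \<circ> inv g" using o_inv_distrib permutes_bij h by blast
    then show ?thesis using True * \<rho>_comp[OF n permutes_inv[OF h] permutes_inv[OF True] v] by (simp add: ind_incl_def)
  next
    case False
    then show ?thesis using * \<rho>_0[OF n permutes_inv[OF h]] by (simp add: ind_incl_def)
  qed
qed

text \<open>The transpositions (a, n+1), with the identity for a = n+1, represent the cosets of S_n
  in S_{n+1}, a coset being determined by the common value of its elements at n+1. Hence at a
  permutation g only the summand with a = g(n+1) is nonzero.\<close>

lemma W_decomp:
  assumes n: "1 \<le> n" and w: "w \<in> W n"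
  shows "w = (\<Sum>a\<in>{1..n+1}. ind_act (transpose a (n+1)) (emb n (w (transpose a (n+1)))))"
proof
  fix g
  have tr: "transpose a (n+1) permutes {1..n+1}" if "a \<in> {1..n+1}" for a
    using permutes_swap_id[OF that, of "n+1"] by simp
  have e: "ind_act (transpose a (n+1)) (emb n v) g = (if transpose a (n+1) \<circ> g permutes {1..n}
      then \<rho> n (inv (transpose a (n+1) \<circ> g)) v else 0)" for a v
    by (simp add: ind_act_def ind_incl_def)
  show "w g = (\<Sum>a\<in>{1..n+1}. ind_act (transpose a (n+1)) (emb n (w (transpose a (n+1))))) g"
  proof (cases "g permutes {1..n+1}")
    case False
    have "\<not> transpose a (n+1) \<circ> g permutes {1..n}" if "a \<in> {1..n+1}" for a
    proof
      assume "transpose a (n+1) \<circ> g permutes {1..n}"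
      then have "transpose a (n+1) \<circ> g permutes {1..n+1}" by (rule permutes_subset) auto
      from permutes_compose[OF this tr[OF that]] show False
        using False by (simp add: comp_assoc[symmetric])
    qed
    then show ?thesis using False W_out[OF w] unfolding sum_fun_apply e by simp
  next
    case True
    define b where "b = g (n+1)"
    have b: "b \<in> {1..n+1}" using permutes_in_image[OF True, of "n+1"] by (simp add: b_def)
    have perm: "transpose a (n+1) \<circ> g permutes {1..n} \<longleftrightarrow> a = b" if a: "a \<in> {1..n+1}" for a
    proof
      assume "transpose a (n+1) \<circ> g permutes {1..n}"
      then have "(transpose a (n+1) \<circ> g) (n+1) = n+1" by (rule permutes_not_in) simp
      then have "transpose a (n+1) b = n+1" by (simp add: b_def)
      then show "a = b" by (metis transpose_apply_second transpose_involutory)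
    next
      assume "a = b"
      show "transpose a (n+1) \<circ> g permutes {1..n}"
      proof (rule permutes_superset[OF permutes_compose[OF True tr[OF a]]])
        fix x assume "x \<in> {1..n+1} - {1..n}"
        then have "x = n+1" by auto
        then show "(transpose a (n+1) \<circ> g) x = x" using \<open>a = b\<close> by (simp add: b_def)
      qed
    qed
    define h where "h = transpose b (n+1) \<circ> g"
    have h: "h permutes {1..n}" using perm[OF b] by (simp add: h_def)
    have gh: "g = transpose b (n+1) \<circ> h" by (simp add: h_def fun_eq_iff)
    have "(\<Sum>a\<in>{1..n+1}. ind_act (transpose a (n+1)) (emb n (w (transpose a (n+1))))) g
        = (\<Sum>a\<in>{1..n+1}. if a = b then \<rho> n (inv h) (w (transpose b (n+1))) else 0)"
      unfolding sum_fun_apply e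
    proof (rule sum.cong[OF refl])
      fix a assume a: "a \<in> {1..n+1}"
      show "(if transpose a (n+1) \<circ> g permutes {1..n}
          then \<rho> n (inv (transpose a (n+1) \<circ> g)) (w (transpose a (n+1))) else 0)
        = (if a = b then \<rho> n (inv h) (w (transpose b (n+1))) else 0)"
        unfolding perm[OF a] h_def by (cases "a = b") simp_all
    qed
    also have "\<dots> = \<rho> n (inv h) (w (transpose b (n+1)))"
      using b by (simp only: sum.delta finite_atLeastAtMost if_True)
    also have "\<dots> = w g" using W_\<sigma>[OF w tr[OF b] h] gh by simp
    finally show ?thesis by simp
  qed
qed

text \<open>Replaces the set of cosets by a surjection \<open>G\<close> from \<open>W n\<close> onto
  \<open>V (n+1)\<close> with kernel \<open>U n\<close>. As W is generated by the translates of
  \<open>V n\<close>, equivariance and the values of \<open>G\<close> on \<open>V n\<close> force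
  the explicit formula, which later reappears as a cube boundary.\<close>

lemma cstab_quotient:
  assumes n: "1 \<le> n" and iso: "cstab_iso s V \<rho> \<phi> n F"
  obtains G where "\<And>w. w \<in> W n \<Longrightarrow> G w = (\<Sum>a\<in>{1..n+1}. \<rho> (n+1) (transpose a (n+1)) (\<phi> n (w (transpose a (n+1)))))"
    and "\<And>v. v \<in> V (n+1) \<Longrightarrow> \<exists>w\<in>W n. G w = v"
    and "\<And>w. w \<in> W n \<Longrightarrow> G w = 0 \<longleftrightarrow> w \<in> U n"
    and "\<And>w w'. w \<in> W n \<Longrightarrow> w' \<in> W n \<Longrightarrow> G (w + w') = G w + G w'"
    and "\<And>g w. g permutes {1..n+1} \<Longrightarrow> w \<in> W n \<Longrightarrow> G (ind_act g w) = \<rho> (n+1) g (G w)"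
    and "\<And>v. v \<in> V n \<Longrightarrow> G (emb n v) = \<phi> n v"
proof -
  define G where "G w = F (coset (U n) w)" for w
  have Q: "central_stabilization s n (V (n - 1)) (\<phi> (n - 1)) (V n) (\<rho> n) = coset (U n) ` W n"
    by (simp add: central_stabilization_def)
  note iso' = iso[unfolded cstab_iso_def Let_def Q]
  have bij: "bij_betw F (coset (U n) ` W n) (V (n + 1))" using iso' by blast
  have G_add: "G (w + w') = G w + G w'" if "w \<in> W n" "w' \<in> W n" for w w'
    using iso' that unfolding G_def coset_add_coset[symmetric] by blast
  have G_act: "G (ind_act g w) = \<rho> (n+1) g (G w)" if "g permutes {1..n+1}" "w \<in> W n" for g w
    using iso' that unfolding G_def act_coset[OF that(1), symmetric] equivariant_on_def by blast
  have G_j: "G (emb n v) = \<phi> n v" if "v \<in> V n" for v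
    using iso' that unfolding G_def cstab_natural_map_def by blast
  have G_0: "G 0 = 0" using G_add[OF W_0[OF n] W_0[OF n]] by simp
  have G_sum: "G (sum f I) = (\<Sum>x\<in>I. G (f x))" if "\<And>x. x \<in> I \<Longrightarrow> f x \<in> W n" for f :: "nat \<Rightarrow> _" and I
    using that by (induction I rule: infinite_finite_induct) (simp_all only: sum.infinite sum.empty sum.insert G_0 G_add W_sum[OF n] insertI1 insertI2 not_False_eq_True)
  show ?thesis
  proof (rule that[of G])
    fix w assume w: "w \<in> W n"
    have tr: "transpose a (n+1) permutes {1..n+1}" if "a \<in> {1..n+1}" for a
      using permutes_swap_id[OF that, of "n+1"] by simp
    have wV: "w (transpose a (n+1)) \<in> V n" if "a \<in> {1..n+1}" for a using W_V[OF w tr[OF that]] .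
    have "G w = (\<Sum>a\<in>{1..n+1}. G (ind_act (transpose a (n+1)) (emb n (w (transpose a (n+1))))))"
      using arg_cong[OF W_decomp[OF n w], of G] G_sum[OF W_act[OF tr j_W[OF n wV]], of "{1..n+1}" "\<lambda>a. a"]
      by (simp only:)
    also have "\<dots> = (\<Sum>a\<in>{1..n+1}. \<rho> (n+1) (transpose a (n+1)) (\<phi> n (w (transpose a (n+1)))))"
      by (rule sum.cong[OF refl]) (simp only: G_act[OF tr j_W[OF n wV]] G_j[OF wV])
    finally show "G w = (\<Sum>a\<in>{1..n+1}. \<rho> (n+1) (transpose a (n+1)) (\<phi> n (w (transpose a (n+1)))))" .
    show "G w = 0 \<longleftrightarrow> w \<in> U n"
    proof
      assume "G w = 0"
      then have "F (coset (U n) w) = F (coset (U n) 0)" using G_0 by (simp add: G_def)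
      then have "coset (U n) w = coset (U n) 0"
        using bij w W_0[OF n] by (meson bij_betw_def imageI inj_onD)
      moreover have "w \<in> coset (U n) w" using U_0 unfolding coset_def by force
      ultimately show "w \<in> U n" unfolding coset_def by auto
    next
      assume wU: "w \<in> U n"
      have "coset (U n) w = coset (U n) 0"
      proof
        show "coset (U n) w \<subseteq> coset (U n) 0" unfolding coset_def using U_add[OF wU] by auto
        show "coset (U n) 0 \<subseteq> coset (U n) w"
        proof
          fix x assume "x \<in> coset (U n) 0"
          then have "x \<in> U n" unfolding coset_def by auto
          then have "x - w \<in> U n" "x = w + (x - w)" using U_diff wU by auto
          then show "x \<in> coset (U n) w" unfolding coset_def by blast
        qed
      qed
      then show "G w = 0" using G_0 by (simp add: G_def)
    qed
  next
    fix v assume "v \<in> V (n+1)"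
    then have "v \<in> F ` coset (U n) ` W n" unfolding bij_betw_imp_surj_on[OF bij] .
    then obtain w where "w \<in> W n" "v = F (coset (U n) w)" by (elim imageE) simp
    then show "\<exists>w\<in>W n. G w = v" unfolding G_def by (intro bexI[of _ w]) simp_all
  qed (fact G_add G_act G_j)+
qed

text \<open>The generator w - (i+1, i+2) w of the relations, with w the image of
  \<open>\<phi> i v\<close> in \<open>W (i+1)\<close>, is killed by \<open>G\<close>. This
  invariance is what makes the two orders of adjoining two points anticommute.\<close>

lemma cstab_invariant:
  assumes i: "1 \<le> i" and iso: "cstab_iso s V \<rho> \<phi> (i+1) F" and v: "v \<in> V i"
  shows "\<rho> (i+2) (transpose (i+1) (i+2)) (\<phi> (i+1) (\<phi> i v)) = \<phi> (i+1) (\<phi> i v)"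
proof -
  have n: "1 \<le> i + 1" by simp
  obtain G where "\<And>w. w \<in> W (i+1) \<Longrightarrow>
      G w = (\<Sum>a\<in>{1..i+1+1}. \<rho> (i+1+1) (transpose a (i+1+1)) (\<phi> (i+1) (w (transpose a (i+1+1)))))"
    "\<And>v. v \<in> V (i+1+1) \<Longrightarrow> \<exists>w\<in>W (i+1). G w = v"
    and G: "\<And>w. w \<in> W (i+1) \<Longrightarrow> G w = 0 \<longleftrightarrow> w \<in> U (i+1)"
    "\<And>w w'. w \<in> W (i+1) \<Longrightarrow> w' \<in> W (i+1) \<Longrightarrow> G (w + w') = G w + G w'"
    "\<And>g w. g permutes {1..i+1+1} \<Longrightarrow> w \<in> W (i+1) \<Longrightarrow> G (ind_act g w) = \<rho> (i+1+1) g (G w)"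
    "\<And>v. v \<in> V (i+1) \<Longrightarrow> G (emb (i+1) v) = \<phi> (i+1) v"
  proof (rule cstab_quotient[OF n iso], goal_cases)
    case (1 G)
    show ?case by (rule 1(1)[OF 1(2-7)])
  qed
  define t where "t = transpose (i+1) (i+1+1)"
  have t: "t permutes {1..i+1+1}" unfolding t_def by (rule permutes_swap_id) simp_all
  define w where "w = emb (i+1) (\<phi> i v)"
  have pv: "\<phi> i v \<in> V (i+1)" using \<phi>_V[OF i v] .
  have w: "w \<in> W (i+1)" unfolding w_def by (rule j_W[OF n pv])
  have tw: "ind_act t w \<in> W (i+1)" by (rule W_act[OF t w])
  have d: "w - ind_act t w \<in> U (i+1)"
    unfolding cstab_relations_def
  proof (rule fs.span_base, intro CollectI exI conjI)
    show "w - ind_act t w = ind_act id (w - ind_act (transpose (i+1) (i+1+1)) w)"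
      by (simp only: ind_act_id t_def)
    show "id permutes {1..i+1+1}" by (simp add: permutes_id)
    show "w \<in> (\<lambda>v. emb (i+1) (\<phi> (i+1-1) v)) ` V (i+1-1)" unfolding w_def using v by simp
  qed
  have "G w = G ((w - ind_act t w) + ind_act t w)" by (rule arg_cong[of _ _ G]) simp
  also have "\<dots> = G (ind_act t w)"
    unfolding G(2)[OF W_diff[OF n w tw] tw] G(1)[OF W_diff[OF n w tw], THEN iffD2, OF d] by (rule add_0_left)
  also have "\<dots> = \<rho> (i+1+1) t (G w)" by (rule G(3)[OF t w])
  finally have "\<phi> (i+1) (\<phi> i v) = \<rho> (i+1+1) t (\<phi> (i+1) (\<phi> i v))"
    unfolding w_def G(4)[OF pv] .
  then show ?thesis by (simp add: t_def)
qed

end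

section \<open>Induced representations as cubes\<close>

text \<open>
  \<open>T i a\<close> is an extension of \<open>(a, i+1) \<cdot> \<phi>\<^sub>i\<close> to a linear map on the ambient space; with it the maps
  of the cube below are additive on their whole type.
\<close>

locale stable_sequence = coherent_seq s V \<rho> \<phi>
  for s :: "'f::field \<Rightarrow> 'v::ab_group_add \<Rightarrow> 'v"
    and V :: "nat \<Rightarrow> 'v set" and \<rho> :: "nat \<Rightarrow> (nat \<Rightarrow> nat) \<Rightarrow> 'v \<Rightarrow> 'v"
    and \<phi> :: "nat \<Rightarrow> 'v \<Rightarrow> 'v" +
  fixes N M :: nat and T :: "nat \<Rightarrow> nat \<Rightarrow> 'v \<Rightarrow> 'v"
  assumes N: "1 \<le> N"
    and T_add: "T i a (v + w) = T i a v + T i a w"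
    and T_scale: "T i a (s c v) = s c (T i a v)"
    and T_eq: "N \<le> i \<Longrightarrow> a \<in> {1..i+1} \<Longrightarrow> v \<in> V i \<Longrightarrow> T i a v = \<rho> (i+1) (transpose a (i+1)) (\<phi> i v)"
    and inv_\<phi>\<phi>: "N \<le> i \<Longrightarrow> v \<in> V i \<Longrightarrow>
        \<rho> (i+2) (transpose (i+1) (i+2)) (\<phi> (i+1) (\<phi> i v)) = \<phi> (i+1) (\<phi> i v)"
begin

lemma T_zero [simp]: "T i a 0 = 0"
  using T_add[of i a 0 0] by simp

lemma T_uminus: "T i a (- v) = - T i a v"
  using T_add[of i a v "- v"] by (simp add: minus_unique)

lemma T_diff: "T i a (v - w) = T i a v - T i a w"
  using T_add[of i a v "- w"] by (simp add: T_uminus)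

abbreviation IAM :: "nat \<Rightarrow> ((nat \<Rightarrow> nat) \<Rightarrow> 'v) set" where
  "IAM i \<equiv> IA s i (M - i) (V i) (\<rho> i)"

lemma sign_twist_young:
  assumes "\<sigma> permutes {1..i}" "\<tau> permutes {i+1..i+k}"
  shows "sign_twist s i k r (inv (\<sigma> \<circ> \<tau>)) v = s (of_int (sign \<tau>)) (r (inv \<sigma>) v)"
  unfolding sign_twist_def inv_young[OF assms] young_restrict[OF permutes_inv permutes_inv, OF assms]
  using permutes_imp_permutation[OF _ assms(2)] by (simp add: sign_inverse)

text \<open>The covariance condition may be tested on the two factors of the Young subgroup
  separately. A permutation and its inverse have the same sign, so no inverse appears in the
  condition for \<tau>.\<close>

lemma IA_iff:
  assumes i: "1 \<le> i" "i \<le> M"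
  shows "f \<in> IAM i \<longleftrightarrow> (\<forall>g. g permutes {1..M} \<longrightarrow> f g \<in> V i) \<and> (\<forall>g. \<not> g permutes {1..M} \<longrightarrow> f g = 0)
     \<and> (\<forall>g \<sigma>. g permutes {1..M} \<longrightarrow> \<sigma> permutes {1..i} \<longrightarrow> f (g \<circ> \<sigma>) = \<rho> i (inv \<sigma>) (f g))
     \<and> (\<forall>g \<tau>. g permutes {1..M} \<longrightarrow> \<tau> permutes {i+1..M} \<longrightarrow> f (g \<circ> \<tau>) = s (of_int (sign \<tau>)) (f g))"
    (is "?L \<longleftrightarrow> ?R")
proof -
  have iM: "i + (M - i) = M" using i by simp
  have L: "?L \<longleftrightarrow> (\<forall>g. g permutes {1..M} \<longrightarrow> f g \<in> V i) \<and> (\<forall>g. \<not> g permutes {1..M} \<longrightarrow> f g = 0) \<and>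
     (\<forall>g \<sigma> \<tau>. g permutes {1..M} \<longrightarrow> \<sigma> permutes {1..i} \<longrightarrow> \<tau> permutes {i+1..M} \<longrightarrow>
        f (g \<circ> (\<sigma> \<circ> \<tau>)) = s (of_int (sign \<tau>)) (\<rho> i (inv \<sigma>) (f g)))"
  proof -
    have tw: "sign_twist s i (M - i) (\<rho> i) (inv (\<sigma> \<circ> \<tau>)) v = s (of_int (sign \<tau>)) (\<rho> i (inv \<sigma>) v)"
      if "\<sigma> permutes {1..i}" "\<tau> permutes {i+1..M}" for \<sigma> \<tau> v
      using sign_twist_young[of \<sigma> i \<tau> "M - i"] that iM by simp
    have "(\<forall>h\<in>young i (M - i). P h) \<longleftrightarrow> (\<forall>\<sigma> \<tau>. \<sigma> permutes {1..i} \<longrightarrow> \<tau> permutes {i+1..M} \<longrightarrow> P (\<sigma> \<circ> \<tau>))" for P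
      unfolding young_def iM by blast
    then show ?thesis
      unfolding IA_def ind_def iM by (auto simp: tw)
  qed
  show ?thesis
  proof
    assume ?L
    note L = this[unfolded L]
    show ?R
    proof (intro conjI allI impI)
      fix g \<sigma> assume "g permutes {1..M}" "\<sigma> permutes {1..i}"
      then show "f (g \<circ> \<sigma>) = \<rho> i (inv \<sigma>) (f g)"
        using L[THEN conjunct2, THEN conjunct2, rule_format, of g \<sigma> id] by (simp add: permutes_id)
    next
      fix g \<tau> assume "g permutes {1..M}" "\<tau> permutes {i+1..M}"
      then show "f (g \<circ> \<tau>) = s (of_int (sign \<tau>)) (f g)"
        using L[THEN conjunct2, THEN conjunct2, rule_format, of g id \<tau>] L \<rho>_id i by (simp add: permutes_id)
    qed (use L in auto)
  next
    assume R: ?R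
    show ?L unfolding L
    proof (intro conjI allI impI)
      fix g \<sigma> \<tau> :: "nat \<Rightarrow> nat" assume *: "g permutes {1..M}" "\<sigma> permutes {1..i}" "\<tau> permutes {i+1..M}"
      then have "g \<circ> \<sigma> permutes {1..M}"
        using permutes_compose[OF permutes_subset[of \<sigma> "{1..i}" "{1..M}"]] i by simp
      then show "f (g \<circ> (\<sigma> \<circ> \<tau>)) = s (of_int (sign \<tau>)) (\<rho> i (inv \<sigma>) (f g))"
        using R * by (metis comp_assoc)
    qed (use R in auto)
  qed
qed

lemma
  assumes "1 \<le> i" "i \<le> M" "f \<in> IAM i"
  shows IA_V: "g permutes {1..M} \<Longrightarrow> f g \<in> V i"
    and IA_out: "\<not> g permutes {1..M} \<Longrightarrow> f g = 0"
    and IA_\<sigma>: "g permutes {1..M} \<Longrightarrow> \<sigma> permutes {1..i} \<Longrightarrow> f (g \<circ> \<sigma>) = \<rho> i (inv \<sigma>) (f g)"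
    and IA_\<tau>: "g permutes {1..M} \<Longrightarrow> \<tau> permutes {i+1..M} \<Longrightarrow> f (g \<circ> \<tau>) = s (of_int (sign \<tau>)) (f g)"
  using assms(3)[unfolded IA_iff[OF assms(1,2)]] by simp_all

lemma IAI:
  assumes "1 \<le> i" "i \<le> M"
    and "\<And>g. g permutes {1..M} \<Longrightarrow> f g \<in> V i" "\<And>g. \<not> g permutes {1..M} \<Longrightarrow> f g = 0"
    and "\<And>g \<sigma>. g permutes {1..M} \<Longrightarrow> \<sigma> permutes {1..i} \<Longrightarrow> f (g \<circ> \<sigma>) = \<rho> i (inv \<sigma>) (f g)"
    and "\<And>g \<tau>. g permutes {1..M} \<Longrightarrow> \<tau> permutes {i+1..M} \<Longrightarrow> f (g \<circ> \<tau>) = s (of_int (sign \<tau>)) (f g)"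
  shows "f \<in> IAM i"
  unfolding IA_iff[OF assms(1,2)] using assms(3-6) by simp

text \<open>
  \<open>face i R\<close> is the summand of the induced representation that belongs to the coset of the
  permutations mapping \<open>{1..i}\<close> onto \<open>R\<close>. The map \<open>adjoin i x\<close> takes it to \<open>face (i+1) (insert x R)\<close>:
  if \<open>g a = x\<close>, then \<open>g \<circ> (a, i+1)\<close> maps \<open>i+1\<close> to \<open>x\<close>.
\<close>

definition face :: "nat \<Rightarrow> nat set \<Rightarrow> ((nat \<Rightarrow> nat) \<Rightarrow> 'v) set" where
  "face i R = {f \<in> IAM i. \<forall>g. g ` {1..i} \<noteq> R \<longrightarrow> f g = 0}"

definition adjoin :: "nat \<Rightarrow> nat \<Rightarrow> ((nat \<Rightarrow> nat) \<Rightarrow> 'v) \<Rightarrow> (nat \<Rightarrow> nat) \<Rightarrow> 'v" where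
  "adjoin i x f g = (if g permutes {1..M} \<and> inv g x \<in> {1..i+1}
     then T i (inv g x) (f (g \<circ> transpose (inv g x) (i+1))) else 0)"

section \<open>Faces as single cosets of the Young subgroup\<close>

lemma young_decomp:
  assumes "g permutes {1..M}" "g' permutes {1..M}" "g ` {1..i} = g' ` {1..i}" "i \<le> M"
  obtains \<sigma> \<tau> where "\<sigma> permutes {1..i}" "\<tau> permutes {i+1..M}" "g' = g \<circ> \<sigma> \<circ> \<tau>"
proof -
  have h: "inv g \<circ> g' permutes {1..M}"
    using assms permutes_compose permutes_inv by blast
  have "(inv g \<circ> g') ` {1..i} = inv g ` g ` {1..i}" by (simp only: image_comp[symmetric] assms(3))
  also have "\<dots> = {1..i}" using permutes_inj[OF assms(1)] by (simp add: image_image)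
  finally obtain \<sigma> \<tau> where "\<sigma> permutes {1..i}" "\<tau> permutes {i+1..M}" "inv g \<circ> g' = \<sigma> \<circ> \<tau>"
    using permutes_preserving_young[OF h _ assms(4)] by blast
  moreover have "g' = g \<circ> (inv g \<circ> g')"
    using permutes_inverses(1)[OF assms(1)] by (simp add: fun_eq_iff)
  ultimately show ?thesis using that by (simp add: comp_assoc)
qed

lemma permutes_young:
  assumes "g permutes {1..M}" "\<sigma> permutes {1..i}" "i \<le> M"
  shows "g \<circ> \<sigma> permutes {1..M}"
  using permutes_compose[OF permutes_subset[OF assms(2)] assms(1)] assms(3) by simp

lemma permutes_young':
  assumes "g permutes {1..M}" "\<tau> permutes {i+1..M}"
  shows "g \<circ> \<tau> permutes {1..M}"
  using permutes_compose[OF permutes_subset[OF assms(2)] assms(1)] by simp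

lemma permutes_transpose_le:
  assumes "g permutes {1..M}" "a \<in> {1..M}" "b \<in> {1..M}"
  shows "g \<circ> transpose a b permutes {1..M}"
  using permutes_compose[OF permutes_swap_id assms(1)] assms by simp

lemma IA_eval:
  assumes "1 \<le> i" "i \<le> M" "f \<in> IAM i" "g permutes {1..M}" "\<sigma> permutes {1..i}" "\<tau> permutes {i+1..M}"
  shows "f (g \<circ> \<sigma> \<circ> \<tau>) = s (of_int (sign \<tau>)) (\<rho> i (inv \<sigma>) (f g))"
  using IA_\<tau>[OF assms(1-3) permutes_young[OF assms(4,5,2)] assms(6)] IA_\<sigma>[OF assms(1-5)] by simp

lemma faceD:
  assumes "f \<in> face i R"
  shows "f \<in> IAM i" "g ` {1..i} \<noteq> R \<Longrightarrow> f g = 0"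
  using assms by (auto simp: face_def)

lemma image_young:
  assumes "\<sigma> permutes {1..i}" shows "(g \<circ> \<sigma>) ` {1..i} = g ` {1..i}"
  using permutes_image[OF assms] by (metis image_comp)

lemma image_young':
  assumes "\<tau> permutes {i+1..M}" shows "(g \<circ> \<tau>) ` {1..i} = g ` {1..i}"
proof (intro image_cong refl)
  fix x assume "x \<in> {1..i}"
  then have "x \<notin> {i+1..M}" by simp
  then show "(g \<circ> \<tau>) x = g x" using permutes_not_in[OF assms] by simp
qed

text \<open>The support of a face is one coset of S_i \<times> S_{M-i}, so covariance spreads a
  single value over all of it. Identities between elements of a face are accordingly proved by
  evaluation at one well chosen permutation.\<close>

lemma face_eqI:
  assumes i: "1 \<le> i" "i \<le> M" and f: "f1 \<in> face i R" "f2 \<in> face i R"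
    and g: "g permutes {1..M}" "g ` {1..i} = R" "f1 g = f2 g"
  shows "f1 = f2"
proof
  fix g'
  show "f1 g' = f2 g'"
  proof (cases "g' permutes {1..M} \<and> g' ` {1..i} = R")
    case True
    then obtain \<sigma> \<tau> where st: "\<sigma> permutes {1..i}" "\<tau> permutes {i+1..M}" "g' = g \<circ> \<sigma> \<circ> \<tau>"
      using young_decomp[OF g(1), of g' i] g(2) i by auto
    show ?thesis
      using IA_eval[OF i faceD(1)[OF f(1)] g(1) st(1,2)] IA_eval[OF i faceD(1)[OF f(2)] g(1) st(1,2)] st(3) g(3)
      by simp
  next
    case False
    then show ?thesis using f faceD IA_out[OF i] by metis
  qed
qed

lemma IA_subgroup:
  assumes i: "1 \<le> i" "i \<le> M"
  shows "add_subgroup (IAM i)"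
  unfolding add_subgroup_def
proof (intro conjI ballI)
  show "0 \<in> IAM i"
    by (rule IAI[OF i]) (use i V_0 in \<open>auto simp: \<rho>_0 permutes_inv\<close>)
  fix a b assume a: "a \<in> IAM i" and b: "b \<in> IAM i"
  note A = IA_V[OF i a] IA_out[OF i a] IA_\<sigma>[OF i a] IA_\<tau>[OF i a]
    and B = IA_V[OF i b] IA_out[OF i b] IA_\<sigma>[OF i b] IA_\<tau>[OF i b]
  show "a - b \<in> IAM i"
  proof (rule IAI[OF i])
    fix g assume g: "g permutes {1..M}"
    show "(a - b) g \<in> V i" using A(1) B(1) g V_diff i by simp
    show "(a - b) (g \<circ> \<sigma>) = \<rho> i (inv \<sigma>) ((a - b) g)" if "\<sigma> permutes {1..i}" for \<sigma>
      using A(1,3) B(1,3) g that i by (simp add: \<rho>_diff permutes_inv)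
    show "(a - b) (g \<circ> \<tau>) = s (of_int (sign \<tau>)) ((a - b) g)" if "\<tau> permutes {i+1..M}" for \<tau>
      using A(4) B(4) g that by (simp add: scale_right_diff_distrib)
  qed (use A B in simp)
qed

lemma IA_fun_scale:
  assumes i: "1 \<le> i" "i \<le> M" and a: "a \<in> IAM i"
  shows "fun_scale s c a \<in> IAM i"
proof (rule IAI[OF i])
  note A = IA_V[OF i a] IA_out[OF i a] IA_\<sigma>[OF i a] IA_\<tau>[OF i a]
  fix g assume g: "g permutes {1..M}"
  show "fun_scale s c a g \<in> V i" using A(1) g V_scale i by (simp add: fun_scale_def)
  show "fun_scale s c a (g \<circ> \<sigma>) = \<rho> i (inv \<sigma>) (fun_scale s c a g)" if "\<sigma> permutes {1..i}" for \<sigma>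
    using A(1,3) g that i by (simp add: \<rho>_scale permutes_inv fun_scale_def)
  show "fun_scale s c a (g \<circ> \<tau>) = s (of_int (sign \<tau>)) (fun_scale s c a g)" if "\<tau> permutes {i+1..M}" for \<tau>
    using A(4) g that by (simp add: fun_scale_def mult.commute)
qed (use IA_out[OF i a] in \<open>simp add: fun_scale_def\<close>)

lemma face_subgroup: "1 \<le> i \<Longrightarrow> i \<le> M \<Longrightarrow> add_subgroup (face i R)"
  using IA_subgroup[of i] by (simp add: add_subgroup_def face_def)

lemma face_fun_scale: "1 \<le> i \<Longrightarrow> i \<le> M \<Longrightarrow> f \<in> face i R \<Longrightarrow> fun_scale s c f \<in> face i R"
  using IA_fun_scale[of i f c] by (simp add: face_def fun_scale_def)

abbreviation incl :: "nat \<Rightarrow> 'v \<Rightarrow> (nat \<Rightarrow> nat) \<Rightarrow> 'v" where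
  "incl i \<equiv> IA_incl s i (M - i) (\<rho> i)"

lemma incl_young:
  assumes "i \<le> M" "\<sigma> permutes {1..i}" "\<tau> permutes {i+1..M}"
  shows "incl i v (\<sigma> \<circ> \<tau>) = s (of_int (sign \<tau>)) (\<rho> i (inv \<sigma>) v)"
proof -
  have "i + (M - i) = M" using assms by simp
  then have "\<sigma> \<circ> \<tau> \<in> young i (M - i)" "\<tau> permutes {i+1..i+(M-i)}"
    unfolding young_def using assms by auto
  then show ?thesis
    unfolding IA_incl_def ind_incl_def using sign_twist_young[OF assms(2)] by simp
qed

lemma incl_0:
  assumes "i \<le> M" "\<not> (g permutes {1..M} \<and> g ` {1..i} = {1..i})"
  shows "incl i v g = 0"
proof -
  have M: "i + (M - i) = M" using assms by simp
  have "g \<notin> young i (M - i)"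
  proof
    assume "g \<in> young i (M - i)"
    then obtain \<sigma> \<tau> where st: "\<sigma> permutes {1..i}" "\<tau> permutes {i+1..M}" "g = \<sigma> \<circ> \<tau>"
      unfolding young_def M by auto
    have "g permutes {1..M}"
      using st permutes_compose[OF permutes_subset[OF st(2)] permutes_subset[OF st(1)]] assms(1) by simp
    moreover have "g ` {1..i} = {1..i}"
      using image_young'[OF st(2), of \<sigma>] permutes_image[OF st(1)] st(3) by simp
    ultimately show False using assms(2) by blast
  qed
  then show ?thesis unfolding IA_incl_def ind_incl_def by simp
qed

lemma incl_face:
  assumes i: "1 \<le> i" "i \<le> M" and v: "v \<in> V i"
  shows "incl i v \<in> face i {1..i}"
  unfolding face_def
proof (intro CollectI conjI allI impI)
  fix g assume "g ` {1..i} \<noteq> {1..i}"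
  then show "incl i v g = 0" using incl_0[OF i(2)] by blast
next
  have Y: "\<exists>\<sigma> \<tau>. \<sigma> permutes {1..i} \<and> \<tau> permutes {i+1..M} \<and> g = \<sigma> \<circ> \<tau>"
    if "g permutes {1..M}" "g ` {1..i} = {1..i}" for g
    using permutes_preserving_young that i by blast
  show "incl i v \<in> IAM i"
  proof (rule IAI[OF i])
    fix g assume g: "g permutes {1..M}"
    show "incl i v g \<in> V i"
    proof (cases "g ` {1..i} = {1..i}")
      case True
      then show ?thesis using Y[OF g] incl_young[OF i(2)] V_scale \<rho>_V v i by (metis permutes_inv)
    qed (use incl_0[OF i(2)] V_0 i in auto)
    show "incl i v (g \<circ> \<sigma>') = \<rho> i (inv \<sigma>') (incl i v g)" if s': "\<sigma>' permutes {1..i}" for \<sigma>'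
    proof (cases "g ` {1..i} = {1..i}")
      case True
      then obtain \<sigma> \<tau> where st: "\<sigma> permutes {1..i}" "\<tau> permutes {i+1..M}" "g = \<sigma> \<circ> \<tau>" using Y[OF g] by blast
      have "g \<circ> \<sigma>' = (\<sigma> \<circ> \<sigma>') \<circ> \<tau>"
        using young_commute[OF s' st(2)] st(3) by (metis comp_assoc)
      moreover have "inv (\<sigma> \<circ> \<sigma>') = inv \<sigma>' \<circ> inv \<sigma>"
        using st s' permutes_bij by (intro o_inv_distrib) auto
      ultimately show ?thesis
        using incl_young[OF i(2) permutes_compose[OF s' st(1)] st(2)] incl_young[OF i(2) st(1,2)] st(3)
          \<rho>_comp[OF i(1) permutes_inv permutes_inv, OF s' st(1) v] \<rho>_scale[OF i(1) permutes_inv[OF s']]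
          \<rho>_V[OF i(1) permutes_inv[OF st(1)] v] by simp
    next
      case False
      then show ?thesis using incl_0[OF i(2)] image_young[OF s', of g] \<rho>_0[OF i(1) permutes_inv[OF s']] by simp
    qed
    show "incl i v (g \<circ> \<tau>') = s (of_int (sign \<tau>')) (incl i v g)" if t': "\<tau>' permutes {i+1..M}" for \<tau>'
    proof (cases "g ` {1..i} = {1..i}")
      case True
      then obtain \<sigma> \<tau> where st: "\<sigma> permutes {1..i}" "\<tau> permutes {i+1..M}" "g = \<sigma> \<circ> \<tau>" using Y[OF g] by blast
      have "g \<circ> \<tau>' = \<sigma> \<circ> (\<tau> \<circ> \<tau>')" using st(3) by (simp add: comp_assoc)
      moreover have "sign (\<tau> \<circ> \<tau>') = sign \<tau> * sign \<tau>'"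
        using permutes_imp_permutation[of "{i+1..M}"] st t' by (intro sign_compose) auto
      ultimately show ?thesis
        using incl_young[OF i(2) st(1) permutes_compose[OF t' st(2)]] incl_young[OF i(2) st(1,2)] st(3)
        by (simp add: mult.commute)
    next
      case False
      then show ?thesis using incl_0[OF i(2)] image_young'[OF t', of g] by simp
    qed
  qed (use incl_0[OF i(2)] in blast)
qed

lemma incl_id: "1 \<le> i \<Longrightarrow> i \<le> M \<Longrightarrow> v \<in> V i \<Longrightarrow> incl i v id = v"
  using incl_young[of i id id v] \<rho>_id by (simp add: permutes_id)

lemma permutes_act: "g permutes {1..M} \<Longrightarrow> inv g \<circ> g' permutes {1..M} \<longleftrightarrow> g' permutes {1..M}"
proof
  assume g: "g permutes {1..M}"
  show "g' permutes {1..M} \<Longrightarrow> inv g \<circ> g' permutes {1..M}"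
    using permutes_compose[OF _ permutes_inv[OF g]] .
  assume "inv g \<circ> g' permutes {1..M}"
  from permutes_compose[OF this g] show "g' permutes {1..M}"
    using permutes_inverses(1)[OF g] by (simp add: comp_assoc[symmetric] permutes_inv_o[OF g])
qed

lemma ind_act_IA:
  assumes i: "1 \<le> i" "i \<le> M" and f: "f \<in> IAM i" and g: "g permutes {1..M}"
  shows "ind_act g f \<in> IAM i"
proof (rule IAI[OF i])
  fix h assume h: "h permutes {1..M}"
  then have gh: "inv g \<circ> h permutes {1..M}" using permutes_act[OF g] by blast
  show "ind_act g f h \<in> V i" using IA_V[OF i f gh] by (simp add: ind_act_def)
  show "ind_act g f (h \<circ> \<sigma>) = \<rho> i (inv \<sigma>) (ind_act g f h)" if "\<sigma> permutes {1..i}" for \<sigma>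
    using IA_\<sigma>[OF i f gh that] by (simp add: ind_act_def comp_assoc)
  show "ind_act g f (h \<circ> \<tau>) = s (of_int (sign \<tau>)) (ind_act g f h)" if "\<tau> permutes {i+1..M}" for \<tau>
    using IA_\<tau>[OF i f gh that] by (simp add: ind_act_def comp_assoc)
qed (use IA_out[OF i f] permutes_act[OF g] in \<open>simp add: ind_act_def\<close>)

lemma ind_act_face:
  assumes i: "1 \<le> i" "i \<le> M" and f: "f \<in> face i R" and g: "g permutes {1..M}"
  shows "ind_act g f \<in> face i (g ` R)"
proof -
  have "ind_act g f h = 0" if "h ` {1..i} \<noteq> g ` R" for h
  proof -
    have "(inv g \<circ> h) ` {1..i} \<noteq> R"
    proof
      assume "(inv g \<circ> h) ` {1..i} = R"
      then have "g ` R = (g \<circ> (inv g \<circ> h)) ` {1..i}" by (metis image_comp)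
      also have "\<dots> = h ` {1..i}" using permutes_inverses(1)[OF g] by (simp add: o_def)
      finally show False using that by simp
    qed
    then show ?thesis using faceD(2)[OF f] by (simp add: ind_act_def)
  qed
  then show ?thesis using ind_act_IA[OF i faceD(1)[OF f] g] by (simp add: face_def)
qed

text \<open>Together with \<open>face_eqI\<close> this identifies a face with \<open>V i\<close>:
  evaluation at g is bijective, and its inverse sends v to the translate by g of its
  inclusion.\<close>

lemma ex_face:
  assumes i: "1 \<le> i" "i \<le> M" and g: "g permutes {1..M}" and v: "v \<in> V i"
  shows "ind_act g (incl i v) \<in> face i (g ` {1..i})" "ind_act g (incl i v) g = v"
  using ind_act_face[OF i incl_face[OF i v] g] incl_id[OF i v] permutes_inv_o(2)[OF g]
  by (simp_all add: ind_act_def)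

section \<open>Adjoining a point to a face\<close>

lemma adjoin_0: "\<not> (g permutes {1..M} \<and> inv g x \<in> {1..i+1}) \<Longrightarrow> adjoin i x f g = 0"
  unfolding adjoin_def by (simp only: if_False)

lemma adjoin_diff: "adjoin i x (a - b) = adjoin i x a - adjoin i x b"
  by (auto simp: adjoin_def fun_eq_iff T_diff)

lemma adjoin_zero [simp]: "adjoin i x 0 = 0"
  by (auto simp: adjoin_def fun_eq_iff)

lemma adjoin_scale: "adjoin i x (fun_scale s c f) = fun_scale s c (adjoin i x f)"
  by (auto simp: adjoin_def fun_scale_def fun_eq_iff T_scale)

lemma adjoin_act:
  assumes g: "g permutes {1..M}"
  shows "adjoin i (g x) (ind_act g f) = ind_act g (adjoin i x f)"
proof
  fix h
  have "inv (inv g \<circ> h) = inv h \<circ> g" if "h permutes {1..M}"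
    using o_inv_distrib[OF permutes_bij[OF permutes_inv[OF g]] permutes_bij[OF that]]
      inv_inv_eq[OF permutes_bij[OF g]] by simp
  then show "adjoin i (g x) (ind_act g f) h = ind_act g (adjoin i x f) h"
    using permutes_act[OF g, of h] by (auto simp: adjoin_def ind_act_def comp_assoc)
qed

text \<open>The value at g uses the position a of x in g, which varies with g. Composition with
  \<sigma> in S_{i+1} changes a, and the two transpositions then differ from \<sigma> by an element
  of S_i, where \<phi> is equivariant. Composition with \<tau> leaves a alone and commutes with the
  transposition, so only the sign comes out.\<close>

lemma adjoin_IA:
  assumes i: "N \<le> i" "i < M" and f: "f \<in> IAM i" and x: "x \<in> {1..M}"
  shows "adjoin i x f \<in> IAM (i + 1)"
proof -
  have i1: "1 \<le> i" "i \<le> M" "1 \<le> i + 1" "i + 1 \<le> M" using i N by auto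
  have adjoin_V: "adjoin i x f g = \<rho> (i+1) (transpose (inv g x) (i+1)) (\<phi> i (f (g \<circ> transpose (inv g x) (i+1))))"
    if g: "g permutes {1..M}" "inv g x \<in> {1..i+1}" for g
    using g T_eq[OF i(1) g(2)] IA_V[OF i1(1,2) f] permutes_transpose_le[OF g(1), of "inv g x" "i+1"] i
    by (simp add: adjoin_def)
  have fV: "\<phi> i (f (g \<circ> transpose (inv g x) (i+1))) \<in> V (i+1)" if "g permutes {1..M}" "inv g x \<in> {1..i+1}" for g
    using \<phi>_V[OF i1(1)] IA_V[OF i1(1,2) f] permutes_transpose_le[OF that(1), of "inv g x" "i+1"] that(2) i by simp
  have tr: "transpose a (i+1) permutes {1..i+1}" if "a \<in> {1..i+1}" for a
    using permutes_swap_id[OF that, of "i+1"] by simp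
  show ?thesis
  proof (rule IAI[OF i1(3,4)])
    fix g assume g: "g permutes {1..M}"
    show "adjoin i x f g \<in> V (i+1)"
    proof (cases "inv g x \<in> {1..i+1}")
      case True
      then show ?thesis using adjoin_V[OF g True] \<rho>_V[OF i1(3) tr[OF True]] fV[OF g True] by simp
    qed (use V_0[OF i1(3)] in \<open>auto simp: adjoin_def\<close>)
  next
    fix g \<sigma> assume g: "g permutes {1..M}" and \<sigma>: "\<sigma> permutes {1..i+1}"
    define a where "a = inv g x"
    define b where "b = inv \<sigma> a"
    have ig: "inv (g \<circ> \<sigma>) x = b"
      using o_inv_distrib[OF permutes_bij[OF g] permutes_bij[OF \<sigma>]] by (simp add: a_def b_def)
    have ab: "a \<in> {1..i+1} \<longleftrightarrow> b \<in> {1..i+1}" "\<sigma> b = a"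
      using permutes_in_image[OF permutes_inv[OF \<sigma>], of a] permutes_inverses(1)[OF \<sigma>] by (simp_all add: b_def)
    have gs: "g \<circ> \<sigma> permutes {1..M}" using permutes_young[OF g \<sigma>] i1 by simp
    show "adjoin i x f (g \<circ> \<sigma>) = \<rho> (i+1) (inv \<sigma>) (adjoin i x f g)"
    proof (cases "a \<in> {1..i+1}")
      case False
      then have "\<not> (g permutes {1..M} \<and> inv g x \<in> {1..i+1})"
        "\<not> (g \<circ> \<sigma> permutes {1..M} \<and> inv (g \<circ> \<sigma>) x \<in> {1..i+1})"
        using ab ig unfolding a_def by blast+
      then have "adjoin i x f g = 0" "adjoin i x f (g \<circ> \<sigma>) = 0" using adjoin_0 by blast+
      then show ?thesis using \<rho>_0[OF i1(3) permutes_inv[OF \<sigma>]] by simp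
    next
      case True
      then have b: "b \<in> {1..i+1}" using ab by simp
      \<comment> \<open>Since \<sigma> takes b to a, this product fixes i+1 and hence lies in
        S_i.\<close>
      define \<pi> where "\<pi> = transpose a (i+1) \<circ> \<sigma> \<circ> transpose b (i+1)"
      have \<pi>1: "\<pi> permutes {1..i+1}"
        unfolding \<pi>_def using permutes_compose[OF tr[OF b] permutes_compose[OF \<sigma> tr[OF True]]] by (simp add: comp_assoc)
      have "\<pi> (i+1) = i+1" unfolding \<pi>_def using ab(2) by simp
      have \<pi>: "\<pi> permutes {1..i}"
      proof (rule permutes_superset[OF \<pi>1])
        show "\<pi> x = x" if "x \<in> {1..i+1} - {1..i}" for x
        proof -
          have "x = i + 1" using that by auto
          then show ?thesis using \<open>\<pi> (i+1) = i+1\<close> by simp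
        qed
      qed
      have ga: "g \<circ> transpose a (i+1) permutes {1..M}"
        using permutes_transpose_le[OF g] True i by simp
      have e1: "g \<circ> \<sigma> \<circ> transpose b (i+1) = (g \<circ> transpose a (i+1)) \<circ> \<pi>"
        unfolding \<pi>_def by (simp add: fun_eq_iff)
      have e2: "transpose b (i+1) \<circ> inv \<pi> = inv \<sigma> \<circ> transpose a (i+1)"
      proof -
        have "inv \<pi> = transpose b (i+1) \<circ> (inv \<sigma> \<circ> transpose a (i+1))"
        proof (rule inv_unique_comp)
          show "\<pi> \<circ> (transpose b (i+1) \<circ> (inv \<sigma> \<circ> transpose a (i+1))) = id"
            unfolding \<pi>_def using permutes_inverses(1)[OF \<sigma>] by (simp add: fun_eq_iff)
          show "transpose b (i+1) \<circ> (inv \<sigma> \<circ> transpose a (i+1)) \<circ> \<pi> = id"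
            unfolding \<pi>_def using permutes_inverses(2)[OF \<sigma>] by (simp add: fun_eq_iff)
        qed
        then show ?thesis by (simp add: fun_eq_iff)
      qed
      let ?w = "f (g \<circ> transpose a (i+1))"
      have w: "?w \<in> V i" using IA_V[OF i1(1,2) f ga] .
      then have pw: "\<phi> i ?w \<in> V (i+1)" using \<phi>_V[OF i1(1)] by simp
      have \<pi>i: "inv \<pi> permutes {1..i+1}" using permutes_inv[OF \<pi>1] .
      have "adjoin i x f (g \<circ> \<sigma>) = \<rho> (i+1) (transpose b (i+1)) (\<phi> i (\<rho> i (inv \<pi>) ?w))"
        using adjoin_V[OF gs] ig b e1 IA_\<sigma>[OF i1(1,2) f ga \<pi>] by simp
      also have "\<dots> = \<rho> (i+1) (transpose b (i+1)) (\<rho> (i+1) (inv \<pi>) (\<phi> i ?w))"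
        using \<phi>_\<rho>[OF i1(1) permutes_inv[OF \<pi>] w] by simp
      also have "\<dots> = \<rho> (i+1) (inv \<sigma> \<circ> transpose a (i+1)) (\<phi> i ?w)"
        using \<rho>_comp[OF i1(3) tr[OF b] \<pi>i pw] e2 by simp
      also have "\<dots> = \<rho> (i+1) (inv \<sigma>) (adjoin i x f g)"
        using \<rho>_comp[OF i1(3) permutes_inv[OF \<sigma>] tr[OF True] pw] adjoin_V[OF g] True by (simp add: a_def)
      finally show ?thesis .
    qed
  next
    fix g \<tau> assume g: "g permutes {1..M}" and \<tau>: "\<tau> permutes {i+1+1..M}"
    define a where "a = inv g x"
    have gt: "g \<circ> \<tau> permutes {1..M}" using permutes_young'[OF g \<tau>] .
    have ig: "inv (g \<circ> \<tau>) x = inv \<tau> a"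
      using o_inv_distrib[OF permutes_bij[OF g] permutes_bij[OF \<tau>]] by (simp add: a_def)
    show "adjoin i x f (g \<circ> \<tau>) = s (of_int (sign \<tau>)) (adjoin i x f g)"
    proof (cases "a \<in> {1..i+1}")
      case False
      have "inv \<tau> a \<notin> {1..i+1}"
      proof
        assume *: "inv \<tau> a \<in> {1..i+1}"
        then have "inv \<tau> a \<notin> {i+1+1..M}" by simp
        then have "\<tau> (inv \<tau> a) = inv \<tau> a" using permutes_not_in[OF \<tau>] by simp
        then show False using False * permutes_inverses(1)[OF \<tau>] by simp
      qed
      then have "adjoin i x f g = 0" "adjoin i x f (g \<circ> \<tau>) = 0"
        using False ig adjoin_0 unfolding a_def by metis+
      then show ?thesis by simp
    next
      case True
      then have "a \<notin> {i+1+1..M}" by simp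
      then have ia: "inv \<tau> a = a" using permutes_not_in[OF permutes_inv[OF \<tau>]] by simp
      have ga: "g \<circ> transpose a (i+1) permutes {1..M}"
        using permutes_transpose_le[OF g] True i by simp
      have \<tau>': "\<tau> permutes {i+1..M}" using permutes_subset[OF \<tau>] by simp
      have e: "g \<circ> \<tau> \<circ> transpose a (i+1) = (g \<circ> transpose a (i+1)) \<circ> \<tau>"
        using young_commute[OF tr[OF True] \<tau>] by (simp add: comp_assoc)
      show ?thesis
        using ig ia True g gt e IA_\<tau>[OF i1(1,2) f ga \<tau>'] by (simp add: adjoin_def a_def[symmetric] T_scale)
    qed
  next
    fix g assume "\<not> g permutes {1..M}"
    then show "adjoin i x f g = 0" by (simp add: adjoin_def)
  qed
qed

lemma adjoin_face:
  assumes i: "N \<le> i" "i < M" and f: "f \<in> face i R" and x: "x \<in> {1..M}"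
  shows "adjoin i x f \<in> face (i + 1) (insert x R)"
proof -
  have "adjoin i x f g = 0" if "g ` {1..i+1} \<noteq> insert x R" for g
  proof (cases "g permutes {1..M} \<and> inv g x \<in> {1..i+1}")
    case True
    then have g: "g permutes {1..M}" and a: "inv g x \<in> {1..i+1}" by auto
    have gx: "g (inv g x) = x" using permutes_inverses(1)[OF g] by simp
    have "(g \<circ> transpose (inv g x) (i+1)) ` {1..i} = g ` {1..i+1} - {x}"
      using image_transpose_Suc[OF permutes_inj[OF g] a] gx by simp
    moreover have "x \<in> g ` {1..i+1}" using gx a by (metis imageI)
    ultimately have "(g \<circ> transpose (inv g x) (i+1)) ` {1..i} \<noteq> R" using that by auto
    then show ?thesis using faceD(2)[OF f] by (simp add: adjoin_def)
  qed (auto simp: adjoin_def)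
  then show ?thesis using adjoin_IA[OF i faceD(1)[OF f] x] by (simp add: face_def)
qed

text \<open>When x already sits at position i+1 of g, the transposition in \<open>adjoin\<close> is
  the identity. Choosing g in this way reduces every later computation with \<open>adjoin\<close> to
  \<phi>.\<close>

lemma adjoin_at:
  assumes i: "N \<le> i" "i < M" and g: "g permutes {1..M}" "g (i+1) = x" and f: "f \<in> IAM i"
  shows "adjoin i x f g = \<phi> i (f g)"
proof -
  have i1: "1 \<le> i" "i \<le> M" "1 \<le> i + 1" using i N by auto
  have "inv g x = i+1" using g permutes_inverses(2)[OF g(1)] by auto
  then have "adjoin i x f g = \<rho> (i+1) id (\<phi> i (f g))"
    using g T_eq[OF i(1), of "i+1" "f g"] IA_V[OF i1(1,2) f g(1)] by (simp add: adjoin_def)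
  then show ?thesis using \<rho>_id[OF i1(3)] \<phi>_V[OF i1(1) IA_V[OF i1(1,2) f g(1)]] by simp
qed

text \<open>
  Below \<open>N\<close> the sequence is cut off, because there the maps \<open>adjoin\<close> need not anticommute.
\<close>

definition cube_A :: "nat set \<Rightarrow> ((nat \<Rightarrow> nat) \<Rightarrow> 'v) set" where
  "cube_A R = (if N \<le> card R then face (card R) R else {0})"

definition cube_\<iota> :: "nat set \<Rightarrow> nat \<Rightarrow> ((nat \<Rightarrow> nat) \<Rightarrow> 'v) \<Rightarrow> (nat \<Rightarrow> nat) \<Rightarrow> 'v" where
  "cube_\<iota> R x = adjoin (card R) x"

lemma card_le_M: "R \<subseteq> {1..M} \<Longrightarrow> card R \<le> M" "R \<subseteq> {1..M} \<Longrightarrow> finite R"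
  using card_mono[of "{1..M}" R] finite_subset[of R "{1..M}"] by auto

lemma ex_permutes_1:
  assumes "R \<subseteq> {1..M}" "x \<in> {1..M}" "x \<notin> R"
  shows "\<exists>g. g permutes {1..M} \<and> g ` {1..card R} = R \<and> g (card R + 1) = x"
proof -
  define i where "i = card R"
  have c: "card (insert x R) = i + 1" "insert x R \<subseteq> {1..M}"
    using card_le_M[OF assms(1)] assms by (auto simp: i_def)
  obtain g where g: "g permutes {1..M}" "g ` {1..i+1} = insert x R"
    using ex_permutes_image[OF c(2)] c(1) by auto
  then obtain a where a: "a \<in> {1..i+1}" "g a = x" by (metis imageE insertI1)
  have "i + 1 \<le> M" using card_le_M(1)[OF c(2)] c(1) by simp
  then have "g \<circ> transpose a (i+1) permutes {1..M}" using permutes_transpose_le[OF g(1)] a by simp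
  moreover have "(g \<circ> transpose a (i+1)) ` {1..i} = R"
    using image_transpose_Suc[OF permutes_inj[OF g(1)] a(1)] g(2) a(2) assms by simp
  moreover have "(g \<circ> transpose a (i+1)) (i+1) = x" using a by simp
  ultimately show ?thesis unfolding i_def by blast
qed

lemma ex_permutes_2:
  assumes "R \<subseteq> {1..M}" "x \<in> {1..M}" "x \<notin> R" "y \<in> {1..M}" "y \<notin> R" "x \<noteq> y"
  shows "\<exists>g. g permutes {1..M} \<and> g ` {1..card R} = R \<and> g (card R + 1) = x \<and> g (card R + 2) = y"
proof -
  define i where "i = card R"
  have c: "card (insert x R) = i + 1" "insert x R \<subseteq> {1..M}" "y \<notin> insert x R"
    using card_le_M[OF assms(1)] assms by (auto simp: i_def)
  obtain g where g: "g permutes {1..M}" "g ` {1..i+1} = insert x R" "g (i+2) = y"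
    using ex_permutes_1[OF c(2) assms(4) c(3)] c(1) by auto
  then obtain a where a: "a \<in> {1..i+1}" "g a = x" by (metis imageE insertI1)
  have "i + 1 \<le> M" using card_le_M(1)[OF c(2)] c(1) by simp
  then have "g \<circ> transpose a (i+1) permutes {1..M}" using permutes_transpose_le[OF g(1)] a by simp
  moreover have "(g \<circ> transpose a (i+1)) ` {1..i} = R"
    using image_transpose_Suc[OF permutes_inj[OF g(1)] a(1)] g(2) a(2) assms by simp
  moreover have "(g \<circ> transpose a (i+1)) (i+1) = x" "(g \<circ> transpose a (i+1)) (i+2) = y"
    using a g by (simp_all add: transpose_def)
  ultimately show ?thesis unfolding i_def by blast
qed

text \<open>Seen through g, the transposition of x and y exchanges two positions beyond i, where the
  sign representation acts.\<close>

lemma act_outside: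
  assumes i: "1 \<le> i" "i \<le> M" and f: "f \<in> face i R" and R: "R \<subseteq> {1..M}" "card R = i"
    and xy: "x \<in> {1..M}" "y \<in> {1..M}" "x \<notin> R" "y \<notin> R" "x \<noteq> y"
  shows "ind_act (transpose x y) f = - f"
proof -
  have t: "transpose x y permutes {1..M}" using xy by (intro permutes_swap_id)
  obtain g where g: "g permutes {1..M}" "g ` {1..i} = R" using ex_permutes_image[OF R(1)] R(2) by auto
  define a b where "a = inv g x" and "b = inv g y"
  have gab: "g a = x" "g b = y" unfolding a_def b_def using permutes_inverses(1)[OF g(1)] by auto
  have ab: "a \<in> {i+1..M}" "b \<in> {i+1..M}" "a \<noteq> b"
  proof -
    have "a \<in> {1..M}" "b \<in> {1..M}"
      using permutes_in_image[OF permutes_inv[OF g(1)]] xy unfolding a_def b_def by auto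
    moreover have "a \<notin> {1..i}" "b \<notin> {1..i}" using gab g(2) xy by blast+
    ultimately show "a \<in> {i+1..M}" "b \<in> {i+1..M}" by auto
    show "a \<noteq> b" using gab xy by auto
  qed
  have e: "transpose x y \<circ> g = g \<circ> transpose a b"
    using gab permutes_inj[OF g(1)] by (auto simp: fun_eq_iff transpose_def inj_def)
  have ab': "transpose a b permutes {i+1..M}" using ab by (intro permutes_swap_id)
  have "ind_act (transpose x y) f g = (- f) g"
    using IA_\<tau>[OF i faceD(1)[OF f] g(1) ab'] ab by (simp add: ind_act_def e sign_swap_id)
  moreover have "ind_act (transpose x y) f \<in> face i R"
  proof -
    have "transpose x y ` R = R"
      using xy by (auto simp: transpose_def image_iff)
    then show ?thesis using ind_act_face[OF i f t] by simp
  qed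
  moreover have "- f \<in> face i R" using add_subgroup_uminus[OF face_subgroup[OF i] f] .
  ultimately show ?thesis by (intro face_eqI[OF i _ _ g])
qed

text \<open>At a permutation g with x and y in positions i+1 and i+2, adjoining x and then y gives
  \<open>\<phi> (i+1) (\<phi> i (f g))\<close>. The other order differs by the transposition of
  these two positions, which changes the sign of f and fixes the image of \<phi>\<phi> by central
  stability.\<close>

lemma adjoin_op:
  assumes i: "N \<le> i" "i + 2 \<le> M" and f: "f \<in> face i R" and R: "R \<subseteq> {1..M}" "card R = i"
    and xy: "x \<in> {1..M}" "y \<in> {1..M}" "x \<notin> R" "y \<notin> R" "x \<noteq> y"
  shows "adjoin (i+1) y (adjoin i x f) + adjoin (i+1) x (adjoin i y f) = 0"
proof -
  have i1: "1 \<le> i" "i \<le> M" "1 \<le> i+2" "N \<le> i+1" "i+1 < M" "i < M" using i N by auto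
  obtain g where g: "g permutes {1..M}" "g ` {1..i} = R" "g (i+1) = x" "g (i+2) = y"
    using ex_permutes_2[OF R(1) xy(1,3,2,4,5)] R(2) by auto
  note fI = faceD(1)[OF f]
  have fx: "adjoin i x f \<in> face (i+1) (insert x R)" and fy: "adjoin i y f \<in> face (i+1) (insert y R)"
    using adjoin_face[OF i(1) i1(6) f] xy by auto
  have "adjoin (i+1) y (adjoin i x f) \<in> face (i+1+1) (insert y (insert x R))"
    "adjoin (i+1) x (adjoin i y f) \<in> face (i+1+1) (insert x (insert y R))"
    using adjoin_face[OF i1(4,5)] fx fy xy by auto
  then have F: "adjoin (i+1) y (adjoin i x f) + adjoin (i+1) x (adjoin i y f) \<in> face (i+2) (insert x (insert y R))"
    using add_subgroup_add[OF face_subgroup[OF i1(3) i(2)]] by (simp add: insert_commute)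
  have F0: "0 \<in> face (i+2) (insert x (insert y R))"
    using add_subgroup_zero[OF face_subgroup[OF i1(3) i(2)]] .
  have gi: "g ` {1..i+2} = insert x (insert y R)"
  proof -
    have "{1..i+2} = insert (i+1) (insert (i+2) {1..i})" by auto
    then show ?thesis using g by simp
  qed
  have fg: "f g \<in> V i" using IA_V[OF i1(1,2) fI g(1)] .
  have 1: "adjoin (i+1) y (adjoin i x f) g = \<phi> (i+1) (\<phi> i (f g))"
    using adjoin_at[OF i1(4,5) g(1) _ faceD(1)[OF fx], of y] adjoin_at[OF i(1) i1(6) g(1,3) fI] g(4) by simp
  define t where "t = transpose (i+1) (i+2)"
  have gt: "g \<circ> t permutes {1..M}" unfolding t_def using i by (intro permutes_transpose_le[OF g(1)]) auto
  have "(g \<circ> t) (i+1) = y" using g(4) by (simp add: t_def)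
  then have e: "adjoin i y f (g \<circ> t) = \<phi> i (f (g \<circ> t))" using adjoin_at[OF i(1) i1(6) gt _ fI] by blast
  have "t permutes {i+1..M}" unfolding t_def using i by (intro permutes_swap_id) auto
  then have ft: "f (g \<circ> t) = s (- 1) (f g)" using IA_\<tau>[OF i1(1,2) fI g(1)] by (simp add: t_def sign_swap_id)
  have e2: "adjoin i y f (g \<circ> t) = s (- 1) (\<phi> i (f g))" unfolding e ft by (rule \<phi>_scale[OF i1(1) fg])
  have "inv g x = i+1" using g(3) permutes_inverses(2)[OF g(1)] by auto
  then have "adjoin (i+1) x (adjoin i y f) g = T (i+1) (i+1) (adjoin i y f (g \<circ> t))"
    using g(1) by (simp add: adjoin_def t_def)
  also have "\<dots> = s (- 1) (\<rho> (i+2) (transpose (i+1) (i+2)) (\<phi> (i+1) (\<phi> i (f g))))"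
    unfolding e2 T_scale using T_eq[OF i1(4), of "i+1" "\<phi> i (f g)"] \<phi>_V[OF i1(1) fg] by simp
  also have "\<dots> = - \<phi> (i+1) (\<phi> i (f g))" using inv_\<phi>\<phi>[OF i(1) fg] by simp
  finally show ?thesis using 1 by (intro face_eqI[OF i1(3) i(2) F F0 g(1) gi]) simp
qed

text \<open>The sign in the axiom relating transpositions to \<open>cube_\<iota>\<close> comes from
  \<open>act_outside\<close>. The case distinctions on N separate off the region where the cube has
  been cut off and only the zero element occurs.\<close>

sublocale IAcube: cube "{1..M}" cube_A "\<lambda>_. {0}" cube_\<iota> "\<lambda>x y R. ind_act (transpose x y)"
proof
  show "finite {1..M}" by simp
next
  fix R assume R: "R \<subseteq> {1..M}"
  show sA: "add_subgroup (cube_A R)"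
    using face_subgroup[of "card R" R] card_le_M[OF R] N by (auto simp: cube_A_def add_subgroup_def)
  show "add_subgroup {0::(nat \<Rightarrow> nat) \<Rightarrow> 'v}" by (simp add: add_subgroup_def)
  show "{0} \<subseteq> cube_A R" using add_subgroup_zero[OF sA] by simp
next
  fix R x and a b :: "(nat \<Rightarrow> nat) \<Rightarrow> 'v"
  show "cube_\<iota> R x (a - b) = cube_\<iota> R x a - cube_\<iota> R x b" by (simp only: cube_\<iota>_def adjoin_diff)
next
  fix R x a assume R: "R \<subseteq> {1..M}" and x: "x \<in> {1..M}" "x \<notin> R"
  have c: "card (insert x R) = card R + 1" "insert x R \<subseteq> {1..M}" using card_le_M[OF R] R x by auto
  then have c': "card R < M" using card_le_M(1)[OF c(2)] by simp
  show "cube_\<iota> R x a \<in> {0}" if "a \<in> {0}" using that by (simp only: singleton_iff cube_\<iota>_def adjoin_zero)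
  show "cube_\<iota> R x a \<in> cube_A (insert x R)" if a: "a \<in> cube_A R"
  proof (cases "N \<le> card R")
    case True
    then show ?thesis using a adjoin_face[OF True c' _ x(1), of a R] c(1) by (simp add: cube_A_def cube_\<iota>_def)
  next
    case False
    then have "a = 0" using a unfolding cube_A_def by (simp only: if_False singleton_iff)
    then have "cube_\<iota> R x a = 0" by (simp only: cube_\<iota>_def adjoin_zero)
    moreover have "0 \<in> cube_A (insert x R)"
      using face_subgroup[of "card (insert x R)" "insert x R"] c c' N by (auto simp: cube_A_def add_subgroup_def)
    ultimately show ?thesis by (simp only:)
  qed
next
  fix R x y a assume R: "R \<subseteq> {1..M}" and xy: "x \<in> {1..M}" "y \<in> {1..M}" "x \<notin> R" "y \<notin> R" "x \<noteq> y"
  have c: "card (insert x R) = card R + 1" "card (insert y R) = card R + 1"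
    "card (insert x (insert y R)) = card R + 2" "insert x (insert y R) \<subseteq> {1..M}"
    using card_le_M[OF R] R xy by auto
  then have c': "card R + 2 \<le> M" "1 \<le> card R + 1" "card R + 1 \<le> M" using card_le_M(1)[OF c(4)] by simp_all
  have t: "transpose x y permutes {1..M}" using xy by (intro permutes_swap_id)
  have tR: "transpose x y ` insert x R = insert y R"
    using xy by (auto simp: transpose_def image_iff)
  show "cube_\<iota> (insert x R) y (cube_\<iota> R x a) + cube_\<iota> (insert y R) x (cube_\<iota> R y a) = 0" if a: "a \<in> cube_A R"
  proof (cases "N \<le> card R")
    case True
    then have "a \<in> face (card R) R" using a by (simp add: cube_A_def)
    then show ?thesis unfolding cube_\<iota>_def c(1,2) by (intro adjoin_op[OF True c'(1) _ R refl xy])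
  next
    case False
    then have "a = 0" using a unfolding cube_A_def by (simp only: if_False singleton_iff)
    then show ?thesis by (simp only: cube_\<iota>_def adjoin_zero add_0_left)
  qed
  show "ind_act (transpose x y) a \<in> cube_A (insert y R)" if a: "a \<in> cube_A (insert x R)"
  proof (cases "N \<le> card R + 1")
    case True
    then have "a \<in> face (card R + 1) (insert x R)" using a c by (simp add: cube_A_def)
    then have "ind_act (transpose x y) a \<in> face (card R + 1) (insert y R)"
      using ind_act_face[OF c'(2,3) _ t] tR by metis
    then show ?thesis using True c by (simp add: cube_A_def)
  next
    case False
    then have "a = 0" using a c unfolding cube_A_def by (simp only: if_False singleton_iff)
    then show ?thesis using False c unfolding cube_A_def by (simp only: if_False singleton_iff ind_act_0)
  qed
  show "ind_act (transpose x y) a \<in> {0}" if "a \<in> {0}" using that by (simp only: singleton_iff ind_act_0)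
  show "ind_act (transpose x y) (cube_\<iota> R x a) = - cube_\<iota> R y a" if a: "a \<in> cube_A R"
  proof (cases "N \<le> card R")
    case True
    then have "a \<in> face (card R) R" using a by (simp add: cube_A_def)
    then have "ind_act (transpose x y) a = - a"
      using True N c' by (intro act_outside[OF _ _ _ R refl xy]) auto
    moreover have "ind_act (transpose x y) (cube_\<iota> R x a) = cube_\<iota> R y (ind_act (transpose x y) a)"
      using adjoin_act[OF t, of "card R" x a] by (simp add: cube_\<iota>_def)
    moreover have "adjoin (card R) y (- a) = - adjoin (card R) y a"
      using adjoin_diff[of "card R" y 0 a] by (simp only: adjoin_zero diff_0)
    ultimately show ?thesis by (simp only: cube_\<iota>_def)
  next
    case False
    then have "a = 0" using a unfolding cube_A_def by (simp only: if_False singleton_iff)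
    then show ?thesis by (simp only: cube_\<iota>_def adjoin_zero ind_act_0 minus_zero)
  qed
next
  fix x y R and a b :: "(nat \<Rightarrow> nat) \<Rightarrow> 'v"
  show "ind_act (transpose x y) (a - b) = ind_act (transpose x y) a - ind_act (transpose x y) b"
    by (rule ind_act_diff)
next
  fix R x y z a assume R: "R \<subseteq> {1..M}" and xyz: "x \<in> {1..M}" "y \<in> {1..M}" "z \<in> {1..M}"
    "x \<notin> R" "y \<notin> R" "z \<notin> R" "x \<noteq> y" "x \<noteq> z" "y \<noteq> z"
  have t: "transpose x y permutes {1..M}" using xyz by (intro permutes_swap_id)
  have "card (insert x R) = card (insert y R)" using card_le_M[OF R] xyz by simp
  then show "ind_act (transpose x y) (cube_\<iota> (insert x R) z a)
      = cube_\<iota> (insert y R) z (ind_act (transpose x y) a)"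
    using adjoin_act[OF t, of "card (insert x R)" z a] xyz by (simp add: cube_\<iota>_def)
qed

section \<open>Central stability as exactness in the two top degrees\<close>

abbreviation bd :: "(nat set \<Rightarrow> (nat \<Rightarrow> nat) \<Rightarrow> 'v) \<Rightarrow> nat set \<Rightarrow> (nat \<Rightarrow> nat) \<Rightarrow> 'v" where
  "bd \<equiv> cube_bd cube_\<iota>"

text \<open>Evaluated at g, the cube boundary takes the form of the formula for \<open>G\<close> in
  \<open>cstab_quotient\<close>; chains on the facets of R thereby correspond to elements of the
  induced representation.\<close>

lemma bd_eval:
  assumes g: "g permutes {1..M}" "g ` {1..i+1} = R" and i: "i + 1 \<le> M"
  shows "bd c R g = (\<Sum>a\<in>{1..i+1}. T i a (c (R - {g a}) (g \<circ> transpose a (i+1))))"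
proof -
  have inj: "inj_on g {1..i+1}" using permutes_inj[OF g(1)] by (rule inj_on_subset) simp
  have "card R = i + 1" using card_image[OF inj] g(2) by simp
  moreover have "finite R" using g(2) by (metis finite_atLeastAtMost finite_imageI)
  ultimately have cR: "card (R - {x}) = i" if "x \<in> R" for x using that by simp
  have "bd c R g = (\<Sum>x\<in>R. adjoin i x (c (R - {x})) g)"
    unfolding cube_bd_def sum_fun_apply cube_\<iota>_def by (rule sum.cong[OF refl]) (simp only: cR)
  also have "\<dots> = (\<Sum>x\<in>g ` {1..i+1}. adjoin i x (c (R - {x})) g)" using g(2) by simp
  also have "\<dots> = (\<Sum>a\<in>{1..i+1}. adjoin i (g a) (c (R - {g a})) g)"
    by (subst sum.reindex[OF inj]) (simp add: o_def)
  also have "\<dots> = (\<Sum>a\<in>{1..i+1}. T i a (c (R - {g a}) (g \<circ> transpose a (i+1))))"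
    by (rule sum.cong[OF refl]) (use g(1) permutes_inverses(2)[OF g(1)] in \<open>simp add: adjoin_def\<close>)
  finally show ?thesis .
qed

lemma cube_A_face: "N \<le> card R \<Longrightarrow> cube_A R = face (card R) R"
  by (simp add: cube_A_def)

lemma subset_card_Suc:
  assumes "g permutes {1..M}" "g ` {1..n+1} = Y" "Q \<subseteq> Y" "card Q = n" "n + 1 \<le> M"
  obtains a where "a \<in> {1..n+1}" "Q = Y - {g a}"
proof -
  have inj: "inj_on g {1..n+1}" using permutes_inj[OF assms(1)] by (rule inj_on_subset) simp
  have cY: "card Y = n + 1" "finite Y" using card_image[OF inj] assms(2) by auto
  have "card (Y - Q) = 1"
    using card_Diff_subset[OF finite_subset[OF assms(3) cY(2)] assms(3)] cY assms(4) by simp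
  then obtain x where x: "Y - Q = {x}" by (metis card_1_singletonE)
  then have "x \<in> g ` {1..n+1}" using assms(2) by auto
  then obtain a where "a \<in> {1..n+1}" "g a = x" by blast
  moreover have "Q = Y - {x}" using x assms(3) by auto
  ultimately show ?thesis using that by blast
qed

lemma card_image_init:
  assumes "g permutes {1..M}"
  shows "card (g ` {1..n}) = n"
  using card_image[OF inj_on_subset[OF permutes_inj[OF assms], of "{1..n}"]] by simp

text \<open>In top degree the cycle condition is empty, so the claim is that every element over Y is
  a boundary. This is surjectivity of the map from \<open>W n\<close> to \<open>V (n+1)\<close>: a
  preimage w prescribes the values of a chain on the facets of Y.\<close>

lemma exact_top:
  assumes Y: "Y \<subseteq> {1..M}" "card Y = n + 1" and n: "N \<le> n" and iso: "cstab_iso s V \<rho> \<phi> n F"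
  shows "cube_exact cube_A (\<lambda>_. {0}) cube_\<iota> Y (n + 1)"
  unfolding cube_exact_def
proof (intro allI impI, elim conjE)
  fix c assume c: "\<forall>R\<subseteq>Y. card R = n + 1 \<longrightarrow> c R \<in> cube_A R"
  have nM: "n + 1 \<le> M" "1 \<le> n" "1 \<le> n + 1" "n \<le> M" using card_le_M(1)[OF Y(1)] Y(2) n N by auto
  obtain g where g: "g permutes {1..M}" "g ` {1..n+1} = Y" using ex_permutes_image[OF Y(1)] Y(2) by auto
  have cY: "c Y \<in> face (n+1) Y" using c Y n cube_A_face[of Y] by auto
  obtain G where G: "\<And>w. w \<in> W n \<Longrightarrow> G w = (\<Sum>a\<in>{1..n+1}. \<rho> (n+1) (transpose a (n+1)) (\<phi> n (w (transpose a (n+1)))))"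
    "\<And>v. v \<in> V (n+1) \<Longrightarrow> \<exists>w\<in>W n. G w = v"
  proof (rule cstab_quotient[OF nM(2) iso], goal_cases)
    case (1 G) show ?case by (rule 1(1)[OF 1(2,3)])
  qed
  have "c Y g \<in> V (n+1)" using IA_V[OF nM(3,1) faceD(1)[OF cY] g(1)] .
  then obtain w where w: "w \<in> W n" "G w = c Y g" using G(2) by blast
  have wV: "w (transpose a (n+1)) \<in> V n" if "a \<in> {1..n+1}" for a
  proof -
    have "transpose a (n+1) permutes {1..n+1}" using that by (intro permutes_swap_id) simp_all
    then show ?thesis by (rule W_V[OF w(1)])
  qed
  have "\<exists>h. Q \<subseteq> Y \<and> card Q = n \<longrightarrow> h \<in> face n Q \<and>
      (\<forall>a\<in>{1..n+1}. Q = Y - {g a} \<longrightarrow> h (g \<circ> transpose a (n+1)) = w (transpose a (n+1)))" for Q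
  proof (cases "Q \<subseteq> Y \<and> card Q = n")
    case True
    then obtain a where a: "a \<in> {1..n+1}" "Q = Y - {g a}" using subset_card_Suc[OF g _ _ nM(1)] by blast
    have ga: "g \<circ> transpose a (n+1) permutes {1..M}" using permutes_transpose_le[OF g(1)] a(1) nM by simp
    have im: "(g \<circ> transpose a (n+1)) ` {1..n} = Q"
      using image_transpose_Suc[OF permutes_inj[OF g(1)] a(1)] g(2) a(2) by simp
    \<comment> \<open>The facet Q determines a, so only one value is prescribed on it, and
      \<open>ex_face\<close> provides an element with that value.\<close>
    have un: "b = a" if "b \<in> {1..n+1}" "Q = Y - {g b}" for b
    proof -
      have "g a \<in> Y" "g b \<in> Y" using g(2) a(1) that(1) by blast+
      then have "g a = g b" using a(2) that(2) by blast
      then show ?thesis using permutes_inj[OF g(1)] by (simp add: inj_eq)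
    qed
    show ?thesis
      using ex_face[OF nM(2,4) ga wV[OF a(1)]] un unfolding im by blast
  qed blast
  then obtain e where e: "\<And>Q. Q \<subseteq> Y \<Longrightarrow> card Q = n \<Longrightarrow> e Q \<in> face n Q"
    "\<And>Q a. Q \<subseteq> Y \<Longrightarrow> card Q = n \<Longrightarrow> a \<in> {1..n+1} \<Longrightarrow> Q = Y - {g a} \<Longrightarrow>
      e Q (g \<circ> transpose a (n+1)) = w (transpose a (n+1))"
    by metis
  have cQ: "card (Y - {x}) = n" if "x \<in> Y" for x using that Y card_le_M(2)[OF Y(1)] by simp
  have eA: "e Q \<in> cube_A Q" if "Q \<subseteq> Y" "card Q = n" for Q
    using e(1)[OF that] cube_A_face[of Q] that n by simp
  have "bd e Y g = (\<Sum>a\<in>{1..n+1}. T n a (e (Y - {g a}) (g \<circ> transpose a (n+1))))"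
    by (rule bd_eval[OF g nM(1)])
  also have "\<dots> = (\<Sum>a\<in>{1..n+1}. \<rho> (n+1) (transpose a (n+1)) (\<phi> n (w (transpose a (n+1)))))"
  proof (rule sum.cong[OF refl])
    fix a assume a: "a \<in> {1..n+1}"
    then have "g a \<in> Y" using g(2) by blast
    then have "e (Y - {g a}) (g \<circ> transpose a (n+1)) = w (transpose a (n+1))"
      using cQ a by (intro e(2)) auto
    then show "T n a (e (Y - {g a}) (g \<circ> transpose a (n+1)))
        = \<rho> (n+1) (transpose a (n+1)) (\<phi> n (w (transpose a (n+1))))"
      using T_eq[OF n a wV[OF a]] by (simp only:)
  qed
  also have "\<dots> = c Y g" using G(1)[OF w(1)] w(2) by (simp only:)
  finally have bg: "bd e Y g = c Y g" .
  have "bd e Y \<in> cube_A Y" using cQ by (intro IAcube.bd_A[OF Y(1)] eA) auto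
  then have "bd e Y \<in> face (n+1) Y" using cube_A_face[of Y] Y(2) n by simp
  then have eq: "c Y = bd e Y" using face_eqI[OF nM(3,1) cY _ g] bg by simp
  show "\<exists>e. (\<forall>R\<subseteq>Y. Suc (card R) = n + 1 \<longrightarrow> e R \<in> cube_A R) \<and>
      (\<forall>R\<subseteq>Y. card R = n + 1 \<longrightarrow> c R - bd e R \<in> {0})"
  proof (intro exI[of _ e] conjI allI impI)
    fix R assume "R \<subseteq> Y" "Suc (card R) = n + 1"
    then show "e R \<in> cube_A R" by (intro eA) auto
  next
    fix R assume R: "R \<subseteq> Y" "card R = n + 1"
    then have "R = Y" using card_subset_eq[OF card_le_M(2)[OF Y(1)] R(1)] Y(2) by simp
    then show "c R - bd e R \<in> {0}" using eq by (simp only: diff_self singleton_iff)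
  qed
qed

lemma bd_single:
  assumes "finite R" "y \<notin> R"
  shows "bd (\<lambda>Q. if Q = R then E else 0) (insert y R) = adjoin (card R) y E"
proof -
  have "bd (\<lambda>Q. if Q = R then E else 0) (insert y R) =
      cube_\<iota> (insert y R - {y}) y (if insert y R - {y} = R then E else 0) +
      (\<Sum>x\<in>R. cube_\<iota> (insert y R - {x}) x (if insert y R - {x} = R then E else 0))"
    unfolding cube_bd_def using assms by (rule sum.insert)
  also have "(\<Sum>x\<in>R. cube_\<iota> (insert y R - {x}) x (if insert y R - {x} = R then E else 0)) = 0"
  proof (rule sum.neutral, rule ballI)
    fix x assume "x \<in> R"
    then have "insert y R - {x} \<noteq> R" using assms by auto
    then show "cube_\<iota> (insert y R - {x}) x (if insert y R - {x} = R then E else 0) = 0"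
      by (simp only: if_False IAcube.\<iota>_zero)
  qed
  also have "cube_\<iota> (insert y R - {y}) y (if insert y R - {y} = R then E else 0) + 0 = adjoin (card R) y E"
    using assms by (simp add: cube_\<iota>_def)
  finally show ?thesis .
qed

lemma bd_none:
  assumes "\<not> R \<subseteq> Q"
  shows "bd (\<lambda>Q. if Q = R then E else 0) Q = 0"
  unfolding cube_bd_def
proof (rule sum.neutral, rule ballI)
  fix x assume "x \<in> Q"
  then have "Q - {x} \<noteq> R" using assms by auto
  then show "cube_\<iota> (Q - {x}) x (if Q - {x} = R then E else 0) = 0"
    by (simp only: if_False IAcube.\<iota>_zero)
qed

text \<open>
  The generators of the relations defining the central stabilization are the boundaries of the
  translates of \<open>u\<close> in the complex of \<open>Y\<close>.
\<close>

lemma relation_is_boundary: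
  assumes k: "N \<le> k" "k + 2 \<le> M" and g: "g permutes {1..M}" "g ` {1..k+2} = Y"
    and \<gamma>: "\<gamma> permutes {1..k+2}" and u: "u \<in> V k"
    and h: "h permutes {1..k+2}"
  defines "w \<equiv> emb (k+1) (\<phi> k u)" and "t \<equiv> transpose (k+1) (k+2)"
    and "R \<equiv> (g \<circ> \<gamma>) ` {1..k}" and "E \<equiv> ind_act (g \<circ> \<gamma>) (incl k u)"
  shows "bd (\<lambda>Q. if Q = R then E else 0) (Y - {g (h (k+2))}) (g \<circ> h) = ind_act \<gamma> (w - ind_act t w) h"
proof -
  have k1: "1 \<le> k" "k \<le> M" "k < M" "1 \<le> k + 1" "k + 1 \<le> M" using k N by auto
  have g\<gamma>: "g \<circ> \<gamma> permutes {1..M}" using permutes_young[OF g(1) \<gamma>] k by simp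
  have E: "E \<in> face k R" "E (g \<circ> \<gamma>) = u" unfolding E_def R_def using ex_face[OF k1(1,2) g\<gamma> u] by auto
  note EI = faceD(1)[OF E(1)]
  have R: "finite R" "card R = k" unfolding R_def using card_image_init[OF g\<gamma>, of k] by auto
  have inj: "(g \<circ> \<gamma>) a = (g \<circ> \<gamma>) b \<longleftrightarrow> a = b" for a b using permutes_inj[OF g\<gamma>] by (simp only: inj_eq)
  have YR: "Y = insert ((g \<circ> \<gamma>) (k+1)) (insert ((g \<circ> \<gamma>) (k+2)) R)"
  proof -
    have "Y = (g \<circ> \<gamma>) ` {1..k+2}" using g(2) permutes_image[OF \<gamma>] by (metis image_comp)
    moreover have "{1..k+2} = insert (k+1) (insert (k+2) {1..k})" by auto
    ultimately show ?thesis unfolding R_def by simp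
  qed
  have notR: "(g \<circ> \<gamma>) (k+1) \<notin> R" "(g \<circ> \<gamma>) (k+2) \<notin> R" "(g \<circ> \<gamma>) (k+1) \<noteq> (g \<circ> \<gamma>) (k+2)"
    unfolding R_def using inj by auto
  have in_M: "(g \<circ> \<gamma>) a \<in> {1..M}" if "a \<in> {1..M}" for a using permutes_in_image[OF g\<gamma>] that by blast
  have t: "t permutes {1..k+2}" "t permutes {k+1..M}" "inv t = t" "t \<circ> t = id"
    unfolding t_def using k by (auto intro!: permutes_swap_id)
  \<comment> \<open>In terms of \<open>h1\<close> the right-hand side is
    \<open>w h1 - w (t \<circ> h1)\<close>, and the point removed from Y is the image of
    \<open>h1 (k+2)\<close> under \<open>g \<circ> \<gamma>\<close>.\<close>
  define h1 where "h1 = inv \<gamma> \<circ> h"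
  have h1: "h1 permutes {1..k+2}" unfolding h1_def using permutes_compose[OF h permutes_inv[OF \<gamma>]] .
  have hh1: "h = \<gamma> \<circ> h1" unfolding h1_def using permutes_inv_o(1)[OF \<gamma>] by (simp add: comp_assoc[symmetric])
  have gh: "g (h (k+2)) = (g \<circ> \<gamma>) (h1 (k+2))" unfolding hh1 by simp
  have rhs: "ind_act \<gamma> (w - ind_act t w) h = w h1 - w (t \<circ> h1)"
    by (simp add: ind_act_def h1_def t(3))
  have w1: "w p = \<rho> (k+1) (inv p) (\<phi> k u)" if "p permutes {1..k+1}" for p
    unfolding w_def ind_incl_def using that by simp
  have w0: "w p = 0" if "p (k+2) \<noteq> k+2" for p
  proof -
    have "\<not> p permutes {1..k+1}" using permutes_not_in[of p "{1..k+1}" "k+2"] that by auto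
    then show ?thesis unfolding w_def ind_incl_def by simp
  qed
  have fix_perm: "p permutes {1..k+1}" if "p permutes {1..k+2}" "p (k+2) = k+2" for p
  proof (rule permutes_superset[OF that(1)])
    fix x assume "x \<in> {1..k+2} - {1..k+1}"
    then have "x = k+2" by auto
    then show "p x = x" using that(2) by simp
  qed
  have u1: "\<phi> k u \<in> V (k+1)" using \<phi>_V[OF k1(1) u] .
  \<comment> \<open>Removing the last point of Y leaves R with the last but one adjoined and matches
    the term \<open>w h1\<close>. Removing the last but one matches the other term, the sign coming
    from the exchange of the two. Removing a point of R leaves a set that does not contain R, and
    both sides vanish.\<close>
  consider "h1 (k+2) = k+2" | "h1 (k+2) = k+1" | "h1 (k+2) \<in> {1..k}"
    using permutes_in_image[OF h1, of "k+2"] by fastforce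
  then show ?thesis
  proof cases
    case 1
    define y where "y = (g \<circ> \<gamma>) (k+1)"
    have Yy: "Y - {g (h (k+2))} = insert y R" unfolding gh 1 YR y_def using notR by auto
    have L: "bd (\<lambda>Q. if Q = R then E else 0) (Y - {g (h (k+2))}) = adjoin k y E"
      using bd_single[OF R(1) notR(1), of E] unfolding Yy unfolding R(2) y_def .
    have opI: "adjoin k y E \<in> IAM (k+1)" using adjoin_IA[OF k(1) k1(3) EI] in_M k unfolding y_def by auto
    have h1': "h1 permutes {1..k+1}" by (rule fix_perm[OF h1 1])
    have "adjoin k y E (g \<circ> \<gamma>) = \<phi> k u" using adjoin_at[OF k(1) k1(3) g\<gamma> _ EI, of y] E(2) unfolding y_def by simp
    then have "adjoin k y E (g \<circ> h) = \<rho> (k+1) (inv h1) (\<phi> k u)"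
      using IA_\<sigma>[OF k1(4,5) opI g\<gamma> h1'] unfolding hh1 by (simp add: comp_assoc)
    moreover have "w (t \<circ> h1) = 0" using 1 by (intro w0) (simp add: t_def)
    ultimately show ?thesis unfolding L rhs w1[OF h1'] by simp
  next
    case 2
    define y where "y = (g \<circ> \<gamma>) (k+2)"
    have Yy: "Y - {g (h (k+2))} = insert y R" unfolding gh 2 YR y_def using notR by auto
    have L: "bd (\<lambda>Q. if Q = R then E else 0) (Y - {g (h (k+2))}) = adjoin k y E"
      using bd_single[OF R(1) notR(2), of E] unfolding Yy unfolding R(2) y_def .
    have opI: "adjoin k y E \<in> IAM (k+1)" using adjoin_IA[OF k(1) k1(3) EI] in_M k unfolding y_def by auto
    define h2 where "h2 = t \<circ> h1"
    have h2: "h2 permutes {1..k+1}"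
      unfolding h2_def using permutes_compose[OF h1 t(1)] 2 by (intro fix_perm) (auto simp: t_def)
    have h1t: "h1 = t \<circ> h2" unfolding h2_def using t(4) by (simp add: comp_assoc[symmetric])
    have g\<gamma>t: "g \<circ> \<gamma> \<circ> t permutes {1..M}" using permutes_young'[OF g\<gamma> t(2)] .
    have "E (g \<circ> \<gamma> \<circ> t) = s (- 1) u"
      using IA_\<tau>[OF k1(1,2) EI g\<gamma> t(2)] E(2) by (simp add: t_def sign_swap_id)
    moreover have "(g \<circ> \<gamma> \<circ> t) (k+1) = y" by (simp add: t_def y_def)
    ultimately have "adjoin k y E (g \<circ> \<gamma> \<circ> t) = s (- 1) (\<phi> k u)"
      using adjoin_at[OF k(1) k1(3) g\<gamma>t _ EI, of y] \<phi>_scale[OF k1(1) u, of "-1"] by (simp only:)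
    then have "adjoin k y E (g \<circ> \<gamma> \<circ> t \<circ> h2) = s (- 1) (\<rho> (k+1) (inv h2) (\<phi> k u))"
      using IA_\<sigma>[OF k1(4,5) opI g\<gamma>t h2] \<rho>_scale[OF k1(4) permutes_inv[OF h2] u1, of "-1"] by (simp only:)
    moreover have "g \<circ> \<gamma> \<circ> t \<circ> h2 = g \<circ> h" unfolding hh1 h1t by (simp add: comp_assoc)
    moreover have "w h1 = 0" using 2 by (intro w0) simp
    ultimately show ?thesis unfolding L rhs h2_def[symmetric] w1[OF h2] by simp
  next
    case 3
    have "(g \<circ> \<gamma>) (h1 (k+2)) \<in> R" unfolding R_def using 3 by blast
    then have "\<not> R \<subseteq> Y - {g (h (k+2))}" unfolding gh by blast
    then have L: "bd (\<lambda>Q. if Q = R then E else 0) (Y - {g (h (k+2))}) = 0" by (rule bd_none)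
    have "w h1 = 0" using 3 by (intro w0) auto
    moreover have "w (t \<circ> h1) = 0" using 3 by (intro w0) (auto simp: t_def transpose_def)
    ultimately show ?thesis unfolding L rhs by simp
  qed
qed

lemma bd_scale: "bd (\<lambda>Q. fun_scale s c (e Q)) Q = fun_scale s c (bd e Q)"
  unfolding cube_bd_def cube_\<iota>_def adjoin_scale fs.scale_sum_right ..

text \<open>This is injectivity of W/U -> V for the stabilization at k+1. A cycle on the facets of Y
  is an element of W killed by \<open>G\<close>, hence a combination of relations, and each relation
  is the boundary of a chain concentrated on one face with k elements.\<close>

lemma exact_below_top:
  assumes Y: "Y \<subseteq> {1..M}" "card Y = k + 2" and k: "N \<le> k" and iso: "cstab_iso s V \<rho> \<phi> (k+1) F"
  shows "cube_exact cube_A (\<lambda>_. {0}) cube_\<iota> Y (k + 1)"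
  unfolding cube_exact_def
proof (intro allI impI, elim conjE)
  fix c assume c: "\<forall>R\<subseteq>Y. card R = k + 1 \<longrightarrow> c R \<in> cube_A R"
    and bc: "\<forall>R\<subseteq>Y. card R = Suc (k + 1) \<longrightarrow> bd c R \<in> {0}"
  have kM: "k + 2 \<le> M" "1 \<le> k + 1" "k + 1 \<le> M" "1 \<le> k" "k \<le> M" "k + 1 + 1 \<le> M"
    using card_le_M(1)[OF Y(1)] Y(2) k N by auto
  obtain g where g: "g permutes {1..M}" "g ` {1..k+2} = Y" using ex_permutes_image[OF Y(1)] Y(2) by auto
  have cf: "c R \<in> face (k+1) R" if "R \<subseteq> Y" "card R = k + 1" for R
    using c that k cube_A_face[of R] by auto
  obtain G where G: "\<And>w. w \<in> W (k+1) \<Longrightarrow>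
      G w = (\<Sum>a\<in>{1..k+1+1}. \<rho> (k+1+1) (transpose a (k+1+1)) (\<phi> (k+1) (w (transpose a (k+1+1)))))"
    "\<And>w. w \<in> W (k+1) \<Longrightarrow> G w = 0 \<longleftrightarrow> w \<in> U (k+1)"
  proof (rule cstab_quotient[OF kM(2) iso], goal_cases)
    case (1 G) show ?case by (rule 1(1)[OF 1(2,4)])
  qed
  \<comment> \<open>The chain \<open>c\<close> is read along g: \<open>h (k+2)\<close> names the
    point that the facet omits. The value 0 outside the symmetric group is forced by membership in
    the induced representation.\<close>
  define w where "w h = (if h permutes {1..k+2} then c (Y - {g (h (k+2))}) (g \<circ> h) else 0)" for h
  have Yg: "Y - {g a} \<subseteq> Y" "card (Y - {g a}) = k + 1" if "a \<in> {1..k+2}" for a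
  proof -
    have "g a \<in> Y" using that g(2) by blast
    then show "card (Y - {g a}) = k + 1" using Y card_le_M(2)[OF Y(1)] by simp
  qed auto
  have hk: "h (k+2) \<in> {1..k+2}" "g \<circ> h permutes {1..M}" if "h permutes {1..k+2}" for h
    using permutes_in_image[OF that, of "k+2"] permutes_young[OF g(1) that kM(1)] by auto
  have cI: "c (Y - {g a}) \<in> IAM (k+1)" if "a \<in> {1..k+2}" for a
    using faceD(1)[OF cf[OF Yg[OF that]]] .
  have wW: "w \<in> W (k+1)"
  proof (rule WI)
    fix h assume "h permutes {1..k+1+1}"
    then have h: "h permutes {1..k+2}" by simp
    then show "w h \<in> V (k+1)" unfolding w_def using IA_V[OF kM(2,3) cI[OF hk(1)[OF h]] hk(2)[OF h]] by simp
    fix \<sigma> assume \<sigma>: "\<sigma> permutes {1..k+1}"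
    then have "\<sigma> (k+2) = k+2" by (intro permutes_not_in) auto
    then have "(h \<circ> \<sigma>) (k+2) = h (k+2)" by simp
    moreover have "h \<circ> \<sigma> permutes {1..k+2}"
      using permutes_compose[OF permutes_subset[OF \<sigma>, of "{1..k+2}"] h] by simp
    moreover have "g \<circ> (h \<circ> \<sigma>) = g \<circ> h \<circ> \<sigma>" by (simp add: comp_assoc)
    ultimately show "w (h \<circ> \<sigma>) = \<rho> (k+1) (inv \<sigma>) (w h)"
      unfolding w_def using IA_\<sigma>[OF kM(2,3) cI[OF hk(1)[OF h]] hk(2)[OF h] \<sigma>] h by (simp only: if_True)
  next
    fix h assume "\<not> h permutes {1..k+1+1}" then show "w h = 0" unfolding w_def by simp
  qed
  have "G w = (\<Sum>a\<in>{1..k+1+1}. T (k+1) a (c (Y - {g a}) (g \<circ> transpose a (k+1+1))))"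
    unfolding G(1)[OF wW]
  proof (rule sum.cong[OF refl])
    fix a assume a: "a \<in> {1..k+1+1}"
    then have tr: "transpose a (k+1+1) permutes {1..k+1+1}" by (intro permutes_swap_id) simp_all
    then have "w (transpose a (k+1+1)) = c (Y - {g a}) (g \<circ> transpose a (k+1+1))"
      unfolding w_def by simp
    then show "\<rho> (k+1+1) (transpose a (k+1+1)) (\<phi> (k+1) (w (transpose a (k+1+1))))
        = T (k+1) a (c (Y - {g a}) (g \<circ> transpose a (k+1+1)))"
      using T_eq[OF _ a W_V[OF wW tr]] k by simp
  qed
  also have "\<dots> = bd c Y g"
    using g(2) by (intro bd_eval[OF g(1) _ kM(6), symmetric]) simp
  also have "\<dots> = 0"
  proof -
    have "bd c Y \<in> {0}" using bc Y(2) by simp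
    then have "bd c Y = 0" by (simp only: singleton_iff)
    then show ?thesis by simp
  qed
  finally have "w \<in> U (k+1)" using G(2)[OF wW] by blast
  \<comment> \<open>The cube boundary is linear, so induction over the span reduces the search for a
    filling to the generators treated in \<open>relation_is_boundary\<close>.\<close>
  then have "\<exists>e. (\<forall>Q. Q \<subseteq> Y \<and> card Q = k \<longrightarrow> e Q \<in> face k Q) \<and>
      (\<forall>h. h permutes {1..k+2} \<longrightarrow> bd e (Y - {g (h (k+2))}) (g \<circ> h) = w h)"
    unfolding cstab_relations_def
  proof (induction rule: fs.span_induct_alt)
    case base
    show ?case
    proof (rule exI[of _ "\<lambda>_. 0"], intro conjI allI impI)
      fix Q show "0 \<in> face k Q" using add_subgroup_zero[OF face_subgroup[OF kM(4,5)]] .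
    next
      fix h show "bd (\<lambda>_. 0) (Y - {g (h (k+2))}) (g \<circ> h) = 0 h"
        unfolding IAcube.bd_zero by simp
    qed
  next
    case (step b x y)
    then obtain \<gamma> u where x: "x = ind_act \<gamma> (emb (k+1) (\<phi> k u) - ind_act (transpose (k+1) (k+2)) (emb (k+1) (\<phi> k u)))"
      "\<gamma> permutes {1..k+2}" "u \<in> V k"
      by auto
    define R E where "R = (g \<circ> \<gamma>) ` {1..k}" and "E = ind_act (g \<circ> \<gamma>) (incl k u)"
    define e1 where "e1 Q = (if Q = R then E else 0)" for Q
    have E: "E \<in> face k R"
      unfolding E_def R_def using ex_face(1)[OF kM(4,5) permutes_young[OF g(1) x(2) kM(1)] x(3)] .
    have e1: "e1 Q \<in> face k Q" for Q
      unfolding e1_def using E add_subgroup_zero[OF face_subgroup[OF kM(4,5)]] by simp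
    have b1: "bd e1 (Y - {g (h (k+2))}) (g \<circ> h) = x h" if "h permutes {1..k+2}" for h
      unfolding x(1) e1_def R_def E_def by (rule relation_is_boundary[OF k kM(1) g x(2,3) that])
    from step.IH obtain e2 where e2: "\<And>Q. Q \<subseteq> Y \<Longrightarrow> card Q = k \<Longrightarrow> e2 Q \<in> face k Q"
      "\<And>h. h permutes {1..k+2} \<Longrightarrow> bd e2 (Y - {g (h (k+2))}) (g \<circ> h) = y h" by blast
    show ?case
    proof (rule exI[of _ "\<lambda>Q. fun_scale s b (e1 Q) + e2 Q"], intro conjI allI impI)
      fix Q assume "Q \<subseteq> Y \<and> card Q = k"
      then show "fun_scale s b (e1 Q) + e2 Q \<in> face k Q"
        using add_subgroup_add[OF face_subgroup[OF kM(4,5)] face_fun_scale[OF kM(4,5) e1] e2(1)] by blast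
    next
      fix h :: "nat \<Rightarrow> nat" assume h: "h permutes {1..k+2}"
      show "bd (\<lambda>Q. fun_scale s b (e1 Q) + e2 Q) (Y - {g (h (k+2))}) (g \<circ> h) = (fun_scale s b x + y) h"
        unfolding IAcube.bd_add bd_scale by (simp only: plus_fun_apply fun_scale_def b1[OF h] e2(2)[OF h])
    qed
  qed
  then obtain e where e: "\<And>Q. Q \<subseteq> Y \<Longrightarrow> card Q = k \<Longrightarrow> e Q \<in> face k Q"
    "\<And>h. h permutes {1..k+2} \<Longrightarrow> bd e (Y - {g (h (k+2))}) (g \<circ> h) = w h" by blast
  have eA: "e Q \<in> cube_A Q" if "Q \<subseteq> Y" "card Q = k" for Q
    using e(1)[OF that] cube_A_face[of Q] that k by simp
  show "\<exists>e. (\<forall>R\<subseteq>Y. Suc (card R) = k + 1 \<longrightarrow> e R \<in> cube_A R) \<and>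
      (\<forall>R\<subseteq>Y. card R = k + 1 \<longrightarrow> c R - bd e R \<in> {0})"
  proof (intro exI[of _ e] conjI allI impI)
    fix R assume "R \<subseteq> Y" "Suc (card R) = k + 1"
    then show "e R \<in> cube_A R" by (intro eA) auto
  next
    fix R assume R: "R \<subseteq> Y" "card R = k + 1"
    obtain a where a: "a \<in> {1..k+1+1}" "R = Y - {g a}"
      using subset_card_Suc[OF g(1) _ R kM(6)] g(2) by auto
    \<comment> \<open>Every facet is reached by such a transposition, and agreement at the one
      permutation \<open>g \<circ> t\<close> suffices by \<open>face_eqI\<close>.\<close>
    define t where "t = transpose a (k+1+1)"
    have t: "t permutes {1..k+2}" unfolding t_def using a by (intro permutes_swap_id) auto
    have "t (k+2) = a" by (simp add: t_def)
    then have v: "bd e R (g \<circ> t) = c R (g \<circ> t)" using e(2)[OF t] t a(2) unfolding w_def by simp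
    have im: "(g \<circ> t) ` {1..k+1} = R"
      using image_transpose_Suc[OF permutes_inj[OF g(1)] a(1)] g(2) a(2) unfolding t_def by simp
    have "bd e R \<in> cube_A R"
      using R card_le_M(2)[OF Y(1)] Y(1) by (intro IAcube.bd_A eA) (auto dest: finite_subset)
    then have "bd e R \<in> face (k+1) R" using cube_A_face[of R] R(2) k by simp
    then have "c R = bd e R"
      using face_eqI[OF kM(2,3) cf[OF R] _ hk(2)[OF t] im] v by simp
    then show "c R - bd e R \<in> {0}" by (simp only: diff_self singleton_iff)
  qed
qed

end

section \<open>The boundary maps\<close>

lemma (in vector_space) ex_linear_extension:
  assumes V: "subspace V"
    and add: "\<And>v w. v \<in> V \<Longrightarrow> w \<in> V \<Longrightarrow> f (v + w) = f v + f w"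
    and sc: "\<And>c v. v \<in> V \<Longrightarrow> f (scale c v) = scale c (f v)"
  shows "\<exists>g. (\<forall>v w. g (v + w) = g v + g w) \<and> (\<forall>c v. g (scale c v) = scale c (g v)) \<and> (\<forall>v\<in>V. g v = f v)"
proof -
  interpret vp: vector_space_pair scale scale by unfold_locales
  obtain B where B: "B \<subseteq> V" "independent B" "V \<subseteq> span B"
    using maximal_independent_subset by metis
  obtain g where g: "Vector_Spaces.linear scale scale g" "\<forall>x\<in>B. g x = f x"
    using vp.linear_independent_extend[OF B(2)] by blast
  have g_add: "g (v + w) = g v + g w" and g_sc: "g (scale c v) = scale c (g v)" for v w c
    using vp.linear_add[OF g(1)] vp.linear_scale[OF g(1)] by auto
  \<comment> \<open>Membership in V is carried through the induction because f is known to be linear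
    only there.\<close>
  have "v \<in> V \<and> g v = f v" if "v \<in> span B" for v
    using that
  proof (induction rule: span_induct_alt)
    case base
    have "g 0 = 0" using g_sc[of 0 0] by simp
    moreover have "f 0 = 0" using sc[of 0 0] subspace_0[OF V] by simp
    ultimately show ?case using subspace_0[OF V] by simp
  next
    case (step c x y)
    then have "x \<in> V" "scale c x \<in> V" "y \<in> V" using B(1) subspace_scale[OF V] by auto
    then show ?case
      using step g(2) add[of "scale c x" y] sc[of x c] subspace_add[OF V] by (simp add: g_add g_sc)
  qed
  then show ?thesis using g_add g_sc B(3) by blast
qed

text \<open>Supplies one system of representatives, without which the clause about all C in
  \<open>is_boundary_map\<close> could not be used to determine a map.\<close>

lemma left_coset_reps_transpose:
  assumes "i + 1 \<le> M"
  shows "left_coset_reps (symgrp {i+1..M}) (symgrp {i+2..M}) ((\<lambda>b. transpose (i+1) b) ` {i+1..M})"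
  unfolding left_coset_reps_def
proof (intro conjI ballI)
  show "(\<lambda>b. transpose (i+1) b) ` {i+1..M} \<subseteq> symgrp {i+1..M}"
    by (auto intro!: permutes_swap_id)
  fix g assume "g \<in> symgrp {i+1..M}"
  then have g: "g permutes {i+1..M}" by simp
  show "\<exists>!c. c \<in> (\<lambda>b. transpose (i+1) b) ` {i+1..M} \<and> g \<in> {c \<circ> h | h. h \<in> symgrp {i+2..M}}"
  proof -
    define b where "b = g (i+1)"
    have b: "b \<in> {i+1..M}" unfolding b_def using permutes_in_image[OF g, of "i+1"] assms by simp
    have tb: "transpose (i+1) b permutes {i+1..M}" using b by (intro permutes_swap_id) auto
    define h where "h = transpose (i+1) b \<circ> g"
    have h: "h permutes {i+2..M}"
    proof (rule permutes_superset[of _ "{i+1..M}"])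
      show "h permutes {i+1..M}" unfolding h_def by (rule permutes_compose[OF g tb])
      fix x assume "x \<in> {i+1..M} - {i+2..M}"
      then have "x = i + 1" by auto
      then show "h x = x" unfolding h_def b_def by simp
    qed
    have gh: "g = transpose (i+1) b \<circ> h" unfolding h_def by (simp add: fun_eq_iff)
    show ?thesis
    proof (rule ex1I[of _ "transpose (i+1) b"])
      show "transpose (i+1) b \<in> (\<lambda>b. transpose (i+1) b) ` {i+1..M} \<and>
          g \<in> {transpose (i+1) b \<circ> h | h. h \<in> symgrp {i+2..M}}" using b gh h by blast
      fix c assume "c \<in> (\<lambda>b. transpose (i+1) b) ` {i+1..M} \<and> g \<in> {c \<circ> h | h. h \<in> symgrp {i+2..M}}"
      then obtain b' h' where c: "c = transpose (i+1) b'" "g = c \<circ> h'" "h' permutes {i+2..M}" by auto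
      have "h' (i+1) = i+1" using permutes_not_in[OF c(3), of "i+1"] by simp
      then have "b' = b" unfolding b_def c(2) c(1) by simp
      then show "c = transpose (i+1) b" using c(1) by simp
    qed
  qed
qed

text \<open>A coset is determined by the image of i+1. Any system C therefore turns the signed sum
  over C into a sum over the points that can be adjoined, which explains its independence of
  C.\<close>

lemma left_coset_reps_bij:
  assumes C: "left_coset_reps (symgrp {i+1..M}) (symgrp {i+2..M}) C" and i: "i + 1 \<le> M"
  shows "bij_betw (\<lambda>\<sigma>. \<sigma> (i+1)) C {i+1..M}"
proof -
  have CG: "c permutes {i+1..M}" if "c \<in> C" for c using C that unfolding left_coset_reps_def by auto
  have un: "\<exists>!c. c \<in> C \<and> g \<in> {c \<circ> h | h. h \<in> symgrp {i+2..M}}" if "g permutes {i+1..M}" for g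
    using C that unfolding left_coset_reps_def by auto
  show ?thesis
  proof (rule bij_betw_imageI)
    show "inj_on (\<lambda>\<sigma>. \<sigma> (i+1)) C"
    proof (rule inj_onI)
      fix c c' assume c: "c \<in> C" "c' \<in> C" "c (i+1) = c' (i+1)"
      define h where "h = inv c \<circ> c'"
      have h: "h permutes {i+2..M}"
      proof (rule permutes_superset[of _ "{i+1..M}"])
        show "h permutes {i+1..M}"
          unfolding h_def by (rule permutes_compose[OF CG[OF c(2)] permutes_inv[OF CG[OF c(1)]]])
        fix x assume "x \<in> {i+1..M} - {i+2..M}"
        then have "x = i + 1" by auto
        then show "h x = x" unfolding h_def using c(3) permutes_inverses(2)[OF CG[OF c(1)]] by (metis comp_apply)
      qed
      have "c' = c \<circ> h" unfolding h_def using permutes_inv_o(1)[OF CG[OF c(1)]] by (simp add: comp_assoc[symmetric])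
      then have "c' \<in> {c \<circ> h | h. h \<in> symgrp {i+2..M}}" using h by blast
      moreover have "c' \<in> {c' \<circ> h | h. h \<in> symgrp {i+2..M}}"
        using permutes_id by (metis (mono_tags, lifting) comp_id mem_Collect_eq)
      ultimately show "c = c'" using un[OF CG[OF c(2)]] c by blast
    qed
    show "(\<lambda>\<sigma>. \<sigma> (i+1)) ` C = {i+1..M}"
    proof
      show "(\<lambda>\<sigma>. \<sigma> (i+1)) ` C \<subseteq> {i+1..M}"
        using permutes_in_image[OF CG] i by auto
      show "{i+1..M} \<subseteq> (\<lambda>\<sigma>. \<sigma> (i+1)) ` C"
      proof
        fix b assume "b \<in> {i+1..M}"
        then have "transpose (i+1) b permutes {i+1..M}" by (intro permutes_swap_id) auto
        from un[OF this] obtain c h where c: "c \<in> C" "transpose (i+1) b = c \<circ> h" "h permutes {i+2..M}" by auto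
        have "h (i+1) = i+1" using permutes_not_in[OF c(3), of "i+1"] by simp
        then have "c (i+1) = b" using fun_cong[OF c(2), of "i+1"] by simp
        then show "b \<in> (\<lambda>\<sigma>. \<sigma> (i+1)) ` C" using c(1) by blast
      qed
    qed
  qed
qed

context stable_sequence
begin

section \<open>The boundary as a sum of adjunctions\<close>

lemma image_init:
  assumes "g permutes {1..M}" "k \<le> M"
  shows "g ` {1..k} \<subseteq> {1..M}" "card (g ` {1..k}) = k" "finite (g ` {1..k})"
proof -
  show "g ` {1..k} \<subseteq> {1..M}"
    using permutes_image[OF assms(1)] image_mono[of "{1..k}" "{1..M}" g] assms(2) by simp
qed (simp_all only: card_image_init[OF assms(1)] finite_imageI finite_atLeastAtMost)

text \<open>Letting x run over all of {1..M} avoids any reference to the face on which f lives and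
  makes equivariance a reindexing of the sum. In the relevant range the points of the face itself
  contribute nothing, by \<open>adjoin_inside\<close>.\<close>

definition bdry :: "nat \<Rightarrow> ((nat \<Rightarrow> nat) \<Rightarrow> 'v) \<Rightarrow> (nat \<Rightarrow> nat) \<Rightarrow> 'v" where
  "bdry i f = (\<Sum>x\<in>{1..M}. adjoin i x f)"

text \<open>On the induced representation this is the projection onto the summand
  \<open>face i R\<close>.\<close>

definition comp_at :: "nat \<Rightarrow> ((nat \<Rightarrow> nat) \<Rightarrow> 'v) \<Rightarrow> nat set \<Rightarrow> (nat \<Rightarrow> nat) \<Rightarrow> 'v" where
  "comp_at i f R = (\<lambda>g. if g ` {1..i} = R then f g else 0)"

lemma bdry_eval:
  assumes g: "g permutes {1..M}" and i: "i < M"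
  shows "bdry i f g = (\<Sum>a\<in>{1..i+1}. T i a (f (g \<circ> transpose a (i+1))))"
proof -
  have "bdry i f g = (\<Sum>a\<in>{1..M}. adjoin i (g a) f g)"
    unfolding bdry_def sum_fun_apply by (subst sum.permute[OF g]) (simp add: o_def)
  also have "\<dots> = (\<Sum>a\<in>{1..i+1}. adjoin i (g a) f g)"
    using i permutes_inverses(2)[OF g] by (intro sum.mono_neutral_right ballI adjoin_0) auto
  also have "\<dots> = (\<Sum>a\<in>{1..i+1}. T i a (f (g \<circ> transpose a (i+1))))"
    by (rule sum.cong[OF refl]) (use g permutes_inverses(2)[OF g] in \<open>simp add: adjoin_def\<close>)
  finally show ?thesis .
qed

lemma bdry_out: "\<not> g permutes {1..M} \<Longrightarrow> bdry i f g = 0"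
  unfolding bdry_def sum_fun_apply by (rule sum.neutral) (simp add: adjoin_0)

lemma bdry_IA: "N \<le> i \<Longrightarrow> i < M \<Longrightarrow> f \<in> IAM i \<Longrightarrow> bdry i f \<in> IAM (i+1)"
  unfolding bdry_def using N by (intro add_subgroup_sum[OF IA_subgroup] adjoin_IA) auto

lemma bdry_add: "bdry i (f + f') = bdry i f + bdry i f'"
  using adjoin_diff[of i _ "f + f'" f'] by (simp add: bdry_def sum.distrib[symmetric] algebra_simps)

lemma bdry_scale: "bdry i (fun_scale s c f) = fun_scale s c (bdry i f)"
  unfolding bdry_def adjoin_scale fs.scale_sum_right ..

lemma ind_act_sum: "ind_act g (sum f I) = (\<Sum>x\<in>I. ind_act g (f x))"
  by (simp add: ind_act_def fun_eq_iff sum_fun_apply)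

lemma bdry_act:
  assumes g: "g permutes {1..M}"
  shows "bdry i (ind_act g f) = ind_act g (bdry i f)"
proof -
  have "bdry i (ind_act g f) = (\<Sum>x\<in>{1..M}. adjoin i (g x) (ind_act g f))"
    unfolding bdry_def by (subst sum.permute[OF g]) (simp add: o_def)
  then show ?thesis unfolding adjoin_act[OF g] bdry_def ind_act_sum .
qed

lemma comp_at_face:
  assumes i: "1 \<le> i" "i \<le> M" and f: "f \<in> IAM i"
  shows "comp_at i f R \<in> face i R"
proof -
  have "comp_at i f R \<in> IAM i"
  proof (rule IAI[OF i])
    fix g assume g: "g permutes {1..M}"
    show "comp_at i f R g \<in> V i" unfolding comp_at_def using IA_V[OF i f g] V_0[OF i(1)] by simp
    show "comp_at i f R (g \<circ> \<sigma>) = \<rho> i (inv \<sigma>) (comp_at i f R g)" if "\<sigma> permutes {1..i}" for \<sigma>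
      unfolding comp_at_def image_young[OF that]
      using IA_\<sigma>[OF i f g that] \<rho>_0[OF i(1) permutes_inv[OF that]] by simp
    show "comp_at i f R (g \<circ> \<tau>) = s (of_int (sign \<tau>)) (comp_at i f R g)" if "\<tau> permutes {i+1..M}" for \<tau>
      unfolding comp_at_def image_young'[OF that] using IA_\<tau>[OF i f g that] by simp
  qed (use IA_out[OF i f] in \<open>simp add: comp_at_def\<close>)
  then show ?thesis by (simp add: face_def comp_at_def)
qed

text \<open>The dictionary between \<open>bdry\<close> and the cube boundary. At a permutation
  belonging to R the cube boundary asks for components over the facets R - {g a}, and
  \<open>g \<circ> transpose a (i+1)\<close> belongs to exactly that facet, so projecting changes no
  term.\<close>

lemma comp_at_bdry:
  assumes i: "N \<le> i" "i < M" and f: "f \<in> IAM i" and R: "R \<subseteq> {1..M}" "card R = i + 1"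
  shows "bd (comp_at i f) R = comp_at (i+1) (bdry i f) R"
proof
  fix g
  have i1: "1 \<le> i" "i \<le> M" "i + 1 \<le> M" "1 \<le> i + 1" using i N by auto
  have cA: "comp_at i f Q \<in> cube_A Q" if "card Q = i" for Q
    using comp_at_face[OF i1(1,2) f, of Q] cube_A_face[of Q] that i by simp
  have "bd (comp_at i f) R \<in> cube_A R"
    using R card_le_M(2)[OF R(1)] by (intro IAcube.bd_A cA) auto
  then have F: "bd (comp_at i f) R \<in> face (i+1) R" using cube_A_face[of R] R i by simp
  show "bd (comp_at i f) R g = comp_at (i+1) (bdry i f) R g"
  proof (cases "g permutes {1..M} \<and> g ` {1..i+1} = R")
    case True
    then have g: "g permutes {1..M}" "g ` {1..i+1} = R" by auto
    have "bd (comp_at i f) R g = (\<Sum>a\<in>{1..i+1}. T i a (comp_at i f (R - {g a}) (g \<circ> transpose a (i+1))))"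
      by (rule bd_eval[OF g i1(3)])
    also have "\<dots> = (\<Sum>a\<in>{1..i+1}. T i a (f (g \<circ> transpose a (i+1))))"
    proof (rule sum.cong[OF refl])
      fix a assume "a \<in> {1..i+1}"
      then have "(g \<circ> transpose a (i+1)) ` {1..i} = R - {g a}"
        using image_transpose_Suc[OF permutes_inj[OF g(1)]] g(2) by blast
      then show "T i a (comp_at i f (R - {g a}) (g \<circ> transpose a (i+1))) = T i a (f (g \<circ> transpose a (i+1)))"
        unfolding comp_at_def by (simp only: if_True refl)
    qed
    also have "\<dots> = comp_at (i+1) (bdry i f) R g"
      unfolding comp_at_def bdry_eval[OF g(1) i(2)] using g(2) by (simp only: if_True refl)
    finally show ?thesis .
  next
    case False
    have "comp_at (i+1) (bdry i f) R g = 0"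
      unfolding comp_at_def using False bdry_out by (simp only: split: if_splits) blast
    moreover have "bd (comp_at i f) R g = 0"
      using False faceD[OF F] IA_out[OF i1(4,3) faceD(1)[OF F]] by blast
    ultimately show ?thesis by simp
  qed
qed

lemma bdry_bdry:
  assumes i: "N \<le> i" "i + 1 < M" and f: "f \<in> IAM i"
  shows "bdry (i+1) (bdry i f) = 0"
proof
  fix g
  have i1: "1 \<le> i" "i \<le> M" "i < M" "N \<le> i + 1" using i N by auto
  show "bdry (i+1) (bdry i f) g = 0 g"
  proof (cases "g permutes {1..M}")
    case True
    define R where "R = g ` {1..i+1+1}"
    have R: "card R = i + 1 + 1" "R \<subseteq> {1..M}" "finite R"
      unfolding R_def using image_init[OF True, of "i+1+1"] i by simp_all
    have "bdry (i+1) (bdry i f) g = comp_at (i+1+1) (bdry (i+1) (bdry i f)) R g"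
      unfolding comp_at_def R_def by simp
    also have "\<dots> = bd (comp_at (i+1) (bdry i f)) R g"
      using comp_at_bdry[OF i1(4) i(2) bdry_IA[OF i(1) i1(3) f] R(2,1)] by simp
    also have "bd (comp_at (i+1) (bdry i f)) R = bd (bd (comp_at i f)) R"
      using R by (intro IAcube.bd_cong comp_at_bdry[OF i(1) i1(3) f, symmetric]) auto
    also have "\<dots> = 0"
    proof (rule IAcube.bd_bd[OF R(2)])
      fix x y assume "x \<in> R" "y \<in> R" "x \<noteq> y"
      then have "card (R - {x} - {y}) = i" using R by simp
      then show "comp_at i f (R - {x} - {y}) \<in> cube_A (R - {x} - {y})"
        using comp_at_face[OF i1(1,2) f, of "R - {x} - {y}"] cube_A_face[of "R - {x} - {y}"] i by simp
    qed
    finally show ?thesis .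
  qed (simp add: bdry_out)
qed

text \<open>This is \<open>cube_exact_range\<close> for the full set {1..M} with g = N+1 in degree
  i+1: the bound 2(N+1) \<le> i+2 becomes 2N \<le> i.\<close>

lemma bdry_exact:
  assumes iso: "\<And>n. N \<le> n \<Longrightarrow> \<exists>F. cstab_iso s V \<rho> \<phi> n F"
    and i: "2 * N \<le> i" "i + 1 < M"
  shows "bdry i ` IAM i = {x \<in> IAM (i+1). bdry (i+1) x = 0}"
proof
  have i1: "1 \<le> i" "i \<le> M" "i < M" "N \<le> i" "N \<le> i + 1" "1 \<le> i + 1" "i + 1 \<le> M" using i N by auto
  show "bdry i ` IAM i \<subseteq> {x \<in> IAM (i+1). bdry (i+1) x = 0}"
    using bdry_IA[OF i1(4,3)] bdry_bdry[OF i1(4) i(2)] by blast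
  show "{x \<in> IAM (i+1). bdry (i+1) x = 0} \<subseteq> bdry i ` IAM i"
  proof
    fix x assume "x \<in> {x \<in> IAM (i+1). bdry (i+1) x = 0}"
    then have x: "x \<in> IAM (i+1)" "bdry (i+1) x = 0" by auto
    have ex: "cube_exact cube_A (\<lambda>_. {0}) cube_\<iota> {1..M} (i+1)"
    proof (rule cube_exact_range[OF IAcube.cube_axioms, of "N+1"])
      fix Y :: "nat set" assume Y: "Y \<subseteq> {1..M}"
      show "cube_exact cube_A (\<lambda>_. {0}) cube_\<iota> Y (card Y)" if "N + 1 \<le> card Y"
      proof -
        have n: "N \<le> card Y - 1" "card Y = (card Y - 1) + 1" using that by auto
        then show ?thesis using iso[OF n(1)] exact_top[OF Y n(2,1)] by auto
      qed
      show "cube_exact cube_A (\<lambda>_. {0}) cube_\<iota> Y (card Y - 1)" if "Suc (N + 1) \<le> card Y"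
      proof -
        have n: "N \<le> card Y - 2" "card Y = (card Y - 2) + 2" "N \<le> card Y - 2 + 1" "card Y - 1 = card Y - 2 + 1"
          using that by auto
        obtain F where "cstab_iso s V \<rho> \<phi> (card Y - 2 + 1) F" using iso[OF n(3)] by blast
        then show ?thesis using exact_below_top[OF Y n(2,1)] n(4) by metis
      qed
    qed (use i in auto)
    obtain e where e: "\<And>R. R \<subseteq> {1..M} \<Longrightarrow> Suc (card R) = i + 1 \<Longrightarrow> e R \<in> cube_A R"
      "\<And>R. R \<subseteq> {1..M} \<Longrightarrow> card R = i + 1 \<Longrightarrow> comp_at (i+1) x R - bd e R \<in> {0}"
    proof (rule cube_exactE[OF ex, of "comp_at (i+1) x"], goal_cases)
      case (1 R)
      then show ?case using comp_at_face[OF i1(6,7) x(1), of R] cube_A_face[of R] i1 by simp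
    next
      case (2 R)
      then have "bd (comp_at (i+1) x) R = comp_at (i+1+1) 0 R"
        using comp_at_bdry[OF i1(5) i(2) x(1), of R] x(2) by simp
      then show ?case by (simp add: comp_at_def fun_eq_iff)
    next
      case (3 e)
      show ?case by (rule 3(1)[OF 3(2,3)])
    qed
    have ef: "e R \<in> face i R" if "R \<subseteq> {1..M}" "card R = i" for R
      using e(1)[OF that(1)] that(2) cube_A_face[of R] i1 by simp
    have gR: "g ` {1..i} \<subseteq> {1..M}" "card (g ` {1..i}) = i" if "g permutes {1..M}" for g
      using image_init[OF that i1(2)] by simp_all
    have eI: "e (g ` {1..i}) \<in> IAM i" if "g permutes {1..M}" for g
      using faceD(1)[OF ef[OF gR[OF that]]] .
    \<comment> \<open>Each permutation belongs to exactly one face, so the components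
      \<open>e R\<close> glue to a single function.\<close>
    define y where "y g = (if g permutes {1..M} then e (g ` {1..i}) g else 0)" for g
    have y: "y \<in> IAM i"
    proof (rule IAI[OF i1(1,2)])
      fix g assume g: "g permutes {1..M}"
      show "y g \<in> V i" unfolding y_def using IA_V[OF i1(1,2) eI[OF g] g] g by simp
      show "y (g \<circ> \<sigma>) = \<rho> i (inv \<sigma>) (y g)" if "\<sigma> permutes {1..i}" for \<sigma>
        unfolding y_def image_young[OF that]
        using IA_\<sigma>[OF i1(1,2) eI[OF g] g that] g permutes_young[OF g that i1(2)] by simp
      show "y (g \<circ> \<tau>) = s (of_int (sign \<tau>)) (y g)" if "\<tau> permutes {i+1..M}" for \<tau>
        unfolding y_def image_young'[OF that]
        using IA_\<tau>[OF i1(1,2) eI[OF g] g that] g permutes_young'[OF g that] by simp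
    qed (simp add: y_def)
    have cy: "comp_at i y R = e R" if R: "R \<subseteq> {1..M}" "card R = i" for R
    proof
      fix g show "comp_at i y R g = e R g"
        unfolding comp_at_def y_def using faceD(2)[OF ef[OF R], of g] IA_out[OF i1(1,2) faceD(1)[OF ef[OF R]], of g]
        by auto
    qed
    have "x = bdry i y"
    proof
      fix g show "x g = bdry i y g"
      proof (cases "g permutes {1..M}")
        case True
        define R where "R = g ` {1..i+1}"
        have R: "R \<subseteq> {1..M}" "card R = i + 1" "finite R"
          unfolding R_def using image_init[OF True, of "i+1"] i1 by simp_all
        have "comp_at (i+1) x R - bd e R = 0" using e(2)[OF R(1,2)] by (simp only: singleton_iff)
        then have "comp_at (i+1) x R = bd e R" by (simp only: right_minus_eq)
        also have "\<dots> = bd (comp_at i y) R"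
          using R by (intro IAcube.bd_cong cy[symmetric]) auto
        also have "\<dots> = comp_at (i+1) (bdry i y) R"
          by (rule comp_at_bdry[OF i1(4,3) y R(1,2)])
        finally have "comp_at (i+1) x R g = comp_at (i+1) (bdry i y) R g" by simp
        then show ?thesis unfolding comp_at_def R_def by simp
      next
        case False
        then show ?thesis using IA_out[OF i1(6,7) x(1) False] bdry_out[OF False] by simp
      qed
    qed
    then show "x \<in> bdry i ` IAM i" using y by blast
  qed
qed

section \<open>Identification with the defined boundary map\<close>

lemma adjoin_inside:
  assumes i: "N \<le> i" "i < M" and f: "f \<in> face i R" and x: "x \<in> R" "x \<in> {1..M}" and R: "card R = i"
  shows "adjoin i x f = 0"
proof
  fix g
  have F: "adjoin i x f \<in> face (i+1) R" using adjoin_face[OF i f x(2)] x(1) by (simp add: insert_absorb)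
  show "adjoin i x f g = 0 g"
  proof (cases "g permutes {1..M}")
    case True
    \<comment> \<open>The left side has i+1 elements and R only i, so the face containing the result
      is zero.\<close>
    then have "g ` {1..i+1} \<noteq> R" using card_image_init[OF True, of "i+1"] R by auto
    then show ?thesis using faceD(2)[OF F] by simp
  qed (simp add: adjoin_0)
qed

text \<open>Both sides lie in the face of \<sigma>, so they are compared at \<sigma> itself. There
  the sign enters on the left through the covariance of the inclusion of v.\<close>

lemma adjoin_incl:
  assumes i: "N \<le> i" "i < M" and v: "v \<in> V i" and \<sigma>: "\<sigma> permutes {i+1..M}"
  shows "adjoin i (\<sigma> (i+1)) (incl i v) = fun_scale s (of_int (sign \<sigma>)) (ind_act \<sigma> (incl (i+1) (\<phi> i v)))"
proof -
  have i1: "1 \<le> i" "i \<le> M" "1 \<le> i + 1" "i + 1 \<le> M" using i N by auto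
  have \<sigma>M: "\<sigma> permutes {1..M}" using permutes_subset[OF \<sigma>] by simp
  have im: "\<sigma> ` {1..i+1} = insert (\<sigma> (i+1)) {1..i}"
  proof -
    have "{1..i+1} = insert (i+1) {1..i}" by auto
    moreover have "\<sigma> ` {1..i} = {1..i}" using image_young'[OF \<sigma>, of id] by simp
    ultimately show ?thesis by simp
  qed
  have pv: "\<phi> i v \<in> V (i+1)" using \<phi>_V[OF i1(1) v] .
  note inc = incl_face[OF i1(1,2) v]
  have "\<sigma> (i+1) \<in> {1..M}" using permutes_in_image[OF \<sigma>M, of "i+1"] i by simp
  then have L: "adjoin i (\<sigma> (i+1)) (incl i v) \<in> face (i+1) (\<sigma> ` {1..i+1})"
    unfolding im by (rule adjoin_face[OF i inc])
  have R: "fun_scale s (of_int (sign \<sigma>)) (ind_act \<sigma> (incl (i+1) (\<phi> i v))) \<in> face (i+1) (\<sigma> ` {1..i+1})"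
    by (intro face_fun_scale[OF i1(3,4)] ind_act_face[OF i1(3,4) incl_face[OF i1(3,4) pv] \<sigma>M])
  have "incl i v (id \<circ> \<sigma>) = s (of_int (sign \<sigma>)) (\<rho> i (inv id) v)"
    by (rule incl_young[OF i1(2) permutes_id \<sigma>])
  then have "incl i v \<sigma> = s (of_int (sign \<sigma>)) v" using \<rho>_id[OF i1(1) v] by simp
  then have "adjoin i (\<sigma> (i+1)) (incl i v) \<sigma> = s (of_int (sign \<sigma>)) (\<phi> i v)"
    using adjoin_at[OF i \<sigma>M refl faceD(1)[OF inc]] \<phi>_scale[OF i1(1) v] by simp
  moreover have "ind_act \<sigma> (incl (i+1) (\<phi> i v)) \<sigma> = \<phi> i v"
    using incl_id[OF i1(3,4) pv] permutes_inv_o(2)[OF \<sigma>M] by (simp add: ind_act_def)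
  ultimately show ?thesis
    by (intro face_eqI[OF i1(3,4) L R \<sigma>M refl]) (simp add: fun_scale_def)
qed

lemma bdry_incl:
  assumes i: "N \<le> i" "i < M" and v: "v \<in> V i"
    and C: "left_coset_reps (symgrp {i+1..M}) (symgrp {i+2..M}) C"
  shows "bdry i (incl i v) =
    (\<Sum>\<sigma>\<in>C. fun_scale s (of_int (sign \<sigma>)) (ind_act \<sigma> (incl (i+1) (\<phi> i v))))"
proof -
  have i1: "1 \<le> i" "i \<le> M" "i + 1 \<le> M" using i N by auto
  have CG: "c permutes {i+1..M}" if "c \<in> C" for c using C that unfolding left_coset_reps_def by auto
  have "bdry i (incl i v) = (\<Sum>x\<in>{i+1..M}. adjoin i x (incl i v))"
    unfolding bdry_def
    by (rule sum.mono_neutral_right) (auto intro!: adjoin_inside[OF i incl_face[OF i1(1,2) v]])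
  also have "\<dots> = (\<Sum>\<sigma>\<in>C. adjoin i (\<sigma> (i+1)) (incl i v))"
    by (rule sum.reindex_bij_betw[OF left_coset_reps_bij[OF C i1(3)], symmetric])
  also have "\<dots> = (\<Sum>\<sigma>\<in>C. fun_scale s (of_int (sign \<sigma>)) (ind_act \<sigma> (incl (i+1) (\<phi> i v))))"
    by (rule sum.cong[OF refl]) (rule adjoin_incl[OF i v CG])
  finally show ?thesis .
qed

lemma is_boundary_map_bdry:
  assumes i: "N \<le> i" "i < M"
  shows "is_boundary_map s V \<rho> \<phi> M i (restrict (bdry i) (IAM i))"
proof -
  have i1: "1 \<le> i" "i \<le> M" using i N by auto
  show ?thesis
    unfolding is_boundary_map_def
  proof (intro conjI allI impI ballI)
    show "restrict (bdry i) (IAM i) \<in> IAM i \<rightarrow>\<^sub>E IAM (i+1)"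
      using bdry_IA[OF i] by auto
    show "linear_map_on (fun_scale s) (fun_scale s) (IAM i) (restrict (bdry i) (IAM i))"
      unfolding linear_map_on_def
      using add_subgroup_add[OF IA_subgroup[OF i1]] IA_fun_scale[OF i1] by (simp only: restrict_apply if_True bdry_add bdry_scale ball_simps simp_thms) simp
    show "equivariant_on (S M) (IAM i) ind_act ind_act (restrict (bdry i) (IAM i))"
      unfolding equivariant_on_def using ind_act_IA[OF i1] bdry_act by simp
    fix C v assume C: "left_coset_reps (symgrp {i+1..M}) (symgrp {i+2..M}) C" and v: "v \<in> V i"
    show "restrict (bdry i) (IAM i) (incl i v) =
        (\<Sum>\<sigma>\<in>C. fun_scale s (of_int (sign \<sigma>)) (ind_act \<sigma> (incl (i+1) (\<phi> i v))))"
      using faceD(1)[OF incl_face[OF i1 v]] bdry_incl[OF i v C] by simp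
  qed
qed

lemma IA_decomp:
  assumes i: "1 \<le> i" "i \<le> M" and f: "f \<in> IAM i"
  shows "f = (\<Sum>R\<in>{R. R \<subseteq> {1..M} \<and> card R = i}. comp_at i f R)"
proof
  fix g
  have fin: "finite {R. R \<subseteq> {1..M} \<and> card R = i}" by simp
  show "f g = (\<Sum>R\<in>{R. R \<subseteq> {1..M} \<and> card R = i}. comp_at i f R) g"
  proof (cases "g permutes {1..M}")
    case True
    have "g ` {1..i} \<subseteq> {1..M}" "card (g ` {1..i}) = i"
      using image_init[OF True i(2)] by simp_all
    then show ?thesis unfolding sum_fun_apply comp_at_def using fin by simp
  next
    case False
    then show ?thesis unfolding sum_fun_apply comp_at_def using IA_out[OF i f False] by simp
  qed
qed

text \<open>The induced representation is generated by the translates of \<open>V i\<close>: the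
  component of f over R is the translate by \<open>g R\<close> of the inclusion of
  \<open>f (g R)\<close>. Additivity, equivariance and the values on \<open>V i\<close> thus yield a
  formula for \<open>D f\<close> in which D no longer occurs.\<close>

lemma is_boundary_map_unique:
  assumes i: "N \<le> i" "i < M"
    and d: "is_boundary_map s V \<rho> \<phi> M i d" and d': "is_boundary_map s V \<rho> \<phi> M i d'"
  shows "d = d'"
proof -
  have i1: "1 \<le> i" "i \<le> M" using i N by auto
  define C where "C = (\<lambda>b. transpose (i+1) b) ` {i+1..M}"
  have C: "left_coset_reps (symgrp {i+1..M}) (symgrp {i+2..M}) C"
    unfolding C_def using i by (intro left_coset_reps_transpose) simp
  define I where "I = {R. R \<subseteq> {1..M} \<and> card R = i}"
  have *: "D f = (\<Sum>R\<in>I. ind_act (g R) (\<Sum>\<sigma>\<in>C. fun_scale s (of_int (sign \<sigma>)) (ind_act \<sigma> (incl (i+1) (\<phi> i (f (g R)))))))"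
    if D: "is_boundary_map s V \<rho> \<phi> M i D" and f: "f \<in> IAM i"
      and g: "\<And>R. R \<in> I \<Longrightarrow> g R permutes {1..M} \<and> g R ` {1..i} = R" for D f g
  proof -
    have D_add: "D (f1 + f2) = D f1 + D f2" if "f1 \<in> IAM i" "f2 \<in> IAM i" for f1 f2
      using D that unfolding is_boundary_map_def linear_map_on_def by blast
    have D_act: "D (ind_act p f1) = ind_act p (D f1)" if "p permutes {1..M}" "f1 \<in> IAM i" for p f1
      using D that unfolding is_boundary_map_def equivariant_on_def by blast
    have D_incl: "D (incl i v) = (\<Sum>\<sigma>\<in>C. fun_scale s (of_int (sign \<sigma>)) (ind_act \<sigma> (incl (i+1) (\<phi> i v))))"
      if "v \<in> V i" for v
      using D C that unfolding is_boundary_map_def by blast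
    have z: "0 \<in> IAM i" using add_subgroup_zero[OF IA_subgroup[OF i1]] .
    have D_0: "D 0 = 0" using D_add[OF z z] by simp
    have D_sum: "D (sum h J) = (\<Sum>x\<in>J. D (h x))" if "\<And>x. x \<in> J \<Longrightarrow> h x \<in> IAM i" for h :: "nat set \<Rightarrow> _" and J
      using that
    proof (induction J rule: infinite_finite_induct)
      case (insert x J)
      have "sum h J \<in> IAM i" using insert.prems by (intro add_subgroup_sum[OF IA_subgroup[OF i1]]) auto
      then have "D (h x + sum h J) = D (h x) + D (sum h J)" using insert.prems by (intro D_add) auto
      moreover have "D (sum h J) = (\<Sum>x\<in>J. D (h x))" using insert.prems by (intro insert.IH) auto
      ultimately show ?case by (simp only: sum.insert[OF insert.hyps])
    qed (simp_all only: sum.infinite sum.empty D_0 not_False_eq_True)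
    have comp: "comp_at i f R = ind_act (g R) (incl i (f (g R)))" if R: "R \<in> I" for R
    proof -
      have gR: "g R permutes {1..M}" "g R ` {1..i} = R" using g[OF R] by auto
      have v: "f (g R) \<in> V i" using IA_V[OF i1 f gR(1)] .
      show ?thesis
        using face_eqI[OF i1 comp_at_face[OF i1 f] ex_face(1)[OF i1 gR(1) v, unfolded gR(2)] gR]
          ex_face(2)[OF i1 gR(1) v] gR(2) by (simp add: comp_at_def)
    qed
    have "D f = (\<Sum>R\<in>I. D (comp_at i f R))"
      using arg_cong[OF IA_decomp[OF i1 f], of D] D_sum[of I "comp_at i f", OF faceD(1)[OF comp_at_face[OF i1 f]]]
      unfolding I_def by (simp only:)
    also have "\<dots> = (\<Sum>R\<in>I. ind_act (g R) (\<Sum>\<sigma>\<in>C. fun_scale s (of_int (sign \<sigma>)) (ind_act \<sigma> (incl (i+1) (\<phi> i (f (g R)))))))"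
    proof (rule sum.cong[OF refl])
      fix R assume R: "R \<in> I"
      have gR: "g R permutes {1..M}" using g[OF R] by blast
      have v: "f (g R) \<in> V i" using IA_V[OF i1 f gR] .
      show "D (comp_at i f R) = ind_act (g R) (\<Sum>\<sigma>\<in>C. fun_scale s (of_int (sign \<sigma>)) (ind_act \<sigma> (incl (i+1) (\<phi> i (f (g R))))))"
        unfolding comp[OF R] D_act[OF gR faceD(1)[OF incl_face[OF i1 v]]] D_incl[OF v] ..
    qed
    finally show ?thesis .
  qed
  have "\<exists>g. R \<in> I \<longrightarrow> g permutes {1..M} \<and> g ` {1..i} = R" for R
    using ex_permutes_image[of R M] unfolding I_def by blast
  then obtain g where g: "\<And>R. R \<in> I \<Longrightarrow> g R permutes {1..M} \<and> g R ` {1..i} = R" by metis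
  show ?thesis
  proof (rule PiE_ext)
    show "d \<in> IAM i \<rightarrow>\<^sub>E IAM (i+1)" "d' \<in> IAM i \<rightarrow>\<^sub>E IAM (i+1)"
      using d d' unfolding is_boundary_map_def by blast+
    show "d f = d' f" if "f \<in> IAM i" for f
      by (rule trans[OF *[OF d that g] *[OF d' that g, symmetric]])
  qed
qed

lemma boundary_eq:
  assumes i: "N \<le> i" "i < M"
  shows "boundary s V \<rho> \<phi> M i = restrict (bdry i) (IAM i)"
  unfolding boundary_def
  by (rule the_equality) (use is_boundary_map_bdry[OF i] is_boundary_map_unique[OF i] in auto)

end

theorem proposition4p5:
  fixes s :: "'f::field \<Rightarrow> 'v::ab_group_add \<Rightarrow> 'v"
    and V :: "nat \<Rightarrow> 'v set"
    and \<rho> :: "nat \<Rightarrow> (nat \<Rightarrow> nat) \<Rightarrow> 'v \<Rightarrow> 'v"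
    and \<phi> :: "nat \<Rightarrow> 'v \<Rightarrow> 'v"
    and N n m M :: nat
  assumes "vector_space s"
    and "coherent_sequence s V \<rho> \<phi>"
    and "centrally_stable_from s V \<rho> \<phi> N"
    and "CHAR('f) = 0 \<or> CHAR('f) \<ge> 2 * N + 2"
    and "2 * N + 1 \<le> n" and "n \<le> m" and "m \<le> M"
  shows "\<forall>i. n < i \<and> i < m \<longrightarrow>
    boundary s V \<rho> \<phi> M (i - 1) ` IA s (i - 1) (M - (i - 1)) (V (i - 1)) (\<rho> (i - 1)) =
    {x \<in> IA s i (M - i) (V i) (\<rho> i). boundary s V \<rho> \<phi> M i x = 0}"
proof (intro allI impI)
  interpret coherent_seq s V \<rho> \<phi>
    using assms(1,2) by (simp add: coherent_seq_def coherent_seq_axioms_def)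
  have N: "2 \<le> N" and iso: "\<And>n. N \<le> n \<Longrightarrow> \<exists>F. cstab_iso s V \<rho> \<phi> n F"
    using assms(3) by (auto simp: centrally_stable_from_def)
  \<comment> \<open>The domain \<open>V i\<close> is only a subspace, while the cube maps are to be
    additive on the whole type, so each (a, i+1) \<cdot> \<phi> is extended linearly. For indices
    out of range the zero map serves.\<close>
  have "\<exists>g. (\<forall>v w. g (v + w) = g v + g w) \<and> (\<forall>c v. g (s c v) = s c (g v)) \<and>
      (N \<le> i \<longrightarrow> a \<in> {1..i+1} \<longrightarrow> (\<forall>v\<in>V i. g v = \<rho> (i+1) (transpose a (i+1)) (\<phi> i v)))" for i a
  proof (cases "N \<le> i \<and> a \<in> {1..i+1}")
    case True
    then have i: "1 \<le> i" "1 \<le> i + 1" and a: "transpose a (i+1) permutes {1..i+1}"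
      using N by (auto intro!: permutes_swap_id)
    have "\<exists>g. (\<forall>v w. g (v + w) = g v + g w) \<and> (\<forall>c v. g (s c v) = s c (g v)) \<and>
        (\<forall>v\<in>V i. g v = \<rho> (i+1) (transpose a (i+1)) (\<phi> i v))"
      using \<phi>_V[OF i(1)] \<phi>_add[OF i(1)] \<phi>_scale[OF i(1)] \<rho>_add[OF i(2) a] \<rho>_scale[OF i(2) a]
      by (intro ex_linear_extension V_subspace[OF i(1)]) auto
    then show ?thesis by blast
  qed (intro exI[of _ "\<lambda>_. 0"], auto)
  then obtain T where T: "\<And>i a v w. T i a (v + w) = T i a v + T i a w" "\<And>i a c v. T i a (s c v) = s c (T i a v)"
    "\<And>i a v. N \<le> i \<Longrightarrow> a \<in> {1..i+1} \<Longrightarrow> v \<in> V i \<Longrightarrow> T i a v = \<rho> (i+1) (transpose a (i+1)) (\<phi> i v)"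
    by metis
  interpret stable_sequence s V \<rho> \<phi> N M T
  proof
    show "1 \<le> N" using N by simp
    show "\<rho> (i+2) (transpose (i+1) (i+2)) (\<phi> (i+1) (\<phi> i v)) = \<phi> (i+1) (\<phi> i v)" if "N \<le> i" "v \<in> V i" for i v
      using iso[of "i+1"] cstab_invariant[of i _ v] that N by auto
  qed (fact T)+
  fix i assume i: "n < i \<and> i < m"
  \<comment> \<open>From i > n \<ge> 2N+1 it follows that k \<ge> 2N+1, which covers the bound 2N
    \<le> k, and i < m \<le> M gives k+1 < M, so both boundary maps at the term i are
    defined.\<close>
  define k where "k = i - 1"
  have k: "i = k + 1" "i - 1 = k" "2 * N \<le> k" "k + 1 < M" "N \<le> k" "k < M" "N \<le> k + 1"
    using i assms(5-7) unfolding k_def by auto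
  have "restrict (bdry k) (IAM k) ` IAM k = bdry k ` IAM k" by (rule image_cong) simp_all
  also have "\<dots> = {x \<in> IAM (k+1). bdry (k+1) x = 0}" by (rule bdry_exact[OF iso k(3,4)])
  also have "\<dots> = {x \<in> IAM (k+1). restrict (bdry (k+1)) (IAM (k+1)) x = 0}"
    by (rule Collect_cong) (auto simp only: restrict_apply if_True)
  finally have "boundary s V \<rho> \<phi> M k ` IAM k = {x \<in> IAM (k+1). boundary s V \<rho> \<phi> M (k+1) x = 0}"
    unfolding boundary_eq[OF k(5,6)] boundary_eq[OF k(7,4)] .
  then show "boundary s V \<rho> \<phi> M (i - 1) ` IAM (i - 1) = {x \<in> IAM i. boundary s V \<rho> \<phi> M i x = 0}"
    unfolding k(1)[symmetric] k(2) .
qed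

end
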